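(* The space of left $\mathcal{O}_q(\mathrm{SU}_3)$-coinvariant $2$-forms $\{\omega\in\Omega^2_q(\mathrm{F}_3):\Delta_L(\omega)=1\otimes\omega\}$ is three-dimensional. The corresponding space of $\mathcal{O}(\mathbb{T}^2)$-coinvariant degree-$2$ elements of the quantum exterior algebra $V^\bullet$ is spanned by $$f_{\alpha_1}\wedge e_{\alpha_1},\qquad f_{\alpha_2}\wedge e_{\alpha_2},\qquad f_{\alpha_1+\alpha_2}\wedge e_{\alpha_1+\alpha_2}.$$
   Context: Let $q\in\mathbb{R}\setminus\{-1,0,1\}$. Let $\Delta^+=\{\alpha_1,\alpha_2,\alpha_1+\alpha_2\}$ be the positive roots of $\mathfrak{sl}_3$, with Cartan matrix $a_{11}=a_{22}=2$, $a_{12}=a_{21}=-1$. $U_q(\mathfrak{sl}_3)$ is the complex algebra generated by $E_i,F_i,K_i^{\pm1}$ ($i=1,2$) with $K_iK_j=K_jK_i$, $K_iE_j=q^{a_{ij}}E_jK_i$, $K_iF_j=q^{-a_{ij}}F_jK_i$, $[E_i,F_j]=\delta_{ij}\frac{K_i-K_i^{-1}}{q-q^{-1}}$, and $E_i^2E_j-(q+q^{-1})E_iE_jE_i+E_jE_i^2=0$, $F_i^2F_j-(q+q^{-1})F_iF_jF_i+F_jF_i^2=0$ for $i\ne j$. It is a Hopf $*$-algebra with $\Delta(E_i)=E_i\otimes K_i+1\otimes E_i$, $\Delta(F_i)=F_i\otimes1+K_i^{-1}\otimes F_i$, $\Delta(K_i)=K_i\otimes K_i$, $\varepsilon(E_i)=\varepsilon(F_i)=0$,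 $\varepsilon(K_i)=1$, $E_i^*=K_iF_i$, $F_i^*=E_iK_i^{-1}$, $K_i^*=K_i$. $A:=\mathcal{O}_q(\mathrm{SU}_3)$ is the Hopf subalgebra of the Hopf dual of $U_q(\mathfrak{sl}_3)$ generated by $u_{ij}$ ($1\le i,j\le3$), where $\Delta(u_{ij})=\sum_a u_{ia}\otimes u_{aj}$ and the only nonzero pairings of the $u_{ij}$ with the generators are $\langle E_1,u_{21}\rangle=\langle E_2,u_{32}\rangle=\langle F_1,u_{12}\rangle=\langle F_2,u_{23}\rangle=1$, $\langle K_i^{\pm1},u_{jj}\rangle=q^{\pm(\delta_{i,j-1}-\delta_{ij})}$. Put $X\triangleright a:=a_{(1)}\langle X,a_{(2)}\rangle$. Then $B:=\mathcal{O}_q(\mathrm{F}_3):=\{b\in A: K_i^{\pm1}\triangleright b=b,\ i=1,2\}$, a quantum homogeneous space with $\pi_B(A):=A/B^+A\cong\mathcal{O}(\mathbb{T}^2)$ (written $\mathcal{O}_q(\mathbb{T}^2)$ in places). Put $E_{\alpha_i}:=E_i$, $E_{\alpha_1+\alpha_2}:=E_2E_1-q^{-1}E_1E_2$, $F_\gamma:=E_\gamma^*$, and $T:=\mathrm{span}_{\mathbb{C}}\{E_\gamma,F_\gamma:\gamma\in\Delta^+\}$. $T$ defines the left $A$-covariant first-order differential calculus $\Omega^1_q(\mathrm{SU}_3)=A\otimes\Lambda^1$ over $A$: $\Lambda^1:=A^+/\{y\in A^+:X(y)=0\ \forall X\in T\}$ (with $A^+=\ker\varepsilon$) is a right $A$-module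 with basis $\{e_\gamma,f_\gamma\}$ dual to $\{E_\gamma,F_\gamma\}$, the bimodule structure is $a(b\otimes v)c=abc_{(1)}\otimes vc_{(2)}$, the left coaction is $\Delta\otimes\mathrm{id}$, and $\mathrm{d}a=\sum_\gamma (E_\gamma\triangleright a)\otimes e_\gamma+(F_\gamma\triangleright a)\otimes f_\gamma$. $\Omega^1_q(\mathrm{F}_3)$ is its restriction to $B$ (the $B$-sub-bimodule generated by $\mathrm{d}b$, $b\in B$), and $\Omega^\bullet_q(\mathrm{F}_3)$ is the maximal prolongation: the quotient of the tensor algebra of the $B$-bimodule $\Omega^1_q(\mathrm{F}_3)$ by the ideal generated by all $\sum_i\mathrm{d}b_i\otimes\mathrm{d}c_i$ with $\sum_ib_i\,\mathrm{d}c_i=0$; $\Delta_L$ is its left $A$-coaction. With $I:=\{y\in B^+:X(y)=0\ \forall X\in T\}$ the cotangent space is $V^1:=B^+/I$, with left $\pi_B(A)$-coaction $[b]\mapsto\pi_B(b_{(1)})\otimes[b_{(2)}]$, identified with $\Lambda^1$ via $[b]\mapsto[b]$ (an isomorphism). For $a\in A$ write $a^+:=a-\varepsilon(a)1$. The quantum exterior algebra is $V^\bullet:=\mathcal{T}(V^1)/\langle I^{(2)}\rangle$, $I^{(2)}:=\{[y_{(1)}^+]\otimes[y_{(2)}^+]:y\in I\}$, with product $\wedge$ and the induced $\pi_B(A)$-coaction. Takeuchi's equivalence identifies $\Omega^k_q(\mathrm{F}_3)$ with $A\square_{\pi_B(A)}V^k$, and coinvariant $k$-forms correspond to elements $1\otimes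 v$ with $v\in V^k$ coinvariant. *)

theory Defs
  imports Complex_Main
    "HOL-Library.Poly_Mapping"
    "HOL-Library.Function_Algebras"
    "HOL-Library.Product_Plus"
begin

section \<open>Free algebras and their quotients\<close>

text \<open>Words form a monoid under concatenation, written additively because
  \<open>'k \<Rightarrow>\<^sub>0 complex\<close> is the monoid algebra of an additively written monoid.
  Thus \<open>'a word \<Rightarrow>\<^sub>0 complex\<close> is the free unital complex algebra on \<open>'a\<close>,
  i.e. the tensor algebra of the free vector space on \<open>'a\<close>.\<close>

datatype 'a word = Word (letters: "'a list")

instantiation word :: (type) monoid_add
begin

definition zero_word :: "'a word" where "0 = Word []"

definition plus_word :: "'a word \<Rightarrow> 'a word \<Rightarrow> 'a word"
  where "v + w = Word (letters v @ letters w)"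

instance by standard (simp_all add: zero_word_def plus_word_def)

end

type_synonym 'a free_alg = "'a word \<Rightarrow>\<^sub>0 complex"

definition mon :: "'a word \<Rightarrow> 'a free_alg"
  where "mon w = Poly_Mapping.single w 1"

definition lett :: "'a \<Rightarrow> 'a free_alg"
  where "lett x = mon (Word [x])"

definition fscale :: "complex \<Rightarrow> ('k \<Rightarrow>\<^sub>0 complex) \<Rightarrow> ('k \<Rightarrow>\<^sub>0 complex)"
  where "fscale c x = Poly_Mapping.map ((*) c) x"

lemma lookup_fscale [simp]:
  "Poly_Mapping.lookup (fscale c x) k = c * Poly_Mapping.lookup x k"
  unfolding fscale_def by transfer (simp add: when_def)

global_interpretation flin: vector_space fscale
  by standard (auto intro!: poly_mapping_eqI simp: lookup_add algebra_simps)

definition ideal_gen :: "'a set \<Rightarrow> 'a free_alg set \<Rightarrow> 'a free_alg set"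
  where "ideal_gen M S = flin.span {mon u * s * mon v | u s v.
     set (letters u) \<subseteq> M \<and> s \<in> S \<and> set (letters v) \<subseteq> M}"

definition cls :: "'v::ab_group_add set \<Rightarrow> 'v \<Rightarrow> 'v set"
  where "cls J x = {y. y - x \<in> J}"

definition qspan :: "('k \<Rightarrow>\<^sub>0 complex) set \<Rightarrow> ('k \<Rightarrow>\<^sub>0 complex) set set \<Rightarrow> ('k \<Rightarrow>\<^sub>0 complex) set set"
  where "qspan J S = cls J ` flin.span {x. cls J x \<in> S}"

text \<open>\<open>Q\<close> is an \<open>n\<close>-dimensional space of cosets of \<open>J\<close>, with basis
  \<open>cls J (b 0), \<dots>, cls J (b (n - 1))\<close>.\<close>

definition qdim :: "('k \<Rightarrow>\<^sub>0 complex) set \<Rightarrow> ('k \<Rightarrow>\<^sub>0 complex) set set \<Rightarrow> nat \<Rightarrow> bool"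
  where "qdim J Q n \<longleftrightarrow> (\<exists>b.
     Q = qspan J ((\<lambda>i. cls J (b i)) ` {..<n}) \<and>
     (\<forall>c. cls J (\<Sum>i<n. fscale (c i) (b i)) = cls J 0 \<longrightarrow> (\<forall>i<n. c i = 0)))"


section \<open>The Hopf algebra \<open>U\<^sub>q(sl\<^sub>3)\<close>\<close>

datatype node = N1 | N2

fun num :: "node \<Rightarrow> nat"
  where "num N1 = 1" | "num N2 = 2"

datatype gen = E node | F node | K node | Kinv node

definition cartan :: "node \<Rightarrow> node \<Rightarrow> int"
  where "cartan i j = (if i = j then 2 else -1)"

definition Uq_rels :: "real \<Rightarrow> gen free_alg set"
  where "Uq_rels q = (let q = complex_of_real q;
       e = \<lambda>i. lett (E i); f = \<lambda>i. lett (F i); k = \<lambda>i. lett (K i); k' = \<lambda>i. lett (Kinv i) in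
     {k i * k' i - 1 | i. True} \<union> {k' i * k i - 1 | i. True} \<union>
     {k i * k j - k j * k i | i j. True} \<union>
     {k i * e j - fscale (q powi cartan i j) (e j * k i) | i j. True} \<union>
     {k i * f j - fscale (q powi (- cartan i j)) (f j * k i) | i j. True} \<union>
     {e i * f j - f j * e i - (if i = j then fscale (1 / (q - 1 / q)) (k i - k' i) else 0) | i j. True} \<union>
     {e i * e i * e j - fscale (q + 1 / q) (e i * e j * e i) + e j * e i * e i | i j. i \<noteq> j} \<union>
     {f i * f i * f j - fscale (q + 1 / q) (f i * f j * f i) + f j * f i * f i | i j. i \<noteq> j})"

definition Uq_ideal :: "real \<Rightarrow> gen free_alg set"
  where "Uq_ideal q = ideal_gen UNIV (Uq_rels q)"

text \<open>The structure maps are given on the free algebra; they descend to the quotient by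
  \<^const>\<open>Uq_ideal\<close>. The tensor square of the free algebra is the monoid algebra of the monoid of
  pairs of words. The antipode is the one determined by the coproduct.\<close>

fun cop_gen :: "gen \<Rightarrow> gen word \<times> gen word \<Rightarrow>\<^sub>0 complex"
  where
    "cop_gen (E i) = Poly_Mapping.single (Word [E i], Word [K i]) 1 + Poly_Mapping.single (0, Word [E i]) 1"
  | "cop_gen (F i) = Poly_Mapping.single (Word [F i], 0) 1 + Poly_Mapping.single (Word [Kinv i], Word [F i]) 1"
  | "cop_gen (K i) = Poly_Mapping.single (Word [K i], Word [K i]) 1"
  | "cop_gen (Kinv i) = Poly_Mapping.single (Word [Kinv i], Word [Kinv i]) 1"

definition cop_word :: "gen word \<Rightarrow> gen word \<times> gen word \<Rightarrow>\<^sub>0 complex"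
  where "cop_word w = prod_list (map cop_gen (letters w))"

fun eps_gen :: "gen \<Rightarrow> complex"
  where "eps_gen (E i) = 0" | "eps_gen (F i) = 0" | "eps_gen (K i) = 1" | "eps_gen (Kinv i) = 1"

fun antipode_gen :: "gen \<Rightarrow> gen free_alg"
  where
    "antipode_gen (E i) = - (lett (E i) * lett (Kinv i))"
  | "antipode_gen (F i) = - (lett (K i) * lett (F i))"
  | "antipode_gen (K i) = lett (Kinv i)"
  | "antipode_gen (Kinv i) = lett (K i)"

definition antipode_word :: "gen word \<Rightarrow> gen free_alg"
  where "antipode_word w = prod_list (rev (map antipode_gen (letters w)))"

fun star_gen :: "gen \<Rightarrow> gen free_alg"
  where
    "star_gen (E i) = lett (K i) * lett (F i)"
  | "star_gen (F i) = lett (E i) * lett (Kinv i)"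
  | "star_gen (K i) = lett (K i)"
  | "star_gen (Kinv i) = lett (Kinv i)"

definition star :: "gen free_alg \<Rightarrow> gen free_alg"
  where "star X = (\<Sum>w\<in>Poly_Mapping.keys X.
     fscale (cnj (Poly_Mapping.lookup X w)) (prod_list (rev (map star_gen (letters w)))))"


section \<open>The Hopf dual and \<open>O\<^sub>q(SU\<^sub>3)\<close>\<close>

text \<open>A linear functional on the free algebra is given by its values on words; functionals on
  \<open>U\<^sub>q(sl\<^sub>3)\<close> are those vanishing on \<^const>\<open>Uq_ideal\<close>. Addition of functionals is pointwise, but
  their product is the convolution \<open>\<star>\<close>, not the pointwise product \<open>*\<close>.\<close>

type_synonym fnl = "gen word \<Rightarrow> complex"

definition pair :: "gen free_alg \<Rightarrow> fnl \<Rightarrow> complex"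
  where "pair X a = (\<Sum>w\<in>Poly_Mapping.keys X. Poly_Mapping.lookup X w * a w)"

definition csc :: "complex \<Rightarrow> fnl \<Rightarrow> fnl"
  where "csc c a = (\<lambda>w. c * a w)"

definition conv :: "fnl \<Rightarrow> fnl \<Rightarrow> fnl"  (infixl \<open>\<star>\<close> 70)
  where "a \<star> b = (\<lambda>w. \<Sum>p\<in>Poly_Mapping.keys (cop_word w).
     Poly_Mapping.lookup (cop_word w) p * a (fst p) * b (snd p))"

definition unit :: fnl
  where "unit = (\<lambda>w. prod_list (map eps_gen (letters w)))"

definition antip :: "fnl \<Rightarrow> fnl"
  where "antip a = (\<lambda>w. pair (antipode_word w) a)"

definition counit :: "fnl \<Rightarrow> complex"
  where "counit a = a 0"

definition plus_part :: "fnl \<Rightarrow> fnl"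
  where "plus_part a = a - csc (counit a) unit"

text \<open>\<open>sweedler H H' a ps\<close>: the finite list \<open>ps\<close> of pairs in \<open>H \<times> H'\<close> represents the coproduct
  \<open>a\<^sub>(\<^sub>1\<^sub>) \<otimes> a\<^sub>(\<^sub>2\<^sub>)\<close>, which is characterised by
  \<open>\<langle>XY, a\<rangle> = \<langle>X, a\<^sub>(\<^sub>1\<^sub>)\<rangle> \<langle>Y, a\<^sub>(\<^sub>2\<^sub>)\<rangle>\<close>.\<close>

definition sweedler :: "fnl set \<Rightarrow> fnl set \<Rightarrow> fnl \<Rightarrow> (fnl \<times> fnl) list \<Rightarrow> bool"
  where "sweedler H H' a ps \<longleftrightarrow> set ps \<subseteq> H \<times> H' \<and>
     (\<forall>X Y. a (X + Y) = (\<Sum>(x, y)\<leftarrow>ps. x X * y Y))"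

definition Uq_dual :: "real \<Rightarrow> fnl set"
  where "Uq_dual q = {a. \<forall>X\<in>Uq_ideal q. pair X a = 0}"

definition hopf_dual :: "real \<Rightarrow> fnl set"
  where "hopf_dual q = {a \<in> Uq_dual q. \<exists>ps. sweedler (Uq_dual q) (Uq_dual q) a ps}"

definition hopf_subalgebra :: "real \<Rightarrow> fnl set \<Rightarrow> bool"
  where "hopf_subalgebra q H \<longleftrightarrow> H \<subseteq> hopf_dual q \<and> unit \<in> H \<and>
     (\<forall>a\<in>H. \<forall>b\<in>H. a + b \<in> H \<and> a \<star> b \<in> H) \<and>
     (\<forall>a\<in>H. (\<forall>c. csc c a \<in> H) \<and> antip a \<in> H \<and> (\<exists>ps. sweedler H H a ps))"

fun u_gen :: "real \<Rightarrow> gen \<Rightarrow> nat \<Rightarrow> nat \<Rightarrow> complex"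
  where
    "u_gen q (E i) k l = of_bool (k = num i + 1 \<and> l = num i)"
  | "u_gen q (F i) k l = of_bool (k = num i \<and> l = num i + 1)"
  | "u_gen q (K i) k l = (if k = l
       then complex_of_real q powi (of_bool (l = num i + 1) - of_bool (l = num i)) else 0)"
  | "u_gen q (Kinv i) k l = (if k = l
       then complex_of_real q powi (- (of_bool (l = num i + 1) - of_bool (l = num i))) else 0)"

fun u_list :: "real \<Rightarrow> nat \<Rightarrow> nat \<Rightarrow> gen list \<Rightarrow> complex"
  where
    "u_list q k l [] = of_bool (k = l)"
  | "u_list q k l (g # gs) = (\<Sum>m\<in>{1..3}. u_gen q g k m * u_list q m l gs)"

definition u_coef :: "real \<Rightarrow> nat \<Rightarrow> nat \<Rightarrow> fnl"
  where "u_coef q k l = (\<lambda>w. u_list q k l (letters w))"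

definition OqSU3 :: "real \<Rightarrow> fnl set"
  where "OqSU3 q = \<Inter>{H. hopf_subalgebra q H \<and> (\<forall>k\<in>{1..3}. \<forall>l\<in>{1..3}. u_coef q k l \<in> H)}"

definition OqSU3_plus :: "real \<Rightarrow> fnl set"
  where "OqSU3_plus q = {a \<in> OqSU3 q. counit a = 0}"

text \<open>\<open>X \<triangleright> a = a\<^sub>(\<^sub>1\<^sub>) \<langle>X, a\<^sub>(\<^sub>2\<^sub>)\<rangle>\<close>, i.e. \<open>\<langle>Y, X \<triangleright> a\<rangle> = \<langle>YX, a\<rangle>\<close>.\<close>

definition act :: "gen free_alg \<Rightarrow> fnl \<Rightarrow> fnl"  (infixr \<open>\<triangleright>\<close> 75)
  where "X \<triangleright> a = (\<lambda>Y. pair (mon Y * X) a)"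

definition OqF3 :: "real \<Rightarrow> fnl set"
  where "OqF3 q = {b \<in> OqSU3 q. \<forall>i. lett (K i) \<triangleright> b = b \<and> lett (Kinv i) \<triangleright> b = b}"

definition OqF3_plus :: "real \<Rightarrow> fnl set"
  where "OqF3_plus q = {b \<in> OqF3 q. counit b = 0}"

text \<open>The subspace \<open>B\<^sup>+A\<close> of \<open>A\<close>, the kernel of \<open>\<pi>\<^sub>B\<close>.\<close>

definition BplusA :: "real \<Rightarrow> fnl set"
  where "BplusA q = {\<Sum>(b, a)\<leftarrow>ps. b \<star> a | ps. set ps \<subseteq> OqF3_plus q \<times> OqSU3 q}"


section \<open>First-order calculus\<close>

datatype root = A1 | A2 | A12

datatype rvec = Eix root | Fix root

fun Evec :: "real \<Rightarrow> root \<Rightarrow> gen free_alg"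
  where
    "Evec q A1 = lett (E N1)"
  | "Evec q A2 = lett (E N2)"
  | "Evec q A12 = lett (E N2) * lett (E N1)
       - fscale (1 / complex_of_real q) (lett (E N1) * lett (E N2))"

fun Xvec :: "real \<Rightarrow> rvec \<Rightarrow> gen free_alg"
  where
    "Xvec q (Eix \<gamma>) = Evec q \<gamma>"
  | "Xvec q (Fix \<gamma>) = star (Evec q \<gamma>)"

definition Tspace :: "real \<Rightarrow> gen free_alg set"
  where "Tspace q = flin.span (range (Xvec q))"

text \<open>The class of \<open>y \<in> A\<^sup>+\<close> in \<open>\<Lambda>\<^sup>1 = A\<^sup>+/{y. X(y) = 0 for X \<in> T}\<close>, written in coordinates with
  respect to the basis dual to the root vectors: the quotient by the kernel is realised as the
  image of \<open>y \<mapsto> (X(y))\<^sub>X\<close>.\<close>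

type_synonym coords = "rvec \<Rightarrow> complex"

definition cot :: "real \<Rightarrow> fnl \<Rightarrow> coords"
  where "cot q y = (\<lambda>r. pair (Xvec q r) y)"

definition unitvec :: "rvec \<Rightarrow> coords"
  where "unitvec r = (\<lambda>s. of_bool (s = r))"

definition e_form :: "root \<Rightarrow> coords" where "e_form \<gamma> = unitvec (Eix \<gamma>)"
definition f_form :: "root \<Rightarrow> coords" where "f_form \<gamma> = unitvec (Fix \<gamma>)"

text \<open>\<open>Lambda_act q r c\<close> is the product of the basis vector \<open>r\<close> of \<open>\<Lambda>\<^sup>1\<close> with \<open>c \<in> A\<close>,
  computed as \<open>[y] c = [y c]\<close> on a representative.\<close>

definition Lambda_rep :: "real \<Rightarrow> rvec \<Rightarrow> fnl"
  where "Lambda_rep q r = (SOME y. y \<in> OqSU3_plus q \<and> cot q y = unitvec r)"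

definition Lambda_act :: "real \<Rightarrow> rvec \<Rightarrow> fnl \<Rightarrow> coords"
  where "Lambda_act q r c = cot q (Lambda_rep q r \<star> c)"

text \<open>An element \<open>\<Sum>\<^sub>r a\<^sub>r \<otimes> r\<close> of \<open>A \<otimes> \<Lambda>\<^sup>1\<close> is the family of its coefficients \<open>a\<^sub>r \<in> A\<close>.\<close>

type_synonym form1 = "rvec \<Rightarrow> fnl"

definition lmult :: "fnl \<Rightarrow> form1 \<Rightarrow> form1"
  where "lmult b \<omega> = (\<lambda>r. b \<star> \<omega> r)"

definition rmult :: "real \<Rightarrow> form1 \<Rightarrow> fnl \<Rightarrow> form1"
  where "rmult q \<omega> c = (\<lambda>s. \<Sum>r\<in>UNIV.
     \<Sum>(c1, c2)\<leftarrow>(SOME ps. sweedler (OqSU3 q) (OqSU3 q) c ps).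
       csc (Lambda_act q r c2 s) (\<omega> r \<star> c1))"

definition diff :: "real \<Rightarrow> fnl \<Rightarrow> form1"
  where "diff q a = (\<lambda>r. Xvec q r \<triangleright> a)"

inductive_set Omega1 :: "real \<Rightarrow> form1 set" for q
  where
    diff: "b \<in> OqF3 q \<Longrightarrow> diff q b \<in> Omega1 q"
  | add: "\<omega> \<in> Omega1 q \<Longrightarrow> \<eta> \<in> Omega1 q \<Longrightarrow> \<omega> + \<eta> \<in> Omega1 q"
  | left: "b \<in> OqF3 q \<Longrightarrow> \<omega> \<in> Omega1 q \<Longrightarrow> lmult b \<omega> \<in> Omega1 q"
  | right: "b \<in> OqF3 q \<Longrightarrow> \<omega> \<in> Omega1 q \<Longrightarrow> rmult q \<omega> b \<in> Omega1 q"


section \<open>Tensor algebras and coactions on them\<close>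

text \<open>For a complex vector space with carrier \<open>M\<close> and scaling \<open>sc\<close>, the tensor algebra \<open>T(M)\<close> is
  the free algebra on the letters \<open>M\<close> modulo the linear relations \<open>lin_rels sc M\<close>;
  \<open>words_deg M k\<close> spans its component of degree \<open>k\<close>.\<close>

definition lin_rels :: "(complex \<Rightarrow> 'm \<Rightarrow> 'm) \<Rightarrow> 'm::plus set \<Rightarrow> 'm free_alg set"
  where "lin_rels sc M = {lett (x + y) - lett x - lett y | x y. x \<in> M \<and> y \<in> M} \<union>
     {lett (sc c x) - fscale c (lett x) | c x. x \<in> M}"

definition words_on :: "'m set \<Rightarrow> 'm free_alg set"
  where "words_on M = {x. \<forall>w\<in>Poly_Mapping.keys x. set (letters w) \<subseteq> M}"

definition words_deg :: "'m set \<Rightarrow> nat \<Rightarrow> 'm free_alg set"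
  where "words_deg M k = {x \<in> words_on M. \<forall>w\<in>Poly_Mapping.keys x. length (letters w) = k}"

text \<open>\<open>A \<otimes> T\<close>, for \<open>T\<close> with basis the words, is the space of finitely supported \<open>A\<close>-valued
  functions on words.\<close>

definition otimes :: "fnl \<Rightarrow> 'm free_alg \<Rightarrow> 'm word \<Rightarrow>\<^sub>0 fnl"
  where "otimes a x = Poly_Mapping.map (\<lambda>c. csc c a) x"

definition otimes_set :: "fnl set \<Rightarrow> 'm free_alg set \<Rightarrow> ('m word \<Rightarrow>\<^sub>0 fnl) set"
  where "otimes_set N P = {\<Sum>(a, x)\<leftarrow>ps. otimes a x | ps. set ps \<subseteq> N \<times> P}"

text \<open>A coaction \<open>\<delta>\<close> on letters, with values represented by finite lists of elementary tensors,
  is extended by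
  \<open>m\<^sub>1 \<dots> m\<^sub>k \<mapsto> (m\<^sub>1)\<^sub>(\<^sub>-\<^sub>1\<^sub>) \<dots> (m\<^sub>k)\<^sub>(\<^sub>-\<^sub>1\<^sub>) \<otimes> (m\<^sub>1)\<^sub>(\<^sub>0\<^sub>) \<dots> (m\<^sub>k)\<^sub>(\<^sub>0\<^sub>)\<close>.\<close>

fun coact_list :: "('m \<Rightarrow> (fnl \<times> 'm) list) \<Rightarrow> 'm list \<Rightarrow> (fnl \<times> 'm list) list"
  where
    "coact_list \<delta> [] = [(unit, [])]"
  | "coact_list \<delta> (m # ms) =
       concat (map (\<lambda>(a, n). map (\<lambda>(b, ns). (a \<star> b, n # ns)) (coact_list \<delta> ms)) (\<delta> m))"

definition coact :: "('m \<Rightarrow> (fnl \<times> 'm) list) \<Rightarrow> 'm free_alg \<Rightarrow> 'm word \<Rightarrow>\<^sub>0 fnl"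
  where "coact \<delta> x = (\<Sum>w\<in>Poly_Mapping.keys x.
     \<Sum>(a, ms)\<leftarrow>coact_list \<delta> (letters w).
       Poly_Mapping.single (Word ms) (csc (Poly_Mapping.lookup x w) a))"

text \<open>The elements of degree \<open>k\<close> of the quotient by \<open>J\<close> that are coinvariant for the induced left
  coaction of the quotient \<open>H/N\<close>. Here \<open>(H/N) \<otimes> (T/J)\<close> is the quotient of \<open>H \<otimes> T\<close> by
  \<open>N \<otimes> T + H \<otimes> J\<close>. The values of \<open>\<delta>\<close> matter only up to this subspace.\<close>

definition coinvariants ::
  "fnl set \<Rightarrow> fnl set \<Rightarrow> ('m \<Rightarrow> (fnl \<times> 'm) list) \<Rightarrow> 'm set \<Rightarrow> 'm free_alg set \<Rightarrow> nat \<Rightarrow> 'm free_alg set set"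
  where "coinvariants H N \<delta> M J k = (let Z = {s + t | s t. s \<in> otimes_set N (words_on M) \<and> t \<in> otimes_set H J}
     in {cls J x | x. x \<in> words_deg M k \<and> cls Z (coact \<delta> x) = cls Z (otimes unit x)})"


section \<open>The maximal prolongation \<open>\<Omega>\<^sup>\<bullet>\<^sub>q(F\<^sub>3)\<close>\<close>

text \<open>In degrees \<open>k \<ge> 1\<close>, the tensor algebra of the \<open>B\<close>-bimodule \<open>\<Omega>\<^sup>1\<close> is the complex tensor algebra
  of \<open>\<Omega>\<^sup>1\<close> modulo the ideal generated by the balancing relations
  \<open>\<omega>b \<otimes> \<eta> - \<omega> \<otimes> b\<eta>\<close>. (Its degree \<open>0\<close> component is \<open>B\<close> and not \<open>\<complex>\<close>, which is why the generators of
  the second ideal are multiplied by elements of \<open>B\<close> on both sides.)\<close>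

definition balance_rels :: "real \<Rightarrow> form1 free_alg set"
  where "balance_rels q = {lett (rmult q \<omega> b) * lett \<eta> - lett \<omega> * lett (lmult b \<eta>) | \<omega> b \<eta>.
     \<omega> \<in> Omega1 q \<and> b \<in> OqF3 q \<and> \<eta> \<in> Omega1 q}"

definition prolongation_rels :: "real \<Rightarrow> form1 free_alg set"
  where "prolongation_rels q =
     {\<Sum>(b, c)\<leftarrow>ps. lett (lmult x (diff q b)) * lett (rmult q (diff q c) y) | ps x y.
        set ps \<subseteq> OqF3 q \<times> OqF3 q \<and> (\<Sum>(b, c)\<leftarrow>ps. lmult b (diff q c)) = 0 \<and>
        x \<in> OqF3 q \<and> y \<in> OqF3 q}"

definition Omega_ideal :: "real \<Rightarrow> form1 free_alg set"
  where "Omega_ideal q = ideal_gen (Omega1 q)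
     (lin_rels (\<lambda>c \<omega> r. csc c (\<omega> r)) (Omega1 q) \<union> balance_rels q \<union> prolongation_rels q)"

text \<open>\<open>\<Delta>\<^sub>L(\<Sum>\<^sub>r a\<^sub>r \<otimes> r) = \<Sum>\<^sub>r (a\<^sub>r)\<^sub>(\<^sub>1\<^sub>) \<otimes> ((a\<^sub>r)\<^sub>(\<^sub>2\<^sub>) \<otimes> r)\<close>, as a finite list of elements of
  \<open>A \<times> \<Omega>\<^sup>1\<close>.\<close>

definition coact_form :: "real \<Rightarrow> form1 \<Rightarrow> (fnl \<times> form1) list"
  where "coact_form q \<omega> = (SOME ps. set ps \<subseteq> OqSU3 q \<times> Omega1 q \<and>
     (\<forall>X Y r. \<omega> r (X + Y) = (\<Sum>(a, \<eta>)\<leftarrow>ps. a X * \<eta> r Y)))"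

text \<open>The left \<open>O\<^sub>q(SU\<^sub>3)\<close>-coinvariant \<open>k\<close>-forms, for \<open>k \<ge> 1\<close>.\<close>

definition Omega_coinv :: "real \<Rightarrow> nat \<Rightarrow> form1 free_alg set set"
  where "Omega_coinv q k =
     coinvariants (OqSU3 q) {0} (coact_form q) (Omega1 q) (Omega_ideal q) k"


section \<open>The quantum exterior algebra \<open>V\<^sup>\<bullet>\<close>\<close>

definition cot_ideal :: "real \<Rightarrow> fnl set"
  where "cot_ideal q = {y \<in> OqF3_plus q. \<forall>X\<in>Tspace q. pair X y = 0}"

text \<open>\<open>V\<^sup>1 = B\<^sup>+/I\<close>, with \<open>I\<close> = \<^const>\<open>cot_ideal\<close>, realised as the image of \<open>B\<^sup>+\<close> in \<open>\<Lambda>\<^sup>1\<close>.\<close>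

definition V1 :: "real \<Rightarrow> coords set"
  where "V1 q = cot q ` OqF3_plus q"

definition I2 :: "real \<Rightarrow> coords free_alg set"
  where "I2 q = {\<Sum>(y1, y2)\<leftarrow>ps. lett (cot q (plus_part y1)) * lett (cot q (plus_part y2)) | y ps.
     y \<in> cot_ideal q \<and> sweedler (OqSU3 q) (OqSU3 q) y ps}"

definition V_ideal :: "real \<Rightarrow> coords free_alg set"
  where "V_ideal q = ideal_gen (V1 q) (lin_rels (\<lambda>c v r. c * v r) (V1 q) \<union> I2 q)"

definition coact_cot :: "real \<Rightarrow> coords \<Rightarrow> (fnl \<times> coords) list"
  where "coact_cot q v = (SOME ps. \<exists>b qs. b \<in> OqF3_plus q \<and> cot q b = v \<and>
     sweedler (OqSU3 q) (OqF3 q) b qs \<and> ps = map (\<lambda>(x, y). (x, cot q (plus_part y))) qs)"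

text \<open>The elements of \<open>V\<^sup>k\<close> coinvariant for \<open>\<pi>\<^sub>B(A) = A/B\<^sup>+A\<close>.\<close>

definition V_coinv :: "real \<Rightarrow> nat \<Rightarrow> coords free_alg set set"
  where "V_coinv q k =
     coinvariants (OqSU3 q) (BplusA q) (coact_cot q) (V1 q) (V_ideal q) k"

definition wedge :: "real \<Rightarrow> coords \<Rightarrow> coords \<Rightarrow> coords free_alg set"
  where "wedge q v w = cls (V_ideal q) (lett v * lett w)"

end

theory Submission
  imports Defs
begin

text \<open>Everything is reduced to the finite-dimensional space \<open>W\<close> of matrices
  \<open>(\<langle>X\<^sub>t X\<^sub>s, y\<rangle>)\<^sub>t\<^sub>s\<close>, \<open>y \<in> I\<close>, indexed by pairs of root vectors. The coproducts
  \<open>\<Delta>(X\<^sub>s) = \<Sum>\<^sub>r X\<^sub>r \<otimes> G\<^sub>r\<^sub>s + 1 \<otimes> X\<^sub>s\<close> give \<open>V\<^sup>2 = \<complex>\<^sup>6\<^sup>\<times>\<^sup>6/W\<close>, and \<open>\<Omega>\<^sup>2\<close> embeds into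
  \<open>A \<otimes> (\<complex>\<^sup>6\<^sup>\<times>\<^sup>6/W)\<close> by moving the coefficients of the second factor to the left; the inverse uses
  \<open>a \<otimes> [b] = \<Sum> a S(b\<^sub>(\<^sub>1\<^sub>)) d b\<^sub>(\<^sub>2\<^sub>)\<close>, whose coefficients lie in \<open>B\<close> when \<open>a\<close> and \<open>b\<close> have the same weight.
  On both sides coinvariance forces the matrix to have weight zero modulo \<open>W\<close>. The weight-zero
  matrices are spanned by \<open>e\<^sub>\<gamma> \<otimes> f\<^sub>\<gamma>\<close> and \<open>f\<^sub>\<gamma> \<otimes> e\<^sub>\<gamma>\<close>; the elements \<open>u\<^sub>i\<^sub>j S(u\<^sub>j\<^sub>i)\<close> of \<open>I\<close> express the former through
  the latter modulo \<open>W\<close>, and the commutators \<open>[E\<^sub>\<gamma>, F\<^sub>\<gamma>]\<close> show that the latter remain independent.\<close>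

section \<open>Linear extension from a monoid basis\<close>

text \<open>The algebra A is given only as an intersection of Hopf subalgebras, while the right
  action, both coactions and the representatives in Lambda^1 are fixed by arbitrary choice. The
  first obstacle is met by showing that A is the span of an inductively generated class of elements
  that have a weight under each K_i on either side and whose coproducts have matching inner weights;
  weights can then be followed through every formula. The second is met by extracting from each
  choice an identity that all choices share, and by testing elements of A \<otimes> T with
  functionals. Torus coinvariance is tested at the group-like K_i: elements of B take the same value
  there as at 1, so B^+A is annihilated, and since |q| is neither 0 nor 1 the powers of q separate
  weights. Conversely, a coefficient of weight \<mu> with counit zero lies in B^+A when 1 is a sum
  of products of elements of weights -\<mu> and \<mu>, which is shown for all sums of roots. The
  inverse of the embedding of two-forms must have coefficients in B. This is the reason why W is
  decomposed by weight and why weights are attached to every coproduct that is chosen.\<close>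

definition lsum :: "('k \<Rightarrow> complex) \<Rightarrow> ('k \<Rightarrow>\<^sub>0 complex) \<Rightarrow> complex"
  where "lsum f x = (\<Sum>k\<in>Poly_Mapping.keys x. Poly_Mapping.lookup x k * f k)"

text \<open>Cancellation can shrink the support of a sum, so supports are compared inside a common
  finite set that contains them.\<close>

lemma lsum_superset:
  assumes "finite S" "Poly_Mapping.keys x \<subseteq> S"
  shows "lsum f x = (\<Sum>k\<in>S. Poly_Mapping.lookup x k * f k)"
  unfolding lsum_def using assms
  by (intro sum.mono_neutral_left) (auto simp: in_keys_iff)

lemma lsum_add [simp]: "lsum f (x + y) = lsum f x + lsum f y"
proof -
  let ?S = "Poly_Mapping.keys x \<union> Poly_Mapping.keys y"
  have "lsum f z = (\<Sum>k\<in>?S. Poly_Mapping.lookup z k * f k)" if "z \<in> {x, y, x + y}" for z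
    using that keys_add[of x y] by (intro lsum_superset) auto
  then show ?thesis
    by (simp add: lookup_add algebra_simps sum.distrib)
qed

lemma lsum_zero [simp]: "lsum f 0 = 0"
  by (simp add: lsum_def)

lemma lsum_single [simp]: "lsum f (Poly_Mapping.single k c) = c * f k"
  by (cases "c = 0") (simp_all add: lsum_def)

lemma lsum_fscale [simp]: "lsum f (fscale c x) = c * lsum f x"
proof -
  have "lsum f (fscale c x) = (\<Sum>k\<in>Poly_Mapping.keys x. Poly_Mapping.lookup (fscale c x) k * f k)"
    by (intro lsum_superset) (auto simp: in_keys_iff)
  then show ?thesis
    by (simp add: lsum_def sum_distrib_left mult.assoc)
qed

lemma lsum_uminus [simp]: "lsum f (- x) = - lsum f x"
  using lsum_add[of f x "- x"] by (simp add: eq_neg_iff_add_eq_0 add.commute)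

lemma lsum_minus [simp]: "lsum f (x - y) = lsum f x - lsum f y"
  using lsum_add[of f x "- y"] by simp

lemma lsum_sum [simp]: "lsum f (sum g S) = (\<Sum>i\<in>S. lsum f (g i))"
  by (induction S rule: infinite_finite_induct) auto

lemma lsum_sum_list: "lsum f (\<Sum>i\<leftarrow>is. g i) = (\<Sum>i\<leftarrow>is. lsum f (g i))"
  by (induction "is") auto

lemma poly_mapping_decomp: "x = (\<Sum>k\<in>Poly_Mapping.keys x. Poly_Mapping.single k (Poly_Mapping.lookup x k))"
  for x :: "'k \<Rightarrow>\<^sub>0 'b::comm_monoid_add"
proof (rule poly_mapping_eqI)
  fix k
  show "Poly_Mapping.lookup x k = Poly_Mapping.lookup (\<Sum>k\<in>Poly_Mapping.keys x. Poly_Mapping.single k (Poly_Mapping.lookup x k)) k"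
    by (simp add: lookup_sum lookup_single when_def in_keys_iff)
qed

lemma poly_mapping_single_induct [case_names zero single add]:
  fixes x :: "'k \<Rightarrow>\<^sub>0 'b::comm_monoid_add"
  assumes "P 0" "\<And>k c. P (Poly_Mapping.single k c)" "\<And>x y. P x \<Longrightarrow> P y \<Longrightarrow> P (x + y)"
  shows "P x"
proof -
  have "P (\<Sum>k\<in>S. Poly_Mapping.single k (f k))" if "finite S" for S f
    using that by induction (auto intro: assms)
  from this[of "Poly_Mapping.keys x" "Poly_Mapping.lookup x"] show ?thesis
    by (subst poly_mapping_decomp) simp
qed

text \<open>Both sides are bilinear, so monomials suffice. Functionals on products are unfolded
  through this rule into iterated sums.\<close>

lemma lsum_mult: "lsum f (x * y) = lsum (\<lambda>k. lsum (\<lambda>l. f (k + l)) y) x"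
  for x y :: "'k::monoid_add \<Rightarrow>\<^sub>0 complex"
proof (induction x rule: poly_mapping_single_induct)
  case (single k c)
  show ?case
    by (induction y rule: poly_mapping_single_induct) (simp_all add: mult_single algebra_simps)
qed (simp_all add: algebra_simps)

lemma lsum_mult_left [simp]: "lsum (\<lambda>k. c * f k) x = c * lsum f x"
  by (simp add: lsum_def sum_distrib_left algebra_simps)

lemma lsum_mult_right [simp]: "lsum (\<lambda>k. f k * c) x = lsum f x * c"
  by (simp add: lsum_def sum_distrib_right algebra_simps)

lemma lsum_add_fun: "lsum (\<lambda>k. f k + g k) x = lsum f x + lsum g x"
  by (simp add: lsum_def sum.distrib algebra_simps)

lemma lsum_uminus_fun: "lsum (\<lambda>k. - f k) x = - lsum f x"
  using lsum_mult_left[of "-1" f x] by simp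

lemma lsum_zero_fun [simp]: "lsum (\<lambda>k. 0) x = 0"
  by (simp add: lsum_def)

lemma lsum_sum_list_fun: "lsum (\<lambda>k. \<Sum>i\<leftarrow>is. f i k) x = (\<Sum>i\<leftarrow>is. lsum (f i) x)"
  by (induction "is") (simp_all add: lsum_add_fun)

lemma lsum_mon [simp]: "lsum f (mon w) = f w"
  by (simp add: mon_def)

lemma lsum_lett [simp]: "lsum f (lett g) = f (Word [g])"
  by (simp add: lett_def)

lemma lsum_one [simp]: "lsum f 1 = f 0"
  using lsum_single[of f 0 1] by (simp del: lsum_single)

lemma pair_eq_lsum: "pair X a = lsum a X"
  by (simp add: pair_def lsum_def)

text \<open>Convolution is the pullback along \<open>cop_word\<close> of a functional on pairs of
  words; the linear extension \<open>lsum\<close> is kept over arbitrary index types for this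
  purpose.\<close>

lemma conv_eq_lsum: "(a \<star> b) w = lsum (\<lambda>p. a (fst p) * b (snd p)) (cop_word w)"
  by (simp add: conv_def lsum_def mult.assoc)

lemma word_plus [simp]: "Word xs + Word ys = Word (xs @ ys)"
  by (simp add: plus_word_def)

lemma letters_plus [simp]: "letters (v + w) = letters v @ letters w"
  by (simp add: plus_word_def)

lemma letters_zero [simp]: "letters 0 = []"
  by (simp add: zero_word_def)

lemma Word_Nil: "Word [] = 0"
  by (simp add: zero_word_def)

lemma word_induct [case_names zero plus]:
  assumes "P 0" "\<And>g w. P w \<Longrightarrow> P (Word [g] + w)"
  shows "P w"
proof (cases w)
  case (Word xs)
  have "P (Word xs)"
  proof (induction xs)
    case (Cons x xs)
    then show ?case using assms(2)[of "Word xs" x] by simp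
  qed (use assms(1) in \<open>simp add: Word_Nil\<close>)
  then show ?thesis by (simp add: Word)
qed

lemma word_rev_induct [case_names zero plus]:
  assumes "P 0" "\<And>g w. P w \<Longrightarrow> P (w + Word [g])"
  shows "P w"
proof (cases w)
  case (Word xs)
  have "P (Word xs)"
  proof (induction xs rule: rev_induct)
    case (snoc x xs)
    then show ?case using assms(2)[of "Word xs" x] by simp
  qed (use assms(1) in \<open>simp add: Word_Nil\<close>)
  then show ?thesis by (simp add: Word)
qed

section \<open>Functionals and their translates\<close>

lemma csc_apply [simp]: "csc c a w = c * a w"
  by (simp add: csc_def)

lemma csc_1 [simp]: "csc 1 a = a" and csc_0 [simp]: "csc 0 a = 0" and csc_zero [simp]: "csc c 0 = 0"
  and csc_csc [simp]: "csc c (csc d a) = csc (c * d) a"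
  and csc_add: "csc c (a + b) = csc c a + csc c b"
  and csc_minus: "csc c (a - b) = csc c a - csc c b"
  by (simp_all add: fun_eq_iff algebra_simps)

global_interpretation fn: vector_space csc
  by standard (simp_all add: fun_eq_iff algebra_simps)

text \<open>Transposes of multiplication by a generator on either side of a word. Relations of U_q
  become operator identities for them, so no quotient of the free algebra has to be formed.
  \<open>rt g\<close> after \<open>rt h\<close> belongs to the product gh, whereas
  \<open>lt g\<close> after \<open>lt h\<close> belongs to hg.\<close>

definition lt :: "gen \<Rightarrow> fnl \<Rightarrow> fnl" where "lt g a = (\<lambda>w. a (Word [g] + w))"
definition rt :: "gen \<Rightarrow> fnl \<Rightarrow> fnl" where "rt g a = (\<lambda>w. a (w + Word [g]))"

lemma lt_apply: "lt g a w = a (Word [g] + w)" and rt_apply: "rt g a w = a (w + Word [g])"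
  by (simp_all add: lt_def rt_def)

lemma lt_linear [simp]: "lt g (a + b) = lt g a + lt g b" "lt g (csc c a) = csc c (lt g a)"
  "lt g (a - b) = lt g a - lt g b" "lt g (- a) = - lt g a" "lt g 0 = 0"
  by (simp_all add: fun_eq_iff lt_def)

lemma rt_linear [simp]: "rt g (a + b) = rt g a + rt g b" "rt g (csc c a) = csc c (rt g a)"
  "rt g (a - b) = rt g a - rt g b" "rt g (- a) = - rt g a" "rt g 0 = 0"
  by (simp_all add: fun_eq_iff rt_def)

lemma act_apply: "(X \<triangleright> a) w = lsum (\<lambda>v. a (w + v)) X"
  by (simp add: act_def pair_eq_lsum lsum_mult)

lemma act_apply_0: "(X \<triangleright> a) 0 = pair X a"
  by (simp add: act_apply pair_eq_lsum)

lemma act_lett [simp]: "lett g \<triangleright> a = rt g a"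
  by (simp add: fun_eq_iff act_apply rt_def)

lemma act_mult [simp]: "(X * Y) \<triangleright> a = X \<triangleright> (Y \<triangleright> a)"
  by (simp add: fun_eq_iff act_apply lsum_mult add.assoc)

lemma act_1 [simp]: "1 \<triangleright> a = a"
  by (simp add: fun_eq_iff act_apply)

lemma act_linear_left [simp]: "(X + Y) \<triangleright> a = X \<triangleright> a + Y \<triangleright> a" "(X - Y) \<triangleright> a = X \<triangleright> a - Y \<triangleright> a"
  "(- X) \<triangleright> a = - (X \<triangleright> a)" "fscale c X \<triangleright> a = csc c (X \<triangleright> a)" "0 \<triangleright> a = 0"
  by (simp_all add: fun_eq_iff act_apply)

lemma act_linear [simp]: "X \<triangleright> (a + b) = X \<triangleright> a + X \<triangleright> b" "X \<triangleright> (csc c a) = csc c (X \<triangleright> a)" "X \<triangleright> 0 = 0"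
  by (simp_all add: fun_eq_iff act_apply lsum_add_fun)

lemma act_minus [simp]: "X \<triangleright> (a - b) = X \<triangleright> a - X \<triangleright> b"
proof -
  have "X \<triangleright> ((a - b) + b) = X \<triangleright> (a - b) + X \<triangleright> b" by (rule act_linear)
  then show ?thesis by simp
qed

lemma act_sum_list: "X \<triangleright> (\<Sum>i\<leftarrow>is. f i) = (\<Sum>i\<leftarrow>is. X \<triangleright> f i)"
  by (induction "is") (simp_all only: list.map sum_list.Nil sum_list.Cons act_linear)

lemma act_sum: "X \<triangleright> (\<Sum>i\<in>S. f i) = (\<Sum>i\<in>S. X \<triangleright> f i)"
  by (induction S rule: infinite_finite_induct) (simp_all only: sum.infinite sum.empty sum.insert act_linear not_False_eq_True)

lemma lt_act: "lt g (X \<triangleright> a) = X \<triangleright> lt g a"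
  by (simp add: fun_eq_iff lt_def act_apply add.assoc)

lemma sum_fun_apply [simp]: "(\<Sum>i\<in>S. f i) x = (\<Sum>i\<in>S. f i x)"
  by (induction S rule: infinite_finite_induct) simp_all

lemma sum_list_fun_apply: "(\<Sum>i\<leftarrow>is. f i) x = (\<Sum>i\<leftarrow>is. f i x)"
  by (induction "is") simp_all

section \<open>Convolution\<close>

lemma cop_word_plus: "cop_word (v + w) = cop_word v * cop_word w"
  by (simp add: cop_word_def)

lemma cop_word_0 [simp]: "cop_word 0 = 1"
  by (simp add: cop_word_def)

lemma cop_word_gen [simp]: "cop_word (Word [g]) = cop_gen g"
  by (simp add: cop_word_def)

lemma conv_add_left: "(a + a') \<star> b = a \<star> b + a' \<star> b" and conv_add_right: "a \<star> (b + b') = a \<star> b + a \<star> b'"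
  and conv_csc_left [simp]: "csc c a \<star> b = csc c (a \<star> b)" and conv_csc_right [simp]: "a \<star> csc c b = csc c (a \<star> b)"
  and conv_zero_left [simp]: "0 \<star> b = 0" and conv_zero_right [simp]: "a \<star> 0 = 0"
  by (simp_all add: fun_eq_iff conv_eq_lsum algebra_simps lsum_add_fun flip: lsum_mult_left)

lemma conv_uminus_left [simp]: "(- a) \<star> b = - (a \<star> b)" and conv_uminus_right [simp]: "a \<star> (- b) = - (a \<star> b)"
  using conv_csc_left[of "-1" a b] conv_csc_right[of a "-1" b] by (simp_all add: csc_def fun_Compl_def)

lemma conv_minus_left: "(a - a') \<star> b = a \<star> b - a' \<star> b" and conv_minus_right: "a \<star> (b - b') = a \<star> b - a \<star> b'"
  using conv_add_left[of a "- a'" b] conv_add_right[of a b "- b'"] by simp_all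

lemma conv_sum_left: "(\<Sum>i\<in>S. f i) \<star> b = (\<Sum>i\<in>S. f i \<star> b)"
  by (induction S rule: infinite_finite_induct) (simp_all only: sum.infinite sum.empty sum.insert conv_zero_left conv_add_left not_False_eq_True)

lemma conv_sum_right: "a \<star> (\<Sum>i\<in>S. f i) = (\<Sum>i\<in>S. a \<star> f i)"
  by (induction S rule: infinite_finite_induct) (simp_all only: sum.infinite sum.empty sum.insert conv_zero_right conv_add_right not_False_eq_True)

lemma conv_sum_list_left: "(\<Sum>i\<leftarrow>is. f i) \<star> b = (\<Sum>i\<leftarrow>is. f i \<star> b)"
  by (induction "is") (simp_all only: list.map sum_list.Nil sum_list.Cons conv_zero_left conv_add_left)

lemma conv_sum_list_right: "a \<star> (\<Sum>i\<leftarrow>is. f i) = (\<Sum>i\<leftarrow>is. a \<star> f i)"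
  by (induction "is") (simp_all only: list.map sum_list.Nil sum_list.Cons conv_zero_right conv_add_right)

lemma conv_0: "(a \<star> b) 0 = a 0 * b 0"
  by (simp add: conv_eq_lsum)

text \<open>The leading letter of a word contributes the leading factor of its coproduct, so
  \<open>cop_gen\<close> turns into a twisted Leibniz rule. Most later arguments use these rules
  instead of \<open>cop_word\<close>.\<close>

lemma lt_conv:
  "lt (E i) (a \<star> b) = lt (E i) a \<star> lt (K i) b + a \<star> lt (E i) b"
  "lt (F i) (a \<star> b) = lt (F i) a \<star> b + lt (Kinv i) a \<star> lt (F i) b"
  "lt (K i) (a \<star> b) = lt (K i) a \<star> lt (K i) b"
  "lt (Kinv i) (a \<star> b) = lt (Kinv i) a \<star> lt (Kinv i) b"
  by (simp_all add: fun_eq_iff lt_apply conv_eq_lsum cop_word_plus lsum_mult)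

lemma rt_conv:
  "rt (E i) (a \<star> b) = rt (E i) a \<star> rt (K i) b + a \<star> rt (E i) b"
  "rt (F i) (a \<star> b) = rt (F i) a \<star> b + rt (Kinv i) a \<star> rt (F i) b"
  "rt (K i) (a \<star> b) = rt (K i) a \<star> rt (K i) b"
  "rt (Kinv i) (a \<star> b) = rt (Kinv i) a \<star> rt (Kinv i) b"
  by (simp_all add: fun_eq_iff rt_apply conv_eq_lsum cop_word_plus lsum_mult lsum_add_fun)

text \<open>The value at gw is the value at w of the translate by g. Both bracketings obey the same
  Leibniz rules but mix translates of the factors, hence the induction over the word is general in
  all three functionals.\<close>

lemma conv_assoc: "(a \<star> b) \<star> c = a \<star> (b \<star> c)"
proof
  fix w
  show "((a \<star> b) \<star> c) w = (a \<star> (b \<star> c)) w"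
  proof (induction w arbitrary: a b c rule: word_induct)
    case zero
    show ?case by (simp add: conv_0)
  next
    case (plus g w)
    have "lt g ((a \<star> b) \<star> c) w = lt g (a \<star> (b \<star> c)) w"
      by (cases g) (simp_all add: lt_conv conv_add_left conv_add_right plus)
    then show ?case by (simp add: lt_apply)
  qed
qed

lemma unit_0 [simp]: "unit 0 = 1"
  by (simp add: unit_def)

lemma lt_unit [simp]: "lt g unit = csc (eps_gen g) unit" and rt_unit [simp]: "rt g unit = csc (eps_gen g) unit"
  by (simp_all add: fun_eq_iff lt_apply rt_apply unit_def)

lemma unit_conv [simp]: "unit \<star> a = a"
proof
  fix w
  show "(unit \<star> a) w = a w"
  proof (induction w arbitrary: a rule: word_induct)
    case zero
    show ?case by (simp add: conv_0)
  next
    case (plus g w)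
    have "lt g (unit \<star> a) w = lt g a w"
      by (cases g) (simp_all add: lt_conv conv_add_left conv_add_right plus)
    then show ?case by (simp add: lt_apply)
  qed
qed

lemma conv_unit [simp]: "a \<star> unit = a"
proof
  fix w
  show "(a \<star> unit) w = a w"
  proof (induction w arbitrary: a rule: word_induct)
    case zero
    show ?case by (simp add: conv_0)
  next
    case (plus g w)
    have "lt g (a \<star> unit) w = lt g a w"
      by (cases g) (simp_all add: lt_conv conv_add_left conv_add_right plus)
    then show ?case by (simp add: lt_apply)
  qed
qed

section \<open>The antipode\<close>

lemma antip_apply: "antip a w = lsum a (antipode_word w)"
  by (simp add: antip_def pair_eq_lsum)

lemma antip_0: "antip a 0 = a 0"
  by (simp add: antip_apply antipode_word_def)

lemma antip_linear [simp]: "antip (a + b) = antip a + antip b" "antip (csc c a) = csc c (antip a)"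
  "antip (- a) = - antip a" "antip 0 = 0"
  by (simp_all add: fun_eq_iff antip_apply lsum_add_fun lsum_uminus_fun plus_fun_def fun_Compl_def csc_def zero_fun_def)

lemma antip_minus [simp]: "antip (a - b) = antip a - antip b"
  using antip_linear(1)[of a "- b"] by simp

lemma antip_plus: "antip a (v + w) = lsum (\<lambda>p. lsum (\<lambda>p'. a (p + p')) (antipode_word v)) (antipode_word w)"
  by (simp add: antip_apply antipode_word_def flip: lsum_mult)

lemma antipode_word_gen [simp]: "antipode_word (Word [g]) = antipode_gen g"
  by (simp add: antipode_word_def)

text \<open>S reverses products, so translating S(a) on one side amounts to translating a on the
  other side by the image of the generator under S.\<close>

lemma lt_antip:
  "lt (E i) (antip a) = - antip (rt (E i) (rt (Kinv i) a))"
  "lt (F i) (antip a) = - antip (rt (K i) (rt (F i) a))"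
  "lt (K i) (antip a) = antip (rt (Kinv i) a)"
  "lt (Kinv i) (antip a) = antip (rt (K i) a)"
  by (simp_all add: fun_eq_iff lt_apply antip_plus lsum_mult lsum_uminus_fun) (simp_all add: antip_apply rt_def add.assoc)

lemma rt_antip:
  "rt (E i) (antip a) = - antip (lt (Kinv i) (lt (E i) a))"
  "rt (F i) (antip a) = - antip (lt (F i) (lt (K i) a))"
  "rt (K i) (antip a) = antip (lt (Kinv i) a)"
  "rt (Kinv i) (antip a) = antip (lt (K i) a)"
  by (simp_all add: fun_eq_iff rt_apply antip_plus lsum_mult lsum_uminus_fun) (simp_all add: antip_apply lt_def flip: add.assoc)

section \<open>Functionals on the quantised enveloping algebra\<close>

lemma mon_plus: "mon (v + w) = mon v * mon w"
  by (simp add: mon_def mult_single)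

lemma mon_0 [simp]: "mon 0 = 1"
  by (simp add: mon_def)

lemma mon_act_plus: "mon (Word [g] + v) \<triangleright> a = rt g (mon v \<triangleright> a)"
  by (simp add: mon_plus flip: lett_def)

lemma cartan_sym: "cartan i j = cartan j i"
  by (simp add: cartan_def)

locale quantum_parameter =
  fixes q :: real
  assumes q_generic: "q \<notin> {-1, 0, 1}"
begin

abbreviation qc :: complex where "qc \<equiv> complex_of_real q"

abbreviation D :: "fnl set" where "D \<equiv> Uq_dual q"

lemma q_nz [simp]: "q \<noteq> 0" "qc \<noteq> 0"
  using q_generic by auto

lemma q_sq [simp]: "qc * qc \<noteq> 1"
proof
  assume "qc * qc = 1"
  then have "q * q = 1" by (metis of_real_1 of_real_eq_iff of_real_mult)
  then show False using q_generic square_eq_1_iff[of q] by auto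
qed

lemma q_inv [simp]: "qc - 1 / qc \<noteq> 0"
  using q_sq by (simp add: field_simps)

text \<open>The two-sided multiples of the relations span the ideal, so a functional is tested on
  them only. In this form stability under translations is evident.\<close>

lemma Uq_dual_iff: "a \<in> D \<longleftrightarrow> (\<forall>u v. \<forall>r\<in>Uq_rels q. pair (mon u * r * mon v) a = 0)"
proof
  assume "a \<in> D"
  then show "\<forall>u v. \<forall>r\<in>Uq_rels q. pair (mon u * r * mon v) a = 0"
    by (auto simp: Uq_dual_def Uq_ideal_def ideal_gen_def intro!: flin.span_base)
next
  assume *: "\<forall>u v. \<forall>r\<in>Uq_rels q. pair (mon u * r * mon v) a = 0"
  have "flin.span {mon u * s * mon v | u s v. set (letters u) \<subseteq> UNIV \<and> s \<in> Uq_rels q \<and> set (letters v) \<subseteq> UNIV}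
      \<subseteq> {X. pair X a = 0}"
    using * by (intro flin.span_minimal) (auto simp: flin.subspace_def pair_eq_lsum)
  then show "a \<in> D"
    by (auto simp: Uq_dual_def Uq_ideal_def ideal_gen_def)
qed

lemma subspace_Uq_dual: "fn.subspace D"
proof -
  have [simp]: "pair X 0 = 0" "pair X (a + b) = pair X a + pair X b" "pair X (csc c a) = c * pair X a" for X a b c
    by (simp_all add: pair_eq_lsum lsum_def sum.distrib algebra_simps sum_distrib_left)
  show ?thesis by (auto simp: fn.subspace_def Uq_dual_def)
qed

lemma rt_Uq_dual [simp]: assumes "a \<in> D" shows "rt g a \<in> D"
proof -
  have "pair (mon u * r * mon v) (rt g a) = pair (mon u * r * mon (v + Word [g])) a" for u r v
    by (simp add: pair_eq_lsum lsum_mult rt_def add.assoc)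
  then show ?thesis using assms by (simp add: Uq_dual_iff)
qed

lemma lt_Uq_dual [simp]: assumes "a \<in> D" shows "lt g a \<in> D"
proof -
  have "pair (mon u * r * mon v) (lt g a) = pair (mon (Word [g] + u) * r * mon v) a" for u r v
    by (simp add: pair_eq_lsum lsum_mult lt_def add.assoc)
  then show ?thesis using assms by (simp add: Uq_dual_iff)
qed

lemma rels_act: assumes "a \<in> D" "r \<in> Uq_rels q" shows "r \<triangleright> a = 0"
proof
  fix w
  have "pair (mon w * r * mon 0) a = 0" using assms Uq_dual_iff by blast
  then show "(r \<triangleright> a) w = 0 w"
    by (simp add: pair_eq_lsum lsum_mult act_apply)
qed

lemma rels_lact: assumes "a \<in> D" "r \<in> Uq_rels q" shows "lsum (\<lambda>v. a (v + w)) r = 0"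
proof -
  have "pair (mon 0 * r * mon w) a = 0" using assms Uq_dual_iff by blast
  then show ?thesis
    by (simp add: pair_eq_lsum lsum_mult)
qed

lemma Uq_relsE:
  assumes "r \<in> Uq_rels q"
  obtains (KKi) i where "r = lett (K i) * lett (Kinv i) - 1"
  | (KiK) i where "r = lett (Kinv i) * lett (K i) - 1"
  | (KK) i j where "r = lett (K i) * lett (K j) - lett (K j) * lett (K i)"
  | (KE) i j where "r = lett (K i) * lett (E j) - fscale (qc powi cartan i j) (lett (E j) * lett (K i))"
  | (KF) i j where "r = lett (K i) * lett (F j) - fscale (qc powi (- cartan i j)) (lett (F j) * lett (K i))"
  | (EF) i j where "r = lett (E i) * lett (F j) - lett (F j) * lett (E i)
        - (if i = j then fscale (1 / (qc - 1 / qc)) (lett (K i) - lett (Kinv i)) else 0)"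
  | (EE) i j where "i \<noteq> j" "r = lett (E i) * lett (E i) * lett (E j)
        - fscale (qc + 1 / qc) (lett (E i) * lett (E j) * lett (E i)) + lett (E j) * lett (E i) * lett (E i)"
  | (FF) i j where "i \<noteq> j" "r = lett (F i) * lett (F i) * lett (F j)
        - fscale (qc + 1 / qc) (lett (F i) * lett (F j) * lett (F i)) + lett (F j) * lett (F i) * lett (F i)"
  using assms unfolding Uq_rels_def Let_def by blast

lemma Uq_rels_mem:
  "lett (K i) * lett (Kinv i) - 1 \<in> Uq_rels q"
  "lett (Kinv i) * lett (K i) - 1 \<in> Uq_rels q"
  "lett (K i) * lett (K j) - lett (K j) * lett (K i) \<in> Uq_rels q"
  "lett (K i) * lett (E j) - fscale (qc powi cartan i j) (lett (E j) * lett (K i)) \<in> Uq_rels q"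
  "lett (K i) * lett (F j) - fscale (qc powi (- cartan i j)) (lett (F j) * lett (K i)) \<in> Uq_rels q"
  "lett (E i) * lett (F j) - lett (F j) * lett (E i)
        - (if i = j then fscale (1 / (qc - 1 / qc)) (lett (K i) - lett (Kinv i)) else 0) \<in> Uq_rels q"
  "i \<noteq> j \<Longrightarrow> lett (E i) * lett (E i) * lett (E j)
        - fscale (qc + 1 / qc) (lett (E i) * lett (E j) * lett (E i)) + lett (E j) * lett (E i) * lett (E i) \<in> Uq_rels q"
  "i \<noteq> j \<Longrightarrow> lett (F i) * lett (F i) * lett (F j)
        - fscale (qc + 1 / qc) (lett (F i) * lett (F j) * lett (F i)) + lett (F j) * lett (F i) * lett (F i) \<in> Uq_rels q"
  unfolding Uq_rels_def Let_def by blast+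

text \<open>The defining relations as commutation rules for the operators \<open>rt\<close>; their right-hand sides
  are ordered as \<open>F\<close>, \<open>E\<close>, \<open>K\<close>.\<close>

lemma rt_K_Kinv [simp]: assumes "a \<in> D"
  shows "rt (K i) (rt (Kinv i) a) = a" "rt (Kinv i) (rt (K i) a) = a"
  using rels_act[OF assms Uq_rels_mem(1)[of i]] rels_act[OF assms Uq_rels_mem(2)[of i]] by simp_all

lemma rt_K_K: assumes "a \<in> D" shows "rt (K i) (rt (K j) a) = rt (K j) (rt (K i) a)"
  using rels_act[OF assms Uq_rels_mem(3)[of i j]] by simp

lemma rt_K_E: assumes "a \<in> D" shows "rt (K i) (rt (E j) a) = csc (qc powi cartan i j) (rt (E j) (rt (K i) a))"
  using rels_act[OF assms Uq_rels_mem(4)[of i j]] by simp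

lemma rt_K_F: assumes "a \<in> D" shows "rt (K i) (rt (F j) a) = csc (qc powi (- cartan i j)) (rt (F j) (rt (K i) a))"
  using rels_act[OF assms Uq_rels_mem(5)[of i j]] by simp

lemma rt_E_F: assumes "a \<in> D" shows "rt (E i) (rt (F j) a) = rt (F j) (rt (E i) a)
    + (if i = j then csc (1 / (qc - 1 / qc)) (rt (K i) a - rt (Kinv i) a) else 0)"
  using rels_act[OF assms Uq_rels_mem(6)[of i j]] by (simp add: algebra_simps split: if_splits)

lemma rt_Serre_E: assumes "a \<in> D" "i \<noteq> j" shows "rt (E i) (rt (E i) (rt (E j) a))
    = csc (qc + 1 / qc) (rt (E i) (rt (E j) (rt (E i) a))) - rt (E j) (rt (E i) (rt (E i) a))"
  using rels_act[OF assms(1) Uq_rels_mem(7)[OF assms(2)]] by (simp add: algebra_simps eq_neg_iff_add_eq_0)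

lemma rt_Serre_F: assumes "a \<in> D" "i \<noteq> j" shows "rt (F i) (rt (F i) (rt (F j) a))
    = csc (qc + 1 / qc) (rt (F i) (rt (F j) (rt (F i) a))) - rt (F j) (rt (F i) (rt (F i) a))"
  using rels_act[OF assms(1) Uq_rels_mem(8)[OF assms(2)]] by (simp add: algebra_simps eq_neg_iff_add_eq_0)

text \<open>The defining relations contain no commutation rule for the inverse generators; it
  follows by inserting K_i K_i^{-1} and moving K_i past E_j.\<close>

lemma rt_Kinv_E: assumes "a \<in> D" shows "rt (Kinv i) (rt (E j) a) = csc (qc powi (- cartan i j)) (rt (E j) (rt (Kinv i) a))"
proof -
  have "rt (E j) (rt (K i) (rt (Kinv i) a)) = csc (qc powi (- cartan i j)) (rt (K i) (rt (E j) (rt (Kinv i) a)))"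
    using assms by (simp only: rt_K_E rt_Uq_dual csc_csc) (simp flip: power_int_add)
  then show ?thesis using assms by simp
qed

lemma rt_Kinv_F: assumes "a \<in> D" shows "rt (Kinv i) (rt (F j) a) = csc (qc powi cartan i j) (rt (F j) (rt (Kinv i) a))"
proof -
  have "rt (F j) (rt (K i) (rt (Kinv i) a)) = csc (qc powi cartan i j) (rt (K i) (rt (F j) (rt (Kinv i) a)))"
    using assms by (simp only: rt_K_F rt_Uq_dual csc_csc) (simp flip: power_int_add)
  then show ?thesis using assms by simp
qed

lemma rt_Kinv_K: assumes "a \<in> D" shows "rt (Kinv i) (rt (K j) a) = rt (K j) (rt (Kinv i) a)"
proof -
  have "rt (K j) (rt (K i) (rt (Kinv i) a)) = rt (K i) (rt (K j) (rt (Kinv i) a))"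
    using assms by (intro rt_K_K) simp
  then show ?thesis using assms by simp
qed

lemma rt_Kinv_Kinv: assumes "a \<in> D" shows "rt (Kinv i) (rt (Kinv j) a) = rt (Kinv j) (rt (Kinv i) a)"
proof -
  have "rt (Kinv i) (rt (K j) (rt (Kinv j) a)) = rt (K j) (rt (Kinv i) (rt (Kinv j) a))"
    using assms by (intro rt_Kinv_K) simp
  then have "rt (Kinv i) a = rt (K j) (rt (Kinv i) (rt (Kinv j) a))" using assms by simp
  then have "rt (Kinv j) (rt (Kinv i) a) = rt (Kinv j) (rt (K j) (rt (Kinv i) (rt (Kinv j) a)))" by simp
  then show ?thesis using assms by simp
qed

text \<open>From here on the same relations are read from the left. Because \<open>lt\<close>
  reverses products, every product of generators appears in the opposite order.\<close>

lemma lt_K_Kinv [simp]: assumes "a \<in> D"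
  shows "lt (Kinv i) (lt (K i) a) = a" "lt (K i) (lt (Kinv i) a) = a"
  using rels_lact[OF assms Uq_rels_mem(1)[of i]] rels_lact[OF assms Uq_rels_mem(2)[of i]]
  by (simp_all add: fun_eq_iff lsum_mult lt_apply flip: add.assoc)

lemma lt_K_K: assumes "a \<in> D" shows "lt (K i) (lt (K j) a) = lt (K j) (lt (K i) a)"
  using rels_lact[OF assms Uq_rels_mem(3)[of i j]]
  by (simp add: fun_eq_iff lsum_mult lt_apply flip: add.assoc)

lemma lt_E_K: assumes "a \<in> D" shows "lt (E j) (lt (K i) a) = csc (qc powi cartan i j) (lt (K i) (lt (E j) a))"
  using rels_lact[OF assms Uq_rels_mem(4)[of i j]]
  by (simp add: fun_eq_iff lsum_mult lt_apply flip: add.assoc)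

lemma lt_F_K: assumes "a \<in> D" shows "lt (F j) (lt (K i) a) = csc (qc powi (- cartan i j)) (lt (K i) (lt (F j) a))"
  using rels_lact[OF assms Uq_rels_mem(5)[of i j]]
  by (simp add: fun_eq_iff lsum_mult lt_apply flip: add.assoc)

lemma lt_F_E: assumes "a \<in> D" shows "lt (F j) (lt (E i) a) = lt (E i) (lt (F j) a)
    + (if i = j then csc (1 / (qc - 1 / qc)) (lt (K i) a - lt (Kinv i) a) else 0)"
  using rels_lact[OF assms Uq_rels_mem(6)[of i j]]
  by (simp add: fun_eq_iff lsum_mult lt_apply algebra_simps split: if_splits flip: add.assoc)

lemma lt_Serre_E: assumes "a \<in> D" "i \<noteq> j" shows "lt (E j) (lt (E i) (lt (E i) a))
    = csc (qc + 1 / qc) (lt (E i) (lt (E j) (lt (E i) a))) - lt (E i) (lt (E i) (lt (E j) a))"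
  using rels_lact[OF assms(1) Uq_rels_mem(7)[OF assms(2)]]
  by (simp add: fun_eq_iff lsum_mult lt_apply algebra_simps eq_neg_iff_add_eq_0 flip: add.assoc)

lemma lt_Serre_F: assumes "a \<in> D" "i \<noteq> j" shows "lt (F j) (lt (F i) (lt (F i) a))
    = csc (qc + 1 / qc) (lt (F i) (lt (F j) (lt (F i) a))) - lt (F i) (lt (F i) (lt (F j) a))"
  using rels_lact[OF assms(1) Uq_rels_mem(8)[OF assms(2)]]
  by (simp add: fun_eq_iff lsum_mult lt_apply algebra_simps eq_neg_iff_add_eq_0 flip: add.assoc)

lemma lt_E_Kinv: assumes "a \<in> D" shows "lt (E j) (lt (Kinv i) a) = csc (qc powi (- cartan i j)) (lt (Kinv i) (lt (E j) a))"
proof -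
  have "lt (Kinv i) (lt (E j) (lt (K i) (lt (Kinv i) a))) = csc (qc powi cartan i j) (lt (Kinv i) (lt (K i) (lt (E j) (lt (Kinv i) a))))"
    using assms by (simp only: lt_E_K lt_Uq_dual lt_linear)
  then have "lt (Kinv i) (lt (E j) a) = csc (qc powi cartan i j) (lt (E j) (lt (Kinv i) a))"
    using assms by simp
  then show ?thesis by (simp flip: power_int_add)
qed

lemma lt_F_Kinv: assumes "a \<in> D" shows "lt (F j) (lt (Kinv i) a) = csc (qc powi cartan i j) (lt (Kinv i) (lt (F j) a))"
proof -
  have "lt (Kinv i) (lt (F j) (lt (K i) (lt (Kinv i) a))) = csc (qc powi (- cartan i j)) (lt (Kinv i) (lt (K i) (lt (F j) (lt (Kinv i) a))))"
    using assms by (simp only: lt_F_K lt_Uq_dual lt_linear)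
  then have "lt (Kinv i) (lt (F j) a) = csc (qc powi (- cartan i j)) (lt (F j) (lt (Kinv i) a))"
    using assms by simp
  then show ?thesis by (simp flip: power_int_add)
qed

lemma lt_Kinv_K: assumes "a \<in> D" shows "lt (Kinv i) (lt (K j) a) = lt (K j) (lt (Kinv i) a)"
proof -
  have "lt (K i) (lt (K j) (lt (Kinv i) a)) = lt (K j) (lt (K i) (lt (Kinv i) a))"
    using assms by (intro lt_K_K) simp
  then have "lt (Kinv i) (lt (K i) (lt (K j) (lt (Kinv i) a))) = lt (Kinv i) (lt (K j) a)" using assms by simp
  then show ?thesis using assms by simp
qed

lemma lt_Kinv_Kinv: assumes "a \<in> D" shows "lt (Kinv i) (lt (Kinv j) a) = lt (Kinv j) (lt (Kinv i) a)"
proof -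
  have "lt (Kinv i) (lt (K j) (lt (Kinv j) a)) = lt (K j) (lt (Kinv i) (lt (Kinv j) a))"
    using assms by (intro lt_Kinv_K) simp
  then have "lt (Kinv j) (lt (Kinv i) a) = lt (Kinv j) (lt (K j) (lt (Kinv i) (lt (Kinv j) a)))" using assms by simp
  then show ?thesis using assms by simp
qed

text \<open>The value of a at u r v is the value at u of r acting on v \<triangleright> a, and v
  \<triangleright> a stays in the span. It therefore suffices to check each relation on the spanning
  elements, without words on either side.\<close>

lemma span_subset_Uq_dual:
  assumes rt: "\<And>a g. a \<in> G \<Longrightarrow> rt g a \<in> fn.span G"
    and rel: "\<And>a r. a \<in> G \<Longrightarrow> r \<in> Uq_rels q \<Longrightarrow> r \<triangleright> a = 0"
  shows "fn.span G \<subseteq> D"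
proof
  fix a assume a: "a \<in> fn.span G"
  have rts: "rt g b \<in> fn.span G" if "b \<in> fn.span G" for g b
  proof -
    have "fn.span G \<subseteq> {b. rt g b \<in> fn.span G}"
      using rt by (intro fn.span_minimal) (auto simp: fn.subspace_def intro: fn.span_zero fn.span_add fn.span_scale)
    then show ?thesis using that by auto
  qed
  have rels: "r \<triangleright> b = 0" if "b \<in> fn.span G" "r \<in> Uq_rels q" for r b
  proof -
    have "fn.span G \<subseteq> {b. r \<triangleright> b = 0}"
      using rel that by (intro fn.span_minimal) (auto simp: fn.subspace_def)
    then show ?thesis using that by auto
  qed
  have mons: "mon v \<triangleright> a \<in> fn.span G" for v
  proof (induction v rule: word_induct)
    case zero
    show ?case using a by (simp only: mon_0 act_1)
  next
    case (plus g v)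
    then show ?case by (simp only: mon_act_plus rts)
  qed
  have "pair (mon u * r * mon v) a = (r \<triangleright> (mon v \<triangleright> a)) u" for u r v
    by (simp add: pair_eq_lsum lsum_mult act_apply add.assoc)
  then show "a \<in> D" using rels mons by (simp add: Uq_dual_iff)
qed

lemma unit_Uq_dual [simp]: "unit \<in> D"
proof -
  have "fn.span {unit} \<subseteq> D"
  proof (rule span_subset_Uq_dual)
    fix a r assume "a \<in> {unit}" "r \<in> Uq_rels q"
    then show "r \<triangleright> a = 0"
      by (auto elim!: Uq_relsE)
  qed (auto intro: fn.span_scale fn.span_base)
  then show ?thesis using fn.span_base[of unit "{unit}"] by blast
qed

text \<open>In dual form this says that Delta respects the relations: each relation is applied to a
  product by the Leibniz rules and reduced by the relations for the factors.\<close>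

lemma conv_Uq_dual [simp]: assumes "a \<in> D" "b \<in> D" shows "a \<star> b \<in> D"
proof -
  let ?G = "{a \<star> b | a b. a \<in> D \<and> b \<in> D}"
  have mem: "x \<star> y \<in> fn.span ?G" if "x \<in> D" "y \<in> D" for x y
    using that by (intro fn.span_base) auto
  have "fn.span ?G \<subseteq> D"
  proof (rule span_subset_Uq_dual)
    fix x g assume "x \<in> ?G"
    then obtain a b where [simp]: "x = a \<star> b" "a \<in> D" "b \<in> D" by auto
    show "rt g x \<in> fn.span ?G"
      by (cases g) (auto simp: rt_conv intro!: fn.span_add mem)
  next
    fix x r assume "x \<in> ?G" and r: "r \<in> Uq_rels q"
    then obtain a b where [simp]: "x = a \<star> b" "a \<in> D" "b \<in> D" by auto
    note K = rt_K_E rt_K_F rt_Kinv_E rt_Kinv_F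
    note conv_linear = conv_add_left conv_add_right conv_minus_left conv_minus_right
    from r show "r \<triangleright> x = 0"
    proof (cases rule: Uq_relsE)
      case (KK i j)
      then show ?thesis by (simp add: rt_conv rt_K_K[of _ i j])
    next
      case (KE i j)
      then show ?thesis by (simp add: rt_conv K rt_K_K[of _ i j] csc_add)
    next
      case (KF i j)
      then show ?thesis by (simp add: rt_conv K rt_Kinv_K csc_add)
    next
      case (EF i j)
      then show ?thesis
        by (simp add: rt_conv K rt_E_F conv_linear rt_K_K[of _ i j] rt_Kinv_K rt_Kinv_Kinv[of _ i j])
          (simp add: fun_eq_iff field_simps cartan_sym[of j i] flip: power_int_add)
    next
      case (EE i j)
      \<comment> \<open>The mixed terms of the Serre relation cancel only once the two commuting
        translations stand in the same order throughout.\<close>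
      have KK: "rt (K j) (rt (K i) a) = rt (K i) (rt (K j) a)" if "a \<in> D" for a
        using that by (rule rt_K_K)
      show ?thesis using EE
        by (simp add: rt_conv K conv_linear rt_Serre_E cartan_def KK csc_add csc_minus)
          (simp add: fun_eq_iff field_simps power_int_minus power2_eq_square)
    next
      case (FF i j)
      have KK: "rt (Kinv j) (rt (Kinv i) a) = rt (Kinv i) (rt (Kinv j) a)" if "a \<in> D" for a
        using that by (rule rt_Kinv_Kinv)
      show ?thesis using FF
        by (simp add: rt_conv K conv_linear rt_Serre_F cartan_def KK csc_add csc_minus)
          (simp add: fun_eq_iff field_simps power_int_minus power2_eq_square)
    qed (simp_all add: rt_conv K conv_linear csc_add)
  qed
  then show ?thesis using mem[OF assms] by auto
qed

text \<open>In dual form this says that S respects the relations. Since S reverses products, the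
  relations enter through \<open>lt\<close>.\<close>

lemma antip_Uq_dual [simp]: assumes "a \<in> D" shows "antip a \<in> D"
proof -
  let ?G = "antip ` D"
  have mem: "antip x \<in> fn.span ?G" if "x \<in> D" for x
    using that by (intro fn.span_base) auto
  have "fn.span ?G \<subseteq> D"
  proof (rule span_subset_Uq_dual)
    fix x g assume "x \<in> ?G"
    then obtain a where [simp]: "x = antip a" "a \<in> D" by auto
    show "rt g x \<in> fn.span ?G"
      by (cases g) (auto simp: rt_antip intro!: fn.span_neg mem)
  next
    fix x r assume "x \<in> ?G" and r: "r \<in> Uq_rels q"
    then obtain a where [simp]: "x = antip a" "a \<in> D" by auto
    note K = lt_E_K lt_F_K lt_E_Kinv lt_F_Kinv
    from r show "r \<triangleright> x = 0"
    proof (cases rule: Uq_relsE)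
      case (KK i j)
      then show ?thesis by (simp add: rt_antip lt_Kinv_Kinv[of _ i j])
    next
      case (KE i j)
      then show ?thesis by (simp add: rt_antip K lt_Kinv_Kinv[of _ i j] flip: power_int_add)
    next
      case (KF i j)
      then show ?thesis by (simp add: rt_antip K lt_Kinv_K flip: power_int_add)
    next
      case (EF i j)
      then show ?thesis
        by (simp add: rt_antip K lt_F_E lt_Kinv_K)
          (simp add: fun_eq_iff field_simps cartan_sym[of j i] flip: power_int_add)
    next
      case (EE i j)
      have KK: "lt (Kinv j) (lt (Kinv i) a) = lt (Kinv i) (lt (Kinv j) a)" if "a \<in> D" for a
        using that by (rule lt_Kinv_Kinv)
      show ?thesis using EE
        by (simp add: rt_antip K lt_Serre_E cartan_def KK csc_add csc_minus)
          (simp add: fun_eq_iff field_simps power_int_minus power2_eq_square)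
    next
      case (FF i j)
      have KK: "lt (K j) (lt (K i) a) = lt (K i) (lt (K j) a)" if "a \<in> D" for a
        using that by (rule lt_K_K)
      show ?thesis using FF
        by (simp add: rt_antip K lt_Serre_F cartan_def KK csc_add csc_minus)
          (simp add: fun_eq_iff field_simps power_int_minus power2_eq_square)
    qed (simp_all add: rt_antip)
  qed
  then show ?thesis using mem[OF assms] by auto
qed

end

section \<open>Coproducts\<close>

text \<open>The identity part of \<open>sweedler\<close>. Membership of the legs is tracked
  separately because it varies between A, B and the weight spaces.\<close>

definition coproduct_rep :: "fnl \<Rightarrow> (fnl \<times> fnl) list \<Rightarrow> bool"
  where "coproduct_rep a ps \<longleftrightarrow> (\<forall>X Y. a (X + Y) = (\<Sum>(x, y)\<leftarrow>ps. x X * y Y))"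

lemma sweedler_iff: "sweedler H H' a ps \<longleftrightarrow> set ps \<subseteq> H \<times> H' \<and> coproduct_rep a ps"
  by (simp add: sweedler_def coproduct_rep_def)

lemma swD: "coproduct_rep a ps \<Longrightarrow> a (X + Y) = (\<Sum>(x, y)\<leftarrow>ps. x X * y Y)"
  by (simp add: coproduct_rep_def)

lemma sum_list_product:
  "(\<Sum>x\<leftarrow>xs. f x) * (\<Sum>y\<leftarrow>ys. g y) = (\<Sum>(x, y)\<leftarrow>List.product xs ys. f x * g y)"
  for f g :: "_ \<Rightarrow> complex"
  by (induction xs) (simp_all add: algebra_simps sum_list_const_mult comp_def)

lemma coproduct_rep_conv:
  assumes "coproduct_rep a ps" "coproduct_rep b qs"
  shows "coproduct_rep (a \<star> b) (map (\<lambda>((x, y), (x', y')). (x \<star> x', y \<star> y')) (List.product ps qs))"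
  unfolding coproduct_rep_def
proof (intro allI)
  fix X Y
  have ab: "a (fst p + fst p') * b (snd p + snd p') =
      (\<Sum>((x, y), (x', y'))\<leftarrow>List.product ps qs. (x (fst p) * x' (snd p)) * (y (fst p') * y' (snd p')))" for p p'
    unfolding swD[OF assms(1)] swD[OF assms(2)] sum_list_product
    by (intro arg_cong[where f = sum_list] map_cong) (auto simp: mult_ac)
  have "(a \<star> b) (X + Y) = lsum (\<lambda>p. lsum (\<lambda>p'. a (fst p + fst p') * b (snd p + snd p')) (cop_word Y)) (cop_word X)"
    by (simp add: conv_eq_lsum cop_word_plus lsum_mult)
  also have "\<dots> = (\<Sum>((x, y), (x', y'))\<leftarrow>List.product ps qs. (x \<star> x') X * (y \<star> y') Y)"
    unfolding ab lsum_sum_list_fun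
    by (intro arg_cong[where f = sum_list] map_cong) (auto simp: conv_eq_lsum)
  finally show "(a \<star> b) (X + Y) = (\<Sum>(x, y)\<leftarrow>map (\<lambda>((x, y), (x', y')). (x \<star> x', y \<star> y')) (List.product ps qs). x X * y Y)"
    by (simp add: comp_def case_prod_unfold)
qed

text \<open>S reverses products, hence the two legs change places.\<close>

lemma coproduct_rep_antip:
  assumes "coproduct_rep a ps"
  shows "coproduct_rep (antip a) (map (\<lambda>(x, y). (antip y, antip x)) ps)"
  unfolding coproduct_rep_def
proof (intro allI)
  fix X Y
  have "antip a (X + Y) = (\<Sum>(x, y)\<leftarrow>ps. antip y X * antip x Y)"
    unfolding antip_plus swD[OF assms] lsum_sum_list_fun
    by (intro arg_cong[where f = sum_list] map_cong) (auto simp: antip_apply)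
  then show "antip a (X + Y) = (\<Sum>(x, y)\<leftarrow>map (\<lambda>(x, y). (antip y, antip x)) ps. x X * y Y)"
    by (simp add: comp_def case_prod_unfold)
qed

lemma coproduct_rep_add: "coproduct_rep a ps \<Longrightarrow> coproduct_rep b qs \<Longrightarrow> coproduct_rep (a + b) (ps @ qs)"
  by (simp add: coproduct_rep_def)

lemma coproduct_rep_csc: "coproduct_rep a ps \<Longrightarrow> coproduct_rep (csc c a) (map (\<lambda>(x, y). (csc c x, y)) ps)"
  by (simp add: coproduct_rep_def comp_def case_prod_unfold mult.assoc sum_list_const_mult)

lemma coproduct_rep_unit: "coproduct_rep unit [(unit, unit)]"
  by (simp add: coproduct_rep_def unit_def)

lemma coproduct_rep_act:
  assumes "coproduct_rep a ps" shows "X \<triangleright> a = (\<Sum>(x, y)\<leftarrow>ps. csc (pair X y) x)"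
proof
  fix w
  have "(X \<triangleright> a) w = (\<Sum>(x, y)\<leftarrow>ps. x w * lsum y X)"
    unfolding act_apply swD[OF assms] lsum_sum_list_fun
    by (intro arg_cong[where f = sum_list] map_cong) auto
  then show "(X \<triangleright> a) w = (\<Sum>(x, y)\<leftarrow>ps. csc (pair X y) x) w"
    by (simp add: sum_list_fun_apply case_prod_unfold pair_eq_lsum mult.commute)
qed

lemma coproduct_rep_act_right:
  assumes "coproduct_rep a ps" shows "coproduct_rep (X \<triangleright> a) (map (\<lambda>(x, y). (x, X \<triangleright> y)) ps)"
  unfolding coproduct_rep_def
proof (intro allI)
  fix u v
  have "(X \<triangleright> a) (u + v) = (\<Sum>(x, y)\<leftarrow>ps. x u * (X \<triangleright> y) v)"
    unfolding act_apply add.assoc swD[OF assms] lsum_sum_list_fun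
    by (intro arg_cong[where f = sum_list] map_cong) (auto simp: act_apply)
  then show "(X \<triangleright> a) (u + v) = (\<Sum>(x, y)\<leftarrow>map (\<lambda>(x, y). (x, X \<triangleright> y)) ps. x u * y v)"
    by (simp add: comp_def case_prod_unfold)
qed

lemma antipode_word_plus: "antipode_word (v + w) = antipode_word w * antipode_word v"
  by (simp add: antipode_word_def)

lemma antipode_word_0 [simp]: "antipode_word 0 = 1"
  by (simp add: antipode_word_def)

lemma lsum_minus_fun: "lsum (\<lambda>k. f k - g k) x = lsum f x - lsum g x"
  by (simp add: lsum_def sum_subtractf algebra_simps)

text \<open>Induction on the number of summands. The values c s may coincide with each other; only d
  has to differ from all of them.\<close>

lemma eigen_sum_zero:
  assumes "finite S" "\<And>s. s \<in> S \<Longrightarrow> T (f s) = csc (c s) (f s)" "\<And>s. s \<in> S \<Longrightarrow> c s \<noteq> d"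
    and T: "\<And>a b. T (a + b) = T a + T b" "\<And>k a. T (csc k a) = csc k (T a)"
    and "v = (\<Sum>s\<in>S. f s)" "T v = csc d v"
  shows "v = 0"
  using assms(1-3,6-7)
proof (induction S arbitrary: f v rule: finite_induct)
  case empty
  then show ?case by (simp only: sum.empty)
next
  case (insert s S)
  have Tsum: "T (sum g S) = (\<Sum>t\<in>S. csc (c t) (g t))" if "\<And>t. t \<in> S \<Longrightarrow> T (g t) = csc (c t) (g t)" for g
  proof -
    have T0: "T 0 = 0" using T(2)[of 0 0] by simp
    show ?thesis
      using insert.hyps(1) that
    proof (induction S rule: finite_induct)
      case empty
      show ?case by (simp only: sum.empty T0)
    next
      case (insert x F)
      then have "T (sum g F) = (\<Sum>t\<in>F. csc (c t) (g t))" "T (g x) = csc (c x) (g x)" by blast+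
      then show ?case using insert.hyps by (simp only: sum.insert T not_False_eq_True)
    qed
  qed
  have v: "v = f s + sum f S" using insert.hyps insert.prems(3) by (simp only: sum.insert not_False_eq_True)
  have Tv: "csc d v = csc (c s) (f s) + (\<Sum>t\<in>S. csc (c t) (f t))"
    using insert.prems(1,4) Tsum[of f] v by (metis T(1) insertCI)
  \<comment> \<open>Applying T minus the eigenvalue c s removes the summand at s and rescales the
    others, while v is rescaled by the nonzero number d - c s.\<close>
  have eq: "csc (d - c s) v = (\<Sum>t\<in>S. csc (c t - c s) (f t))"
  proof
    fix w
    show "csc (d - c s) v w = (\<Sum>t\<in>S. csc (c t - c s) (f t)) w"
      using fun_cong[OF Tv, of w] fun_cong[OF v, of w]
      by (simp add: algebra_simps sum_subtractf sum_distrib_left)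
  qed
  have "csc (d - c s) v = 0"
  proof (rule insert.IH[where f = "\<lambda>t. csc (c t - c s) (f t)"])
    show "T (csc (d - c s) v) = csc d (csc (d - c s) v)"
      using insert.prems(4) by (simp only: T csc_csc mult.commute)
    show "T (csc (c t - c s) (f t)) = csc (c t) (csc (c t - c s) (f t))" if "t \<in> S" for t
      using insert.prems(1)[OF insertI2[OF that]] by (simp only: T csc_csc mult.commute)
    show "c t \<noteq> d" if "t \<in> S" for t
      using insert.prems(2) that by blast
  qed (fact eq)
  moreover have "d - c s \<noteq> 0" using insert.prems(2) by auto
  ultimately show "v = 0"
    by (simp add: fun_eq_iff)
qed

text \<open>The summands with eigenvalue other than d add up to a difference of two d-eigenvectors,
  so \<open>eigen_sum_zero\<close> makes their sum vanish.\<close>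

lemma eigen_filter:
  assumes "finite S" "\<And>s. s \<in> S \<Longrightarrow> T (f s) = csc (c s) (f s)"
    and T: "\<And>a b. T (a + b) = T a + T b" "\<And>k a. T (csc k a) = csc k (T a)"
    and v: "v = (\<Sum>s\<in>S. f s)" "T v = csc d v"
  shows "v = (\<Sum>s\<in>{s\<in>S. c s = d}. f s)"
proof -
  let ?S = "{s\<in>S. c s = d}" and ?R = "{s\<in>S. c s \<noteq> d}"
  have split: "v = sum f ?S + sum f ?R"
  proof -
    have "sum f (?S \<union> ?R) = sum f ?S + sum f ?R"
      using assms(1) by (intro sum.union_disjoint) auto
    moreover have "?S \<union> ?R = S" by auto
    ultimately show ?thesis using v by metis
  qed
  have Tsum: "T (sum f R) = csc d (sum f R)" if "finite R" "R \<subseteq> ?S" for R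
    using that
  proof (induction R rule: finite_induct)
    case empty
    show ?case using T(2)[of 0 0] by (simp only: sum.empty csc_0 csc_zero)
  next
    case (insert x F)
    then have "T (sum f F) = csc d (sum f F)" "T (f x) = csc d (f x)" using assms(2)[of x] by blast+
    then show ?case using insert.hyps by (simp only: sum.insert T csc_add not_False_eq_True)
  qed
  have "T v = T (sum f ?S) + T (sum f ?R)" using split T(1) by metis
  then have "T (sum f ?R) = csc d (sum f ?R)"
    using v(2) Tsum[of ?S] assms(1) split by (simp add: csc_add)
  then have "sum f ?R = 0"
    using assms(1,2) by (intro eigen_sum_zero[where S = ?R and T = T and f = f and c = c and d = d] T) auto
  then show ?thesis using split by simp
qed

context quantum_parameter
begin

text \<open>The modulus |q| is positive and different from 1, so its powers are 1 only for exponent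
  0. This is what makes weights readable from eigenvalues.\<close>

lemma q_powi_eq_1: "qc powi m = 1 \<longleftrightarrow> m = 0"
proof
  assume "qc powi m = 1"
  then have 1: "\<bar>q\<bar> powi m = 1"
    by (metis norm_of_real norm_one norm_power_int)
  then have 2: "\<bar>q\<bar> powi (- m) = 1" by (simp add: power_int_minus)
  have "\<bar>q\<bar> \<noteq> 1" "\<bar>q\<bar> > 0" using q_generic by auto
  define n where "n = nat \<bar>m\<bar>"
  have "\<bar>q\<bar> ^ n = 1" using 1 2 unfolding n_def
    by (cases "m \<ge> 0") (auto simp: power_int_def abs_if split: if_splits)
  then have "n = 0" using \<open>\<bar>q\<bar> \<noteq> 1\<close> \<open>\<bar>q\<bar> > 0\<close>
    using power_eq_1_iff[of "\<bar>q\<bar>" n] by (cases "n = 0") auto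
  then show "m = 0" by (simp add: n_def)
qed simp

lemma q_powi_inj: "qc powi m = qc powi n \<longleftrightarrow> m = n"
proof
  assume "qc powi m = qc powi n"
  then have "qc powi (m - n) = 1" by (simp add: power_int_diff)
  then show "m = n" using q_powi_eq_1[of "m - n"] by simp
qed simp

text \<open>The antipode axiom S(w_1) w_2 = eps(w), seen through a. Removing the last letter g of w
  leaves S(g_1) in front of S(w_1) w_2 and g_2 behind it; these outer letters become translates of
  a, to which the induction hypothesis applies.\<close>

lemma antipode_left_aux:
  assumes "a \<in> D"
  shows "lsum (\<lambda>p. lsum (\<lambda>v. a (v + snd p)) (antipode_word (fst p))) (cop_word w) = unit w * a 0"
  using assms
proof (induction w arbitrary: a rule: word_rev_induct)
  case zero
  then show ?case by (simp add: antipode_word_def)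
next
  case (plus g w)
  let ?AS = "\<lambda>a w. lsum (\<lambda>p. lsum (\<lambda>v. a (v + snd p)) (antipode_word (fst p))) (cop_word w)"
  have W2: "Word [x, y] = Word [x] + Word [y]" for x y :: gen by simp
  have unit: "unit (w + Word [g]) = unit w * eps_gen g" by (simp add: unit_def)
  have minus: "lsum (\<lambda>p. lsum (\<lambda>v. - f v p) (h p)) c = - lsum (\<lambda>p. lsum (\<lambda>v. f v p) (h p)) c"
    for f :: "gen word \<Rightarrow> _" and h c by (simp add: lsum_uminus_fun)
  have K: "a (Word [K i, Kinv i]) = a 0" "a (Word [Kinv i, K i]) = a 0" 
    "a (Word [E i, Kinv i, K i]) = a (Word [E i])" "a (Word [K i, F i]) = lt (K i) a (Word [F i])"
    if "g = E i \<or> g = F i \<or> g = K i \<or> g = Kinv i" for i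
    using fun_cong[OF rt_K_Kinv(1)[OF plus.prems, of i], of 0] fun_cong[OF rt_K_Kinv(2)[OF plus.prems, of i], of 0]
      fun_cong[OF rt_K_Kinv(2)[OF plus.prems, of i], of "Word [E i]"]
    by (simp_all add: rt_apply lt_apply)
  have KF: "a (Word [K i, Kinv i, F i]) = a (Word [F i])" for i
    using fun_cong[OF lt_K_Kinv(1)[OF plus.prems, of i], of "Word [F i]"] by (simp add: lt_apply)
  show ?case
  proof (cases g)
    case (E i)
    have "?AS a (w + Word [g]) = - ?AS (rt (K i) (lt (Kinv i) (lt (E i) a))) w + ?AS (rt (E i) a) w"
      by (simp add: E cop_word_plus lsum_mult antipode_word_plus lsum_add_fun lsum_minus_fun rt_def lt_def minus)
        (simp add: add.assoc W2 del: word_plus)?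
    also have "\<dots> = unit w * (- a (Word [E i, Kinv i, K i]) + a (Word [E i]))"
      using plus.prems by (simp only: plus.IH rt_Uq_dual lt_Uq_dual) (simp add: rt_apply lt_apply algebra_simps)
    finally show ?thesis using K(3)[of i] E unit by simp
  next
    case (F i)
    have "?AS a (w + Word [g]) = - ?AS (lt (F i) (lt (K i) a)) w + ?AS (rt (F i) (lt (K i) a)) w"
      by (simp add: F cop_word_plus lsum_mult antipode_word_plus lsum_add_fun lsum_minus_fun rt_def lt_def minus)
        (simp add: add.assoc W2 del: word_plus)?
    also have "\<dots> = 0"
      using plus.prems by (simp only: plus.IH rt_Uq_dual lt_Uq_dual) (simp add: rt_apply lt_apply algebra_simps)
    finally show ?thesis using F unit by simp
  next
    case (K i)
    have "?AS a (w + Word [g]) = ?AS (rt (K i) (lt (Kinv i) a)) w"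
      by (simp add: K cop_word_plus lsum_mult antipode_word_plus lsum_add_fun lsum_minus_fun rt_def lt_def)
        (simp add: add.assoc W2 del: word_plus)?
    also have "\<dots> = unit w * a (Word [Kinv i, K i])"
      using plus.prems by (simp only: plus.IH rt_Uq_dual lt_Uq_dual) (simp add: rt_apply lt_apply algebra_simps)
    finally show ?thesis using \<open>\<And>i. _ \<Longrightarrow> a (Word [Kinv i, K i]) = a 0\<close>[of i] K unit by simp
  next
    case (Kinv i)
    have "?AS a (w + Word [g]) = ?AS (rt (Kinv i) (lt (K i) a)) w"
      by (simp add: Kinv cop_word_plus lsum_mult antipode_word_plus lsum_add_fun lsum_minus_fun rt_def lt_def)
        (simp add: add.assoc W2 del: word_plus)?
    also have "\<dots> = unit w * a (Word [K i, Kinv i])"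
      using plus.prems by (simp only: plus.IH rt_Uq_dual lt_Uq_dual) (simp add: rt_apply lt_apply algebra_simps)
    finally show ?thesis using K(1)[of i] Kinv unit by simp
  qed
qed

lemma antipode_left:
  assumes "a \<in> D" "coproduct_rep a ps"
  shows "(\<Sum>(x, y)\<leftarrow>ps. antip x \<star> y) = csc (a 0) unit"
proof
  fix w
  have "(\<Sum>(x, y)\<leftarrow>ps. antip x \<star> y) w = (\<Sum>(x, y)\<leftarrow>ps. lsum (\<lambda>p. lsum (\<lambda>v. x v * y (snd p)) (antipode_word (fst p))) (cop_word w))"
    by (simp add: sum_list_fun_apply case_prod_unfold conv_eq_lsum antip_apply)
  also have "\<dots> = lsum (\<lambda>p. lsum (\<lambda>v. a (v + snd p)) (antipode_word (fst p))) (cop_word w)"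
    unfolding swD[OF assms(2)] lsum_sum_list_fun by (simp add: case_prod_unfold)
  finally show "(\<Sum>(x, y)\<leftarrow>ps. antip x \<star> y) w = csc (a 0) unit w"
    using antipode_left_aux[OF assms(1), of w] by simp
qed

end

section \<open>The coordinate algebra\<close>

lemma atLeastAtMost_1_3: "{1..3} = {1, 2, 3::nat}"
  by auto

lemma num_in: "num i \<in> {1..3}" "num i + 1 \<in> {1..3}"
  by (cases i; simp)+

text \<open>The exponent of q in \<langle>K_i, u_ll\<rangle>, that is, the weight of the l-th vector
  of the vector representation. The three weights for l = 1, 2, 3 add up to zero.\<close>

definition wtu :: "nat \<Rightarrow> node \<Rightarrow> int"
  where "wtu l = (\<lambda>i. of_bool (l = num i + 1) - of_bool (l = num i))"

lemma u_list_append: "k \<in> {1..3} \<Longrightarrow> u_list q k l (xs @ ys) = (\<Sum>m\<in>{1..3}. u_list q k m xs * u_list q m l ys)"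
proof (induction xs arbitrary: k)
  case Nil
  then have "(\<Sum>m\<in>{1..3}. u_list q k m [] * u_list q m l ys) = u_list q k l ys"
    unfolding atLeastAtMost_1_3 by auto
  then show ?case by simp
next
  case (Cons g xs)
  then show ?case
    by (simp add: sum_distrib_left sum_distrib_right mult.assoc del: One_nat_def) (rule sum.swap)
qed

lemma u_coef_plus: "k \<in> {1..3} \<Longrightarrow> u_coef q k l (X + Y) =
    u_coef q k 1 X * u_coef q 1 l Y + u_coef q k 2 X * u_coef q 2 l Y + u_coef q k 3 X * u_coef q 3 l Y"
  using u_list_append[of k q l "letters X" "letters Y"] unfolding atLeastAtMost_1_3
  by (simp add: u_coef_def)

lemma u_coef_gen: "l \<in> {1..3} \<Longrightarrow> u_coef q m l (Word [g]) = u_gen q g m l"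
proof -
  have "u_coef q m l (Word [g]) = (\<Sum>k\<in>{1..3}. u_gen q g m k * of_bool (k = l))"
    by (simp add: u_coef_def)
  then show "l \<in> {1..3} \<Longrightarrow> u_coef q m l (Word [g]) = u_gen q g m l"
    unfolding atLeastAtMost_1_3 by auto
qed

lemma u_coef_0: "u_coef q k l 0 = of_bool (k = l)"
  by (simp add: u_coef_def)

lemma coproduct_rep_u_coef: "k \<in> {1..3} \<Longrightarrow> coproduct_rep (u_coef q k l) (map (\<lambda>m. (u_coef q k m, u_coef q m l)) [1, 2, 3])"
  unfolding coproduct_rep_def by (simp add: u_coef_plus del: One_nat_def atLeastAtMost_iff)

text \<open>Right translation moves the column index by the vector representation; left translation,
  treated next, moves the row index.\<close>

lemma rt_u_coef:
  assumes k: "k \<in> {1..3}" and l: "l \<in> {1..3}"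
  shows "rt (E i) (u_coef q k l) = (if l = num i then u_coef q k (num i + 1) else 0)"
  "rt (F i) (u_coef q k l) = (if l = num i + 1 then u_coef q k (num i) else 0)"
  "rt (K i) (u_coef q k l) = csc (complex_of_real q powi wtu l i) (u_coef q k l)"
  "rt (Kinv i) (u_coef q k l) = csc (complex_of_real q powi (- wtu l i)) (u_coef q k l)"
proof -
  have rt: "rt g (u_coef q k l) w = u_coef q k 1 w * u_gen q g 1 l + u_coef q k 2 w * u_gen q g 2 l + u_coef q k 3 w * u_gen q g 3 l" for g w
    unfolding rt_apply u_coef_plus[OF k] u_coef_gen[OF l] ..
  from l have l: "l = 1 \<or> l = 2 \<or> l = 3" by auto
  show "rt (E i) (u_coef q k l) = (if l = num i then u_coef q k (num i + 1) else 0)"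
    "rt (F i) (u_coef q k l) = (if l = num i + 1 then u_coef q k (num i) else 0)"
    "rt (K i) (u_coef q k l) = csc (complex_of_real q powi wtu l i) (u_coef q k l)"
    "rt (Kinv i) (u_coef q k l) = csc (complex_of_real q powi (- wtu l i)) (u_coef q k l)"
    unfolding fun_eq_iff rt using l
    by (cases i; elim disjE; simp add: wtu_def numeral_2_eq_2[symmetric] numeral_3_eq_3[symmetric])+
qed

lemma lt_u_coef:
  assumes k: "k \<in> {1..3}" and l: "l \<in> {1..3}"
  shows "lt (E i) (u_coef q k l) = (if k = num i + 1 then u_coef q (num i) l else 0)"
  "lt (F i) (u_coef q k l) = (if k = num i then u_coef q (num i + 1) l else 0)"
  "lt (K i) (u_coef q k l) = csc (complex_of_real q powi wtu k i) (u_coef q k l)"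
  "lt (Kinv i) (u_coef q k l) = csc (complex_of_real q powi (- wtu k i)) (u_coef q k l)"
proof -
  have g: "u_coef q k 1 (Word [g]) = u_gen q g k 1" "u_coef q k 2 (Word [g]) = u_gen q g k 2"
    "u_coef q k 3 (Word [g]) = u_gen q g k 3" for g by (intro u_coef_gen; simp)+
  have lt: "lt g (u_coef q k l) w = u_gen q g k 1 * u_coef q 1 l w + u_gen q g k 2 * u_coef q 2 l w + u_gen q g k 3 * u_coef q 3 l w" for g w
    unfolding lt_apply u_coef_plus[OF k] g ..
  from k have k: "k = 1 \<or> k = 2 \<or> k = 3" by auto
  show "lt (E i) (u_coef q k l) = (if k = num i + 1 then u_coef q (num i) l else 0)"
    "lt (F i) (u_coef q k l) = (if k = num i then u_coef q (num i + 1) l else 0)"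
    "lt (K i) (u_coef q k l) = csc (complex_of_real q powi wtu k i) (u_coef q k l)"
    "lt (Kinv i) (u_coef q k l) = csc (complex_of_real q powi (- wtu k i)) (u_coef q k l)"
    unfolding fun_eq_iff lt using k
    by (cases i; elim disjE; simp add: wtu_def numeral_2_eq_2[symmetric] numeral_3_eq_3[symmetric])+
qed

context quantum_parameter
begin

text \<open>The matrix coefficients span a space stable under right translation, so what remains is
  that the 3 by 3 matrices of \<open>u_gen\<close> satisfy the relations.\<close>

lemma u_coef_Uq_dual: assumes "k \<in> {1..3}" "l \<in> {1..3}" shows "u_coef q k l \<in> D"
proof -
  let ?G = "{u_coef q k l | k l. k \<in> {1..3} \<and> l \<in> {1..3}}"
  have mem: "u_coef q k l \<in> fn.span ?G" if "k \<in> {1..3}" "l \<in> {1..3}" for k l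
    using that by (intro fn.span_base) auto
  have "fn.span ?G \<subseteq> D"
  proof (rule span_subset_Uq_dual)
    fix x g assume "x \<in> ?G"
    then obtain k l where [simp]: "x = u_coef q k l" and kl: "k \<in> {1..3}" "l \<in> {1..3}" by auto
    show "rt g x \<in> fn.span ?G"
      using kl num_in by (cases g) (auto simp only: rt_u_coef[OF kl] \<open>x = _\<close> intro!: mem fn.span_scale fn.span_zero split: if_splits)
  next
    fix x r assume "x \<in> ?G" and r: "r \<in> Uq_rels q"
    then obtain k l where [simp]: "x = u_coef q k l" and kl: "k \<in> {1..3}" "l \<in> {1..3}" by auto
    have k: "k \<in> {1..3}" by (fact kl)
    have N: "(1::nat) \<in> {1..3}" "2 \<in> {1..3::nat}" "3 \<in> {1..3::nat}" "Suc 0 \<in> {1..3}" "Suc (Suc 0) \<in> {1..3}" by auto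
    note R = rt_u_coef[OF k]
    have l: "l = 1 \<or> l = 2 \<or> l = 3" using kl by auto
    note S = R N wtu_def cartan_def power_int_minus power2_eq_square
    from r show "r \<triangleright> x = 0"
    proof (cases rule: Uq_relsE)
      case (KKi i)
      then show ?thesis using l by (cases i) (elim disjE; simp add: S)+
    next
      case (KiK i)
      then show ?thesis using l by (cases i) (elim disjE; simp add: S)+
    next
      case (KK i j)
      then show ?thesis using l by (cases i; cases j) (elim disjE; simp add: S)+
    next
      case (KE i j)
      then show ?thesis using l by (cases i; cases j) (elim disjE; simp add: S)+
    next
      case (KF i j)
      then show ?thesis using l by (cases i; cases j) (elim disjE; simp add: S)+
    next
      case (EF i j)
      have d: "csc x a - csc y a = csc (x - y) a" for x y a
        by (simp add: fun_eq_iff algebra_simps)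
      \<comment> \<open>K_i has eigenvalues q, 1/q and 1 in the vector representation, on which (K_i
        - K_i^{-1})/(q - q^{-1}) acts as 1, -1 and 0.\<close>
      have "1 / (qc - 1 / qc) * (1 / qc - qc) = - 1"
        using q_inv by (metis minus_diff_eq nonzero_eq_divide_eq mult_minus_right times_divide_eq_left mult_1)
      then have EFs: "csc (1 / (qc - 1 / qc)) (csc qc a - csc (inverse qc) a) = a"
        "csc (1 / (qc - 1 / qc)) (csc (inverse qc) a - csc qc a) = - a" for a
        using q_inv unfolding d csc_csc inverse_eq_divide by (simp_all add: fun_eq_iff)
      have two: "Suc (Suc 0) = 2" by simp
      show ?thesis unfolding EF \<open>x = _\<close> using l
        by (cases i; cases j; elim disjE; hypsubst; simp add: R N wtu_def power_int_minus; simp only: EFs two)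
    next
      case (EE i j)
      then show ?thesis using l by (cases i; cases j) (elim disjE; simp add: S)+
    next
      case (FF i j)
      then show ?thesis using l by (cases i; cases j) (elim disjE; simp add: S)+
    qed
  qed
  then show ?thesis using mem[OF assms] by auto
qed

text \<open>\<open>homA \<mu> \<nu>\<close> collects elements on which multiplication by \<open>K\<^sub>i\<close> from the left and from the right
  scales by \<open>q\<close> to the power \<open>\<mu> i\<close> and \<open>\<nu> i\<close>.\<close>

inductive homA :: "(node \<Rightarrow> int) \<Rightarrow> (node \<Rightarrow> int) \<Rightarrow> fnl \<Rightarrow> bool"
  where
    homA_unit: "homA 0 0 unit"
  | homA_u: "k \<in> {1..3} \<Longrightarrow> l \<in> {1..3} \<Longrightarrow> homA (wtu k) (wtu l) (u_coef q k l)"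
  | homA_add: "homA \<mu> \<nu> a \<Longrightarrow> homA \<mu> \<nu> b \<Longrightarrow> homA \<mu> \<nu> (a + b)"
  | homA_csc: "homA \<mu> \<nu> a \<Longrightarrow> homA \<mu> \<nu> (csc c a)"
  | homA_conv: "homA \<mu> \<nu> a \<Longrightarrow> homA \<mu>' \<nu>' b \<Longrightarrow> homA (\<mu> + \<mu>') (\<nu> + \<nu>') (a \<star> b)"
  | homA_antip: "homA \<mu> \<nu> a \<Longrightarrow> homA (- \<nu>) (- \<mu>) (antip a)"

lemma homA_Uq_dual: "homA \<mu> \<nu> a \<Longrightarrow> a \<in> D"
  by (induction rule: homA.induct)
    (use subspace_Uq_dual in \<open>simp_all only: unit_Uq_dual u_coef_Uq_dual conv_Uq_dual antip_Uq_dual fn.subspace_add fn.subspace_scale\<close>)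

lemma rt_Kinv_eq: assumes "a \<in> D" "rt (K i) a = csc (qc powi n) a" shows "rt (Kinv i) a = csc (qc powi (- n)) a"
proof -
  have "a = csc (qc powi n) (rt (Kinv i) a)" using rt_K_Kinv(2)[OF assms(1), of i] assms(2) by simp
  then have "csc (qc powi (- n)) a = csc (qc powi (- n)) (csc (qc powi n) (rt (Kinv i) a))" by (rule arg_cong)
  then show ?thesis by (simp flip: power_int_add)
qed

lemma lt_Kinv_eq: assumes "a \<in> D" "lt (K i) a = csc (qc powi n) a" shows "lt (Kinv i) a = csc (qc powi (- n)) a"
proof -
  have "a = csc (qc powi n) (lt (Kinv i) a)" using lt_K_Kinv(1)[OF assms(1), of i] assms(2) by simp
  then have "csc (qc powi (- n)) a = csc (qc powi (- n)) (csc (qc powi n) (lt (Kinv i) a))" by (rule arg_cong)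
  then show ?thesis by (simp flip: power_int_add)
qed

lemma homA_weights: "homA \<mu> \<nu> a \<Longrightarrow> lt (K i) a = csc (qc powi \<mu> i) a \<and> rt (K i) a = csc (qc powi \<nu> i) a"
proof (induction rule: homA.induct)
  case homA_unit
  show ?case by simp
next
  case (homA_u k l)
  then show ?case by (simp only: lt_u_coef rt_u_coef simp_thms)
next
  case (homA_add \<mu> \<nu> a b)
  then show ?case by (simp only: lt_linear rt_linear csc_add simp_thms)
next
  case (homA_csc \<mu> \<nu> a c)
  then show ?case by (simp only: lt_linear rt_linear csc_csc mult.commute simp_thms)
next
  case (homA_conv \<mu> \<nu> a \<mu>' \<nu>' b)
  then show ?case
    by (simp only: lt_conv rt_conv conv_csc_left conv_csc_right csc_csc plus_fun_apply simp_thms)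
      (simp add: power_int_add mult.commute)
next
  case (homA_antip \<mu> \<nu> a)
  then have "lt (Kinv i) a = csc (qc powi (- \<mu> i)) a" "rt (Kinv i) a = csc (qc powi (- \<nu> i)) a"
    by (blast intro: lt_Kinv_eq rt_Kinv_eq homA_Uq_dual)+
  then show ?case by (simp only: lt_antip rt_antip antip_linear) simp
qed

text \<open>The reason for an inductive predicate in place of an eigenvector condition: each
  constructor has an explicit coproduct, and the right weight of every first leg is the left weight
  of its partner.\<close>

lemma homA_sweedler:
  "homA \<mu> \<nu> a \<Longrightarrow> \<exists>ps. coproduct_rep a ps \<and> (\<forall>(x, y)\<in>set ps. \<exists>\<kappa>. homA \<mu> \<kappa> x \<and> homA \<kappa> \<nu> y)"
proof (induction rule: homA.induct)
  case homA_unit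
  have "\<forall>(x, y)\<in>set [(unit, unit)]. \<exists>\<kappa>. homA 0 \<kappa> x \<and> homA \<kappa> 0 y"
    using homA.homA_unit by auto
  then show ?case using coproduct_rep_unit by blast
next
  case (homA_u k l)
  have "coproduct_rep (u_coef q k l) (map (\<lambda>m. (u_coef q k m, u_coef q m l)) [1, 2, 3])"
    using homA_u by (intro coproduct_rep_u_coef)
  moreover have "\<forall>(x, y)\<in>set (map (\<lambda>m. (u_coef q k m, u_coef q m l)) [1, 2, 3]). \<exists>\<kappa>. homA (wtu k) \<kappa> x \<and> homA \<kappa> (wtu l) y"
  proof -
    have "\<exists>\<kappa>. homA (wtu k) \<kappa> (u_coef q k m) \<and> homA \<kappa> (wtu l) (u_coef q m l)" if "m \<in> {1..3}" for m
      using homA_u that by (blast intro: homA.homA_u)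
    from this[of 1] this[of 2] this[of 3] show ?thesis by simp
  qed
  ultimately show ?case by blast
next
  case (homA_add \<mu> \<nu> a b)
  then obtain ps qs where "coproduct_rep a ps" "\<forall>(x, y)\<in>set ps. \<exists>\<kappa>. homA \<mu> \<kappa> x \<and> homA \<kappa> \<nu> y"
    "coproduct_rep b qs" "\<forall>(x, y)\<in>set qs. \<exists>\<kappa>. homA \<mu> \<kappa> x \<and> homA \<kappa> \<nu> y" by blast
  then show ?case by (intro exI[of _ "ps @ qs"] conjI coproduct_rep_add) auto
next
  case (homA_csc \<mu> \<nu> a c)
  then obtain ps where "coproduct_rep a ps" "\<forall>(x, y)\<in>set ps. \<exists>\<kappa>. homA \<mu> \<kappa> x \<and> homA \<kappa> \<nu> y" by blast
  then show ?case
    by (intro exI[of _ "map (\<lambda>(x, y). (csc c x, y)) ps"] conjI coproduct_rep_csc) (fastforce intro: homA.homA_csc)+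
next
  case (homA_conv \<mu> \<nu> a \<mu>' \<nu>' b)
  then obtain ps qs where pq: "coproduct_rep a ps" "coproduct_rep b qs" and
    p: "\<And>x y. (x, y) \<in> set ps \<Longrightarrow> \<exists>\<kappa>. homA \<mu> \<kappa> x \<and> homA \<kappa> \<nu> y" and
    q: "\<And>x y. (x, y) \<in> set qs \<Longrightarrow> \<exists>\<kappa>. homA \<mu>' \<kappa> x \<and> homA \<kappa> \<nu>' y" by blast
  have "\<exists>\<kappa>. homA (\<mu> + \<mu>') \<kappa> (x \<star> x') \<and> homA \<kappa> (\<nu> + \<nu>') (y \<star> y')"
    if "(x, y) \<in> set ps" "(x', y') \<in> set qs" for x y x' y'
    using p[OF that(1)] q[OF that(2)] by (meson homA.homA_conv)
  then have "\<forall>(x, y)\<in>set (map (\<lambda>((x, y), (x', y')). (x \<star> x', y \<star> y')) (List.product ps qs)).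
      \<exists>\<kappa>. homA (\<mu> + \<mu>') \<kappa> x \<and> homA \<kappa> (\<nu> + \<nu>') y" by auto
  with coproduct_rep_conv[OF pq] show ?case by blast
next
  case (homA_antip \<mu> \<nu> a)
  then obtain ps where pq: "coproduct_rep a ps" and
    p: "\<And>x y. (x, y) \<in> set ps \<Longrightarrow> \<exists>\<kappa>. homA \<mu> \<kappa> x \<and> homA \<kappa> \<nu> y" by blast
  have "\<exists>\<kappa>. homA (- \<nu>) \<kappa> (antip y) \<and> homA \<kappa> (- \<mu>) (antip x)" if "(x, y) \<in> set ps" for x y
    using p[OF that] by (meson homA.homA_antip)
  then have "\<forall>(x, y)\<in>set (map (\<lambda>(x, y). (antip y, antip x)) ps). \<exists>\<kappa>. homA (- \<nu>) \<kappa> x \<and> homA \<kappa> (- \<mu>) y" by auto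
  with coproduct_rep_antip[OF pq] show ?case by blast
qed

section \<open>The coordinate algebra as the span of its bihomogeneous elements\<close>

definition Hom :: "fnl set" where "Hom = {a. \<exists>\<mu> \<nu>. homA \<mu> \<nu> a}"

lemma coproduct_rep_span_Hom: "a \<in> fn.span Hom \<Longrightarrow> \<exists>ps. coproduct_rep a ps \<and> set ps \<subseteq> fn.span Hom \<times> fn.span Hom"
proof -
  let ?P = "{a. \<exists>ps. coproduct_rep a ps \<and> set ps \<subseteq> fn.span Hom \<times> fn.span Hom}"
  have "fn.span Hom \<subseteq> ?P"
  proof (rule fn.span_minimal)
    show "Hom \<subseteq> ?P"
    proof
      fix a assume "a \<in> Hom"
      then obtain \<mu> \<nu> where "homA \<mu> \<nu> a" by (auto simp: Hom_def)
      then obtain ps where ps: "coproduct_rep a ps" "\<forall>(x, y)\<in>set ps. \<exists>\<kappa>. homA \<mu> \<kappa> x \<and> homA \<kappa> \<nu> y" using homA_sweedler by blast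
      then have "set ps \<subseteq> fn.span Hom \<times> fn.span Hom" by (fastforce simp: Hom_def intro: fn.span_base)
      with ps show "a \<in> ?P" by blast
    qed
    have "coproduct_rep 0 []" by (simp add: coproduct_rep_def)
    moreover have "a + b \<in> ?P" if ab: "a \<in> ?P" "b \<in> ?P" for a b
    proof -
      obtain ps qs where p: "coproduct_rep a ps" "set ps \<subseteq> fn.span Hom \<times> fn.span Hom" and
        q: "coproduct_rep b qs" "set qs \<subseteq> fn.span Hom \<times> fn.span Hom" using ab by blast
      have "set (ps @ qs) \<subseteq> fn.span Hom \<times> fn.span Hom" using p q by simp
      with coproduct_rep_add[OF p(1) q(1)] show ?thesis by blast
    qed
    moreover have "csc c a \<in> ?P" if a: "a \<in> ?P" for a c
    proof -
      obtain ps where "coproduct_rep a ps" "set ps \<subseteq> fn.span Hom \<times> fn.span Hom" using a by blast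
      moreover from this have "set (map (\<lambda>(x, y). (csc c x, y)) ps) \<subseteq> fn.span Hom \<times> fn.span Hom"
        by (auto intro: fn.span_scale)
      ultimately show ?thesis using coproduct_rep_csc[of a ps c] by blast
    qed
    moreover have "0 \<in> ?P" using \<open>coproduct_rep 0 []\<close> by (intro CollectI exI[of _ "[]"]) simp
    ultimately show "fn.subspace ?P"
      unfolding fn.subspace_def by blast
  qed
  then show "a \<in> fn.span Hom \<Longrightarrow> \<exists>ps. coproduct_rep a ps \<and> set ps \<subseteq> fn.span Hom \<times> fn.span Hom" by blast
qed

lemma conv_span_Hom: assumes "a \<in> fn.span Hom" "b \<in> fn.span Hom" shows "a \<star> b \<in> fn.span Hom"
proof -
  have 1: "x \<star> y \<in> fn.span Hom" if "x \<in> Hom" "y \<in> fn.span Hom" for x y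
  proof -
    have "fn.span Hom \<subseteq> {y. x \<star> y \<in> fn.span Hom}"
      using that by (intro fn.span_minimal)
        (auto simp: Hom_def fn.subspace_def conv_add_right intro!: fn.span_zero fn.span_add fn.span_scale intro: fn.span_base homA_conv)
    then show ?thesis using that by blast
  qed
  have "fn.span Hom \<subseteq> {x. x \<star> b \<in> fn.span Hom}"
    using assms(2) 1 by (intro fn.span_minimal)
      (auto simp: fn.subspace_def conv_add_left intro!: fn.span_zero fn.span_add fn.span_scale)
  then show ?thesis using assms by blast
qed

lemma antip_span_Hom: assumes "a \<in> fn.span Hom" shows "antip a \<in> fn.span Hom"
proof -
  have "fn.span Hom \<subseteq> {x. antip x \<in> fn.span Hom}"
    by (intro fn.span_minimal)
      (auto simp: Hom_def fn.subspace_def intro!: fn.span_zero fn.span_add fn.span_scale intro: fn.span_base homA_antip)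
  then show ?thesis using assms by blast
qed

lemma span_Hom_Uq_dual: "fn.span Hom \<subseteq> D"
  using subspace_Uq_dual by (intro fn.span_minimal) (auto simp: Hom_def homA_Uq_dual)

lemma hopf_span_Hom: "hopf_subalgebra q (fn.span Hom)"
  unfolding hopf_subalgebra_def
proof (intro conjI ballI allI)
  show "fn.span Hom \<subseteq> hopf_dual q"
    using coproduct_rep_span_Hom span_Hom_Uq_dual by (fastforce simp: hopf_dual_def sweedler_iff)
  show "unit \<in> fn.span Hom" by (auto simp: Hom_def intro: fn.span_base homA_unit)
  fix a assume a: "a \<in> fn.span Hom"
  show "\<exists>ps. sweedler (fn.span Hom) (fn.span Hom) a ps" using coproduct_rep_span_Hom[OF a] by (auto simp: sweedler_iff)
  show "csc c a \<in> fn.span Hom" for c using a by (rule fn.span_scale)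
  show "antip a \<in> fn.span Hom" using a by (rule antip_span_Hom)
  fix b assume b: "b \<in> fn.span Hom"
  show "a + b \<in> fn.span Hom" using a b by (rule fn.span_add)
  show "a \<star> b \<in> fn.span Hom" using a b by (rule conv_span_Hom)
qed

abbreviation AA :: "fnl set" where "AA \<equiv> OqSU3 q"

text \<open>The span of the homogeneous elements is one of the Hopf subalgebras in the intersection;
  conversely each rule generating \<open>homA\<close> is a closure property of every competing
  subalgebra.\<close>

lemma OqSU3_eq: "AA = fn.span Hom"
proof
  have "\<forall>k\<in>{1..3}. \<forall>l\<in>{1..3}. u_coef q k l \<in> fn.span Hom"
    unfolding Hom_def using homA_u by (blast intro: fn.span_base)
  then show "AA \<subseteq> fn.span Hom"
    unfolding OqSU3_def using hopf_span_Hom by blast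
  show "fn.span Hom \<subseteq> AA"
    unfolding OqSU3_def
  proof (rule Inter_greatest)
    fix H assume "H \<in> {H. hopf_subalgebra q H \<and> (\<forall>k\<in>{1..3}. \<forall>l\<in>{1..3}. u_coef q k l \<in> H)}"
    then have H: "hopf_subalgebra q H" and u: "\<And>k l. k \<in> {1..3} \<Longrightarrow> l \<in> {1..3} \<Longrightarrow> u_coef q k l \<in> H" by auto
    have unit: "unit \<in> H" and add: "\<And>a b. a \<in> H \<Longrightarrow> b \<in> H \<Longrightarrow> a + b \<in> H" and conv: "\<And>a b. a \<in> H \<Longrightarrow> b \<in> H \<Longrightarrow> a \<star> b \<in> H"
      and csc: "\<And>c a. a \<in> H \<Longrightarrow> csc c a \<in> H" and antip: "\<And>a. a \<in> H \<Longrightarrow> antip a \<in> H"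
      using H by (auto simp: hopf_subalgebra_def)
    have "0 \<in> H" using csc[OF unit, of 0] by simp
    have "a \<in> H" if "homA \<mu> \<nu> a" for \<mu> \<nu> a
      using that by induction (blast intro: unit add conv csc antip u)+
    then show "fn.span Hom \<subseteq> H"
      using \<open>0 \<in> H\<close> add csc by (intro fn.span_minimal) (auto simp: fn.subspace_def Hom_def)
  qed
qed

lemma subspace_A: "fn.subspace AA" by (simp only: OqSU3_eq fn.subspace_span)

lemma A_zero [simp]: "0 \<in> AA" using subspace_A by (rule fn.subspace_0)
lemma A_add [simp]: "a \<in> AA \<Longrightarrow> b \<in> AA \<Longrightarrow> a + b \<in> AA" using subspace_A by (rule fn.subspace_add)
lemma A_minus [simp]: "a \<in> AA \<Longrightarrow> b \<in> AA \<Longrightarrow> a - b \<in> AA" using subspace_A by (rule fn.subspace_diff)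
lemma A_csc [simp]: "a \<in> AA \<Longrightarrow> csc c a \<in> AA" using subspace_A by (rule fn.subspace_scale)
lemma A_conv [simp]: "a \<in> AA \<Longrightarrow> b \<in> AA \<Longrightarrow> a \<star> b \<in> AA" by (simp only: OqSU3_eq conv_span_Hom)
lemma A_antip [simp]: "a \<in> AA \<Longrightarrow> antip a \<in> AA" by (simp only: OqSU3_eq antip_span_Hom)
lemma homA_A: "homA \<mu> \<nu> a \<Longrightarrow> a \<in> AA" by (auto simp: OqSU3_eq Hom_def intro: fn.span_base)
lemma A_unit [simp]: "unit \<in> AA" by (rule homA_A[OF homA_unit])
lemma A_Uq_dual [simp]: "a \<in> AA \<Longrightarrow> a \<in> D" using span_Hom_Uq_dual by (auto simp: OqSU3_eq)
lemma A_sw: "a \<in> AA \<Longrightarrow> \<exists>ps. coproduct_rep a ps \<and> set ps \<subseteq> AA \<times> AA" by (simp only: OqSU3_eq coproduct_rep_span_Hom)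

lemma A_sum_list: "(\<And>i. i \<in> set is \<Longrightarrow> f i \<in> AA) \<Longrightarrow> (\<Sum>i\<leftarrow>is. f i) \<in> AA"
proof (induction "is")
  case Nil
  show ?case by (simp only: list.map sum_list.Nil A_zero)
next
  case (Cons a "is")
  then have "f a \<in> AA" "(\<Sum>i\<leftarrow>is. f i) \<in> AA" by (meson list.set_intros)+
  then show ?case by (simp only: list.map sum_list.Cons A_add)
qed

lemma A_act [simp]: assumes "a \<in> AA" shows "X \<triangleright> a \<in> AA"
proof -
  obtain ps where ps: "coproduct_rep a ps" "set ps \<subseteq> AA \<times> AA" using A_sw[OF assms] by blast
  show ?thesis unfolding coproduct_rep_act[OF ps(1)] using ps(2) by (intro A_sum_list) (auto intro: A_csc)
qed

lemma A_rt [simp]: "a \<in> AA \<Longrightarrow> rt g a \<in> AA" using A_act[of a "lett g"] by simp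

text \<open>Summands are indexed by their pair of weights, so adding two decompositions merges the
  terms of equal weights.\<close>

lemma A_decomp:
  assumes "a \<in> AA"
  shows "\<exists>S f. finite S \<and> (\<forall>s\<in>S. homA (fst s) (snd s) (f s)) \<and> a = (\<Sum>s\<in>S. f s)"
proof -
  let ?P = "{a. \<exists>S f. finite S \<and> (\<forall>s\<in>S. homA (fst s) (snd s) (f s)) \<and> a = (\<Sum>s\<in>S. f s)}"
  have "fn.span Hom \<subseteq> ?P"
  proof (rule fn.span_minimal)
    show "Hom \<subseteq> ?P"
    proof
      fix a assume "a \<in> Hom"
      then obtain \<mu> \<nu> where *: "homA \<mu> \<nu> a" by (auto simp: Hom_def)
      have "a = (\<Sum>s\<in>{(\<mu>, \<nu>)}. a)" by (simp only: sum.insert sum.empty finite.emptyI empty_iff not_False_eq_True add_0_right)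
      then show "a \<in> ?P" using * by (intro CollectI exI[of _ "{(\<mu>, \<nu>)}"] exI[of _ "\<lambda>_. a"]) auto
    qed
    have 0: "0 \<in> ?P"
      by (intro CollectI exI[of _ "{}"]) (simp only: sum.empty finite.emptyI ball_empty simp_thms ex_simps)
    have add: "a + b \<in> ?P" if ab: "a \<in> ?P" "b \<in> ?P" for a b
    proof -
      from ab obtain S f S' g where S: "finite S" "\<forall>s\<in>S. homA (fst s) (snd s) (f s)" "a = (\<Sum>s\<in>S. f s)"
        and S': "finite S'" "\<forall>s\<in>S'. homA (fst s) (snd s) (g s)" "b = (\<Sum>s\<in>S'. g s)" by blast
      define h where "h s = (if s \<in> S then f s else 0) + (if s \<in> S' then g s else 0)" for s
      have "(\<Sum>s\<in>S \<union> S'. if s \<in> S then f s else 0) = a"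
        unfolding S(3) using S(1) S'(1) by (intro sum.mono_neutral_cong_right) auto
      moreover have "(\<Sum>s\<in>S \<union> S'. if s \<in> S' then g s else 0) = b"
        unfolding S'(3) using S(1) S'(1) by (intro sum.mono_neutral_cong_right) auto
      ultimately have "a + b = (\<Sum>s\<in>S \<union> S'. h s)"
        unfolding h_def by (simp only: sum.distrib)
      moreover have "\<forall>s\<in>S \<union> S'. homA (fst s) (snd s) (h s)"
        using S(2) S'(2) by (auto simp: h_def intro: homA_add)
      ultimately show ?thesis using S(1) S'(1) by blast
    qed
    have scale: "csc c a \<in> ?P" if a: "a \<in> ?P" for a c
    proof -
      from a obtain S f where S: "finite S" "\<forall>s\<in>S. homA (fst s) (snd s) (f s)" "a = (\<Sum>s\<in>S. f s)" by blast
      have "csc c a = (\<Sum>s\<in>S. csc c (f s))" unfolding S(3) by (rule fn.scale_sum_right)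
      moreover have "\<forall>s\<in>S. homA (fst s) (snd s) (csc c (f s))" using S(2) homA_csc by blast
      ultimately show ?thesis using S(1) by (intro CollectI exI[of _ S] exI[of _ "\<lambda>s. csc c (f s)"] conjI)
    qed
    show "fn.subspace ?P" unfolding fn.subspace_def by (intro conjI ballI allI 0 add scale)
  qed
  then show ?thesis using assms OqSU3_eq by blast
qed

text \<open>Sections of the homogeneous line bundle of weight \<nu> over the quantum flag manifold;
  weight 0 gives B itself.\<close>

definition Aw :: "(node \<Rightarrow> int) \<Rightarrow> fnl set"
  where "Aw \<nu> = {a \<in> AA. \<forall>i. rt (K i) a = csc (qc powi \<nu> i) a}"

lemma homA_Aw: "homA \<mu> \<nu> a \<Longrightarrow> a \<in> Aw \<nu>"
  using homA_weights homA_A by (simp add: Aw_def)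

text \<open>Filtering a bihomogeneous decomposition by the eigenvalues of K_1 and then of K_2 leaves
  the summands of right weight \<nu>; these are told apart by their left weight alone.\<close>

lemma Aw_decomp:
  assumes "a \<in> Aw \<nu>"
  shows "\<exists>S f. finite S \<and> (\<forall>\<mu>\<in>S. homA \<mu> \<nu> (f \<mu>)) \<and> a = (\<Sum>\<mu>\<in>S. f \<mu>)"
proof -
  obtain S f where S: "finite S" "\<forall>s\<in>S. homA (fst s) (snd s) (f s)" "a = (\<Sum>s\<in>S. f s)"
    using A_decomp[of a] assms by (auto simp: Aw_def)
  have wt: "rt (K i) (f s) = csc (qc powi snd s i) (f s)" if "s \<in> S" for s i
    using S(2) homA_weights that by blast
  have wta: "rt (K i) a = csc (qc powi \<nu> i) a" for i using assms by (simp add: Aw_def)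
  let ?S1 = "{s\<in>S. qc powi snd s N1 = qc powi \<nu> N1}"
  let ?S2 = "{s\<in>?S1. qc powi snd s N2 = qc powi \<nu> N2}"
  have a1: "a = (\<Sum>s\<in>?S1. f s)"
    by (rule eigen_filter[where T = "rt (K N1)" and c = "\<lambda>s. qc powi snd s N1", OF S(1) wt rt_linear(1,2) S(3) wta])
  have "finite ?S1" "\<And>s. s \<in> ?S1 \<Longrightarrow> rt (K N2) (f s) = csc (qc powi snd s N2) (f s)" using S(1) by (simp, simp only: mem_Collect_eq wt)
  then have a: "a = (\<Sum>s\<in>?S2. f s)"
    by (rule eigen_filter[where T = "rt (K N2)" and c = "\<lambda>s. qc powi snd s N2", OF _ _ rt_linear(1,2) a1 wta])
  have snd: "snd s = \<nu>" if "s \<in> ?S2" for s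
  proof
    fix i show "snd s i = \<nu> i" using that by (cases i) (auto simp: q_powi_inj)
  qed
  have inj: "inj_on fst ?S2" using snd by (intro inj_onI prod_eqI) auto
  have *: "(\<Sum>\<mu>\<in>fst ` ?S2. f (\<mu>, \<nu>)) = (\<Sum>s\<in>?S2. f (fst s, \<nu>))"
    using inj by (simp only: sum.reindex comp_def)
  have "(\<Sum>s\<in>?S2. f (fst s, \<nu>)) = (\<Sum>s\<in>?S2. f s)"
  proof (rule sum.cong)
    fix s assume "s \<in> ?S2"
    then have "(fst s, \<nu>) = s" using snd[of s] by (metis prod.collapse)
    then show "f (fst s, \<nu>) = f s" by simp
  qed simp
  with a * have "a = (\<Sum>\<mu>\<in>fst ` ?S2. f (\<mu>, \<nu>))" by simp
  moreover have "\<forall>\<mu>\<in>fst ` ?S2. homA \<mu> \<nu> (f (\<mu>, \<nu>))"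
  proof
    fix \<mu> assume "\<mu> \<in> fst ` ?S2"
    then obtain s where s: "s \<in> ?S2" "\<mu> = fst s" by blast
    then have "s = (\<mu>, \<nu>)" using snd[of s] by (metis prod.collapse)
    moreover have "homA (fst s) (snd s) (f s)" using s S(2) by blast
    ultimately show "homA \<mu> \<nu> (f (\<mu>, \<nu>))" by simp
  qed
  moreover have "finite (fst ` ?S2)" using S(1) by simp
  ultimately show ?thesis
    by (intro exI[of _ "fst ` ?S2"] exI[of _ "\<lambda>\<mu>. f (\<mu>, \<nu>)"] conjI)
qed

lemma subspace_Aw: "fn.subspace (Aw \<nu>)"
  unfolding fn.subspace_def by (auto simp: Aw_def csc_add mult.commute)

text \<open>Right translation touches the second leg only, so that leg can be chosen of the same
  right weight. For weight 0 this yields second legs in B, as \<open>coact_cot\<close>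
  demands.\<close>

lemma Aw_sw: assumes "a \<in> Aw \<nu>" shows "\<exists>ps. coproduct_rep a ps \<and> set ps \<subseteq> AA \<times> Aw \<nu>"
proof -
  obtain S f where S: "finite S" "\<forall>\<mu>\<in>S. homA \<mu> \<nu> (f \<mu>)" "a = (\<Sum>\<mu>\<in>S. f \<mu>)"
    using Aw_decomp[OF assms] by blast
  have "\<exists>ps. coproduct_rep (\<Sum>\<mu>\<in>S. f \<mu>) ps \<and> set ps \<subseteq> AA \<times> Aw \<nu>"
    using S(1,2)
  proof (induction S rule: finite_induct)
    case empty
    have "coproduct_rep 0 []" by (simp add: coproduct_rep_def)
    then show ?case by (intro exI[of _ "[]"]) (simp only: sum.empty list.set empty_subsetI simp_thms)
  next
    case (insert \<mu> S)
    then obtain ps where ps: "coproduct_rep (\<Sum>\<mu>\<in>S. f \<mu>) ps" "set ps \<subseteq> AA \<times> Aw \<nu>" by blast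
    obtain qs where qs: "coproduct_rep (f \<mu>) qs" "\<forall>(x, y)\<in>set qs. \<exists>\<kappa>. homA \<mu> \<kappa> x \<and> homA \<kappa> \<nu> y"
      using insert.prems homA_sweedler by blast
    have "set (qs @ ps) \<subseteq> AA \<times> Aw \<nu>" using ps(2) qs(2) homA_A homA_Aw by fastforce
    moreover have "coproduct_rep (\<Sum>\<mu>\<in>insert \<mu> S. f \<mu>) (qs @ ps)"
      using insert.hyps coproduct_rep_add[OF qs(1) ps(1)] by (simp only: sum.insert not_False_eq_True)
    ultimately show ?case by blast
  qed
  then show ?thesis using S(3) by simp
qed

abbreviation BB :: "fnl set" where "BB \<equiv> OqF3 q"

lemma B_eq: "BB = Aw 0"
proof -
  have "rt (Kinv i) a = a" if "a \<in> AA" "\<forall>i. rt (K i) a = a" for a i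
    using rt_Kinv_eq[of a i 0] that by simp
  then show ?thesis by (auto simp: OqF3_def Aw_def)
qed

lemma Aw_conv: "a \<in> Aw \<mu> \<Longrightarrow> b \<in> Aw \<nu> \<Longrightarrow> a \<star> b \<in> Aw (\<mu> + \<nu>)"
  by (auto simp: Aw_def rt_conv power_int_add mult.commute)

lemma Aw_A: "a \<in> Aw \<nu> \<Longrightarrow> a \<in> AA" by (simp add: Aw_def)

end

section \<open>Root vectors\<close>

lemma UNIV_rvec: "UNIV = {Eix A1, Eix A2, Eix A12, Fix A1, Fix A2, Fix A12}"
proof (rule UNIV_eq_I)
  show "r \<in> {Eix A1, Eix A2, Eix A12, Fix A1, Fix A2, Fix A12}" for r
    by (cases r; rename_tac \<gamma>; case_tac \<gamma>; simp)
qed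

lemma finite_rvec [simp]: "finite (UNIV :: rvec set)"
  by (simp add: UNIV_rvec)

lemma sum_rvec: "(\<Sum>r\<in>UNIV. f r) = f (Eix A1) + f (Eix A2) + f (Eix A12) + f (Fix A1) + f (Fix A2) + f (Fix A12)"
  for f :: "rvec \<Rightarrow> 'a::comm_monoid_add"
  by (simp add: UNIV_rvec add.assoc)

fun root_wt :: "root \<Rightarrow> node \<Rightarrow> int"
  where "root_wt A1 i = cartan i N1" | "root_wt A2 i = cartan i N2" | "root_wt A12 i = cartan i N1 + cartan i N2"

fun wt :: "rvec \<Rightarrow> node \<Rightarrow> int"
  where "wt (Eix \<gamma>) i = root_wt \<gamma> i" | "wt (Fix \<gamma>) i = - root_wt \<gamma> i"

text \<open>Lets an element dual to one root vector be found by weight alone, since a homogeneous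
  element of B can pair with at most one of the six.\<close>

lemma wt_inj: "wt r = wt s \<longleftrightarrow> r = s"
proof
  assume "wt r = wt s"
  then have "wt r N1 = wt s N1" "wt r N2 = wt s N2" by simp_all
  then show "r = s"
    by (cases r; cases s; rename_tac \<gamma> \<delta>; case_tac \<gamma>; case_tac \<delta>; simp add: cartan_def)
qed simp

lemma wt_nz: "wt r \<noteq> 0"
proof
  assume "wt r = 0"
  then have "wt r N1 = 0" "wt r N2 = 0" by simp_all
  then show False
    by (cases r; rename_tac \<gamma>; case_tac \<gamma>; simp add: cartan_def)
qed

lemma star_superset:
  assumes "finite S" "Poly_Mapping.keys X \<subseteq> S"
  shows "star X = (\<Sum>w\<in>S. fscale (cnj (Poly_Mapping.lookup X w)) (prod_list (rev (map star_gen (letters w)))))"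
  unfolding star_def using assms
  by (intro sum.mono_neutral_left) (auto simp: in_keys_iff)

lemma star_E: "star (lett (E i)) = lett (K i) * lett (F i)"
proof -
  have "star (lett (E i)) = (\<Sum>w\<in>{Word [E i]}. fscale (cnj (Poly_Mapping.lookup (lett (E i)) w)) (prod_list (rev (map star_gen (letters w)))))"
    by (rule star_superset) (simp_all add: lett_def mon_def)
  then show ?thesis by (simp add: lett_def mon_def)
qed

lemma star_E12: "star (Evec q A12) = lett (K N1) * lett (F N1) * (lett (K N2) * lett (F N2))
    - fscale (1 / complex_of_real q) (lett (K N2) * lett (F N2) * (lett (K N1) * lett (F N1)))"
proof -
  let ?v = "Word [E N2, E N1]" and ?w = "Word [E N1, E N2]"
  have Ev: "Evec q A12 = Poly_Mapping.single ?v 1 - Poly_Mapping.single ?w (1 / complex_of_real q)"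
    by (rule poly_mapping_eqI) (simp add: lett_def mon_def mult_single lookup_minus lookup_single when_def)
  have "Poly_Mapping.keys (Evec q A12) \<subseteq> {?v, ?w}"
    unfolding Ev by (auto simp: in_keys_iff lookup_minus lookup_single when_def split: if_splits)
  then have "star (Evec q A12) = (\<Sum>w\<in>{?v, ?w}. fscale (cnj (Poly_Mapping.lookup (Evec q A12) w)) (prod_list (rev (map star_gen (letters w)))))"
    by (intro star_superset) simp_all
  also have "\<dots> = lett (K N1) * lett (F N1) * (lett (K N2) * lett (F N2))
    - fscale (1 / complex_of_real q) (lett (K N2) * lett (F N2) * (lett (K N1) * lett (F N1)))"
    unfolding Ev by (simp add: lookup_minus lookup_single when_def)
  finally show ?thesis .
qed

lemma pair_linear: "pair X (a + b) = pair X a + pair X b" "pair X (a - b) = pair X a - pair X b"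
  "pair X (csc c a) = c * pair X a" "pair X 0 = 0"
  unfolding act_apply_0[symmetric] by simp_all

lemma act_X:
  "Xvec q (Eix A1) \<triangleright> a = rt (E N1) a"
  "Xvec q (Eix A2) \<triangleright> a = rt (E N2) a"
  "Xvec q (Eix A12) \<triangleright> a = rt (E N2) (rt (E N1) a) - csc (1 / complex_of_real q) (rt (E N1) (rt (E N2) a))"
  "Xvec q (Fix A1) \<triangleright> a = rt (K N1) (rt (F N1) a)"
  "Xvec q (Fix A2) \<triangleright> a = rt (K N2) (rt (F N2) a)"
  "Xvec q (Fix A12) \<triangleright> a = rt (K N1) (rt (F N1) (rt (K N2) (rt (F N2) a)))
     - csc (1 / complex_of_real q) (rt (K N2) (rt (F N2) (rt (K N1) (rt (F N1) a))))"
  by (simp_all add: star_E star_E12 del: Evec.simps(3)) simp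

text \<open>\<open>\<Delta>(X\<^sub>s) = \<Sum>\<^sub>r X\<^sub>r \<otimes> Gvec r s + 1 \<otimes> X\<^sub>s\<close>, so that \<open>r c = \<Sum>\<^sub>s \<langle>Gvec r s, c\<rangle> s\<close> in \<open>\<Lambda>\<^sup>1\<close>.\<close>

fun Kvec :: "root \<Rightarrow> gen free_alg"
  where "Kvec A1 = lett (K N1)" | "Kvec A2 = lett (K N2)" | "Kvec A12 = lett (K N1) * lett (K N2)"

fun root_of :: "rvec \<Rightarrow> root" where "root_of (Eix \<gamma>) = \<gamma>" | "root_of (Fix \<gamma>) = \<gamma>"

definition Gvec :: "real \<Rightarrow> rvec \<Rightarrow> rvec \<Rightarrow> gen free_alg"
  where "Gvec q r s = (if r = s then Kvec (root_of r)
     else if r = Eix A1 \<and> s = Eix A12 then fscale (complex_of_real q - 1 / complex_of_real q) (lett (K N1) * lett (E N2))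
     else if r = Fix A1 \<and> s = Fix A12 then fscale (complex_of_real q - 1 / complex_of_real q) (lett (K N2) * lett (F N2) * lett (K N1))
     else 0)"

context quantum_parameter
begin

abbreviation XX :: "rvec \<Rightarrow> gen free_alg" where "XX \<equiv> Xvec q"
abbreviation GG :: "rvec \<Rightarrow> rvec \<Rightarrow> gen free_alg" where "GG \<equiv> Gvec q"

lemma act_Uq_dual [simp]: assumes "a \<in> D" shows "X \<triangleright> a \<in> D"
proof (induction X rule: poly_mapping_single_induct)
  case (single k c)
  have m: "mon k \<triangleright> a \<in> D"
    by (induction k rule: word_induct) (simp_all only: mon_0 act_1 mon_act_plus rt_Uq_dual assms)
  have "Poly_Mapping.single k c = fscale c (mon k)"
    by (rule poly_mapping_eqI) (simp add: mon_def lookup_single when_def)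
  then show ?case using m subspace_Uq_dual by (simp only: act_linear_left fn.subspace_scale)
qed (use subspace_Uq_dual in \<open>simp_all only: act_linear_left fn.subspace_add fn.subspace_0\<close>)

lemmas rt_K_rules = rt_K_E rt_K_F rt_Kinv_E rt_Kinv_F

lemma rt_K2_K1: "a \<in> D \<Longrightarrow> rt (K N2) (rt (K N1) a) = rt (K N1) (rt (K N2) a)"
  by (rule rt_K_K)

text \<open>In the coproduct of E_2 E_1 - q^{-1} E_1 E_2 the terms with first leg E_2 cancel by K_2
  E_1 = q^{-1} E_1 K_2, whereas those with first leg E_1 add up to (q - q^{-1}) K_1 E_2. This is one
  off-diagonal entry of \<open>Gvec\<close>; the other is its image under the star.\<close>

lemma X_conv:
  assumes "a \<in> D" "b \<in> D"
  shows "XX t \<triangleright> (a \<star> b) = (\<Sum>r\<in>UNIV. (XX r \<triangleright> a) \<star> (GG r t \<triangleright> b)) + a \<star> (XX t \<triangleright> b)"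
  using assms
  by (cases t; rename_tac \<gamma>; case_tac \<gamma>)
    (simp_all del: Xvec.simps add: sum_rvec act_X Gvec_def rt_conv conv_add_left conv_add_right conv_minus_left conv_minus_right
      rt_K_rules cartan_def rt_K2_K1 csc_add csc_minus,
     simp_all add: fun_eq_iff field_simps power_int_minus power2_eq_square)

text \<open>The G_rs form a matrix coalgebra; this is what makes right multiplication of forms
  associative with multiplication in A.\<close>

lemma G_conv:
  assumes "a \<in> D" "b \<in> D"
  shows "GG r t \<triangleright> (a \<star> b) = (\<Sum>s\<in>UNIV. (GG r s \<triangleright> a) \<star> (GG s t \<triangleright> b))"
  using assms
  by (cases r; cases t; rename_tac \<gamma> \<delta>; case_tac \<gamma>; case_tac \<delta>)
    (simp_all add: sum_rvec Gvec_def rt_conv conv_add_left conv_add_right conv_minus_left conv_minus_right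
      rt_K_rules cartan_def rt_K2_K1 csc_add csc_minus)

lemma G_unit: "GG r t \<triangleright> unit = (if r = t then unit else 0)"
  by (cases r; cases t; rename_tac \<gamma> \<delta>; case_tac \<gamma>; case_tac \<delta>; simp add: Gvec_def)

lemma X_unit: "XX r \<triangleright> unit = 0"
  by (cases r; rename_tac \<gamma>; case_tac \<gamma>) (simp_all del: Xvec.simps add: act_X)

text \<open>Commuting K_i past X_r costs q to the weight of X_r, so acting by X_r shifts right
  weights by \<open>wt r\<close>.\<close>

lemma K_X: assumes "a \<in> D" shows "rt (K i) (XX r \<triangleright> a) = csc (qc powi wt r i) (XX r \<triangleright> rt (K i) a)"
  using assms
  by (cases i; cases r; rename_tac \<gamma>; case_tac \<gamma>)
    (simp_all del: Xvec.simps add: act_X rt_K_rules cartan_def rt_K2_K1 csc_minus,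
     simp_all add: fun_eq_iff field_simps power_int_minus power2_eq_square)

lemma K_G: assumes "a \<in> D" shows "rt (K i) (GG r s \<triangleright> a) = csc (qc powi (wt s i - wt r i)) (GG r s \<triangleright> rt (K i) a)"
  using assms
  by (cases i; cases r; cases s; rename_tac \<gamma> \<delta>; case_tac \<gamma>; case_tac \<delta>;
      simp add: Gvec_def rt_K_rules cartan_def rt_K2_K1 csc_minus;
      simp add: fun_eq_iff field_simps power_int_minus power2_eq_square)

lemma Aw_X: assumes "a \<in> Aw \<nu>" shows "XX r \<triangleright> a \<in> Aw (\<nu> + wt r)"
  using assms by (auto simp: Aw_def K_X power_int_add mult.commute simp del: Xvec.simps)

lemma Aw_G: assumes "a \<in> Aw \<nu>" shows "GG r s \<triangleright> a \<in> Aw (\<nu> + wt s - wt r)"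
  using assms by (auto simp: Aw_def K_G power_int_add power_int_diff mult.commute)

lemma Aw_X_B: "a \<in> BB \<Longrightarrow> XX r \<triangleright> a \<in> Aw (wt r)"
  using Aw_X[of a 0 r] by (simp only: B_eq add_0_left)

text \<open>At the empty word, left and right translation by K_i agree: both give the value of X_r
  \<triangleright> b at K_i. The left one produces the exponent \<mu> i, the right one
  \<open>wt r i\<close>.\<close>

lemma pair_X_weight:
  assumes "homA \<mu> 0 b" "\<mu> \<noteq> wt r" shows "pair (XX r) b = 0"
proof -
  from assms(2) obtain i where i: "\<mu> i \<noteq> wt r i" by auto
  have b: "b \<in> D" "lt (K i) b = csc (qc powi \<mu> i) b" "rt (K i) b = b"
    using homA_Uq_dual[OF assms(1)] homA_weights[OF assms(1), of i] by simp_all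
  have "(rt (K i) (XX r \<triangleright> b)) 0 = (lt (K i) (XX r \<triangleright> b)) 0"
    by (simp add: rt_apply lt_apply)
  then have "qc powi wt r i * pair (XX r) b = qc powi \<mu> i * pair (XX r) b"
    by (simp only: K_X[OF b(1)] lt_act b csc_apply act_linear act_apply_0)
  then show ?thesis using i by (simp add: q_powi_inj)
qed

lemma homA_eps: assumes "homA \<mu> 0 b" "\<mu> \<noteq> 0" shows "b 0 = 0"
proof -
  from assms(2) obtain i where i: "\<mu> i \<noteq> 0" by (auto simp: fun_eq_iff)
  have "(rt (K i) b) 0 = (lt (K i) b) 0" by (simp add: rt_apply lt_apply)
  then have "b 0 = qc powi \<mu> i * b 0" using homA_weights[OF assms(1), of i] by simp
  then show ?thesis using i q_powi_eq_1[of "\<mu> i"] by simp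
qed

lemma cot_act: "cot q y r = (XX r \<triangleright> y) 0"
  by (simp add: cot_def act_apply_0)

lemma homA_u_antip: assumes "i \<in> {1..3}" "j \<in> {1..3}" "k \<in> {1..3}"
  shows "homA (wtu i - wtu k) 0 (u_coef q i j \<star> antip (u_coef q j k))"
  using homA_conv[OF homA_u[OF assms(1,2)] homA_antip[OF homA_u[OF assms(2,3)]]] by simp

lemma K_antip_u: assumes "j \<in> {1..3}"
  shows "rt (K i) (antip (u_coef q j j)) = csc (qc powi (- wtu j i)) (antip (u_coef q j j))"
  using homA_weights[OF homA_antip[OF homA_u[OF assms assms]], of i] by simp

lemma exists_dual_element: "\<exists>b. homA (wt r) 0 b \<and> pair (XX r) b = 1"
proof -
  \<comment> \<open>The indices satisfy \<open>wtu i - wtu j = wt r\<close>. The factor S(u_jj) has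
    counit 1 and cancels the right weight of u_ij, which puts the product into B.\<close>
  define i :: nat where "i = (case r of Eix A1 \<Rightarrow> 2 | Eix A2 \<Rightarrow> 3 | Eix A12 \<Rightarrow> 3 | Fix A1 \<Rightarrow> 1 | Fix A2 \<Rightarrow> 2 | Fix A12 \<Rightarrow> 1)"
  define j :: nat where "j = (case r of Eix A1 \<Rightarrow> 1 | Eix A2 \<Rightarrow> 2 | Eix A12 \<Rightarrow> 1 | Fix A1 \<Rightarrow> 2 | Fix A2 \<Rightarrow> 3 | Fix A12 \<Rightarrow> 3)"
  have ij: "i \<in> {1..3}" "j \<in> {1..3}"
    unfolding i_def j_def by (simp_all split: rvec.split root.split)
  have N: "(1::nat) \<in> {1..3}" "2 \<in> {1..3::nat}" "3 \<in> {1..3::nat}" "Suc 0 \<in> {1..3}" "Suc (Suc 0) \<in> {1..3}" by auto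
  let ?b = "u_coef q i j \<star> antip (u_coef q j j)"
  have wt: "wtu i - wtu j = wt r"
  proof
    fix n show "(wtu i - wtu j) n = wt r n"
      unfolding i_def j_def
      by (cases n; cases r; rename_tac \<gamma>; case_tac \<gamma>; simp add: wtu_def cartan_def)
  qed
  have h: "homA (wt r) 0 ?b" using homA_u_antip[OF ij ij(2)] wt by simp
  have D: "u_coef q i j \<in> D" "antip (u_coef q j j) \<in> D"
    using u_coef_Uq_dual ij by simp_all
  have S: "antip (u_coef q j j) 0 = 1" by (simp add: antip_0 u_coef_0)
  have ne: "i \<noteq> j" unfolding i_def j_def by (simp split: rvec.split root.split)
  \<comment> \<open>The Leibniz term with X_r on S(u_jj) alone drops out because u_ij has counit
    0.\<close>
  have eq: "pair (XX r) ?b = (\<Sum>s\<in>UNIV. (XX s \<triangleright> u_coef q i j) 0 * (GG s r \<triangleright> antip (u_coef q j j)) 0)"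
    unfolding act_apply_0[symmetric] X_conv[OF D] using ne by (simp add: conv_0 u_coef_0 del: Xvec.simps)
  have "pair (XX r) ?b \<noteq> 0"
    unfolding eq unfolding i_def j_def
    using N D[unfolded i_def j_def] S[unfolded j_def]
    by (cases r; rename_tac \<gamma>; case_tac \<gamma>)
      (simp_all del: Xvec.simps add: sum_rvec act_X Gvec_def rt_u_coef K_antip_u u_coef_0 wtu_def)
  then have "pair (XX r) (csc (1 / pair (XX r) ?b) ?b) = 1"
    by (simp add: pair_linear)
  then show ?thesis using homA_csc[OF h] by blast
qed

definition dual_element :: "rvec \<Rightarrow> fnl"
  where "dual_element r = (SOME b. homA (wt r) 0 b \<and> pair (XX r) b = 1)"

lemma dual_element: "homA (wt r) 0 (dual_element r)" "pair (XX r) (dual_element r) = 1"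
  using someI_ex[OF exists_dual_element[of r]] by (simp_all add: dual_element_def)

text \<open>The pairings with the other five root vectors vanish by weight, so a single
  normalisation gives the whole dual basis.\<close>

lemma cot_dual_element: "cot q (dual_element r) = unitvec r"
proof
  fix s
  show "cot q (dual_element r) s = unitvec r s"
    using dual_element(2)[of r] pair_X_weight[OF dual_element(1), of r s] wt_inj[of r s]
    by (auto simp: cot_def unitvec_def)
qed

lemma dual_element_B: "dual_element r \<in> OqF3_plus q" "dual_element r \<in> BB" "dual_element r \<in> AA" "dual_element r 0 = 0"
proof -
  show 1: "dual_element r \<in> BB" using homA_Aw[OF dual_element(1)] by (simp only: B_eq)
  show 2: "dual_element r 0 = 0" using homA_eps[OF dual_element(1) wt_nz] .
  show "dual_element r \<in> OqF3_plus q" using 1 2 by (simp add: OqF3_plus_def counit_def)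
  show "dual_element r \<in> AA" using homA_A[OF dual_element(1)] .
qed

text \<open>Independence of the representative y: in X_s(y c) the term carrying eps(y) vanishes, and
  the remaining ones depend on y only through the numbers X_t(y).\<close>

lemma Lambda_act_eq: assumes "c \<in> AA" shows "Lambda_act q r c s = pair (GG r s) c"
proof -
  have "dual_element r \<in> OqSU3_plus q \<and> cot q (dual_element r) = unitvec r"
    using dual_element_B[of r] cot_dual_element by (simp add: OqSU3_plus_def counit_def)
  then have "Lambda_rep q r \<in> OqSU3_plus q \<and> cot q (Lambda_rep q r) = unitvec r"
    unfolding Lambda_rep_def by (rule someI[where P = "\<lambda>y. y \<in> OqSU3_plus q \<and> cot q y = unitvec r"])
  then have y: "Lambda_rep q r \<in> D" "Lambda_rep q r 0 = 0" "\<And>t. (XX t \<triangleright> Lambda_rep q r) 0 = of_bool (t = r)"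
    by (simp_all add: OqSU3_plus_def counit_def fun_eq_iff cot_act unitvec_def)
  have "Lambda_act q r c s = (XX s \<triangleright> (Lambda_rep q r \<star> c)) 0"
    by (simp add: Lambda_act_def cot_act)
  also have "\<dots> = (\<Sum>t\<in>UNIV. of_bool (t = r) * pair (GG t s) c)"
    using assms y by (simp add: X_conv conv_0 act_apply_0 del: Xvec.simps)
  also have "\<dots> = pair (GG r s) c" by (simp add: of_bool_def if_distrib if_distribR cong: if_cong)
  finally show ?thesis .
qed

text \<open>Right multiplication freed of the two choices inside \<open>rmult\<close>, that of
  representatives in Lambda^1 and that of a coproduct of c.\<close>

definition rmul :: "form1 \<Rightarrow> fnl \<Rightarrow> form1"
  where "rmul \<omega> c = (\<lambda>s. \<Sum>r\<in>UNIV. \<omega> r \<star> (GG r s \<triangleright> c))"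

lemma rmult_eq: assumes "c \<in> AA" shows "rmult q \<omega> c = rmul \<omega> c"
proof
  fix s
  define ps where "ps = (SOME ps. sweedler AA AA c ps)"
  have "\<exists>ps. sweedler AA AA c ps" using A_sw[OF assms] by (auto simp: sweedler_iff)
  then have "sweedler AA AA c ps" unfolding ps_def by (rule someI_ex)
  then have ps: "coproduct_rep c ps" "set ps \<subseteq> AA \<times> AA" by (auto simp: sweedler_iff)
  have "(\<Sum>(c1, c2)\<leftarrow>ps. csc (Lambda_act q r c2 s) (\<omega> r \<star> c1)) = \<omega> r \<star> (GG r s \<triangleright> c)" for r
  proof -
    have "(\<Sum>(c1, c2)\<leftarrow>ps. csc (Lambda_act q r c2 s) (\<omega> r \<star> c1)) = (\<Sum>(c1, c2)\<leftarrow>ps. \<omega> r \<star> csc (pair (GG r s) c2) c1)"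
      using ps(2) by (intro arg_cong[where f = sum_list] map_cong) (auto simp: Lambda_act_eq)
    then show ?thesis
      unfolding coproduct_rep_act[OF ps(1)] conv_sum_list_right by (simp only: case_prod_unfold)
  qed
  then show "rmult q \<omega> c s = rmul \<omega> c s"
    by (simp only: rmult_def rmul_def flip: ps_def)
qed

lemma rmul_rm: assumes "a \<in> D" "b \<in> D" shows "rmul (rmul \<omega> a) b = rmul \<omega> (a \<star> b)"
proof
  fix s
  have "rmul (rmul \<omega> a) b s = (\<Sum>t\<in>UNIV. \<Sum>r\<in>UNIV. \<omega> r \<star> ((GG r t \<triangleright> a) \<star> (GG t s \<triangleright> b)))"
    by (simp only: rmul_def conv_sum_left conv_assoc)
  also have "\<dots> = (\<Sum>r\<in>UNIV. \<Sum>t\<in>UNIV. \<omega> r \<star> ((GG r t \<triangleright> a) \<star> (GG t s \<triangleright> b)))"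
    by (rule sum.swap)
  also have "\<dots> = rmul \<omega> (a \<star> b) s"
    by (simp only: rmul_def G_conv[OF assms] conv_sum_right)
  finally show "rmul (rmul \<omega> a) b s = rmul \<omega> (a \<star> b) s" .
qed

lemma rmul_unit [simp]: "rmul \<omega> unit = \<omega>"
proof
  fix s
  have "(\<Sum>r\<in>UNIV. \<omega> r \<star> (if r = s then unit else 0)) = (\<Sum>r\<in>UNIV. if r = s then \<omega> r else 0)"
    by (intro sum.cong) simp_all
  then show "rmul \<omega> unit s = \<omega> s" by (simp only: rmul_def G_unit sum.delta finite_rvec if_True UNIV_I)
qed

lemma rmul_linear: "rmul (\<omega> + \<eta>) c = rmul \<omega> c + rmul \<eta> c" "rmul (\<lambda>r. csc k (\<omega> r)) c = (\<lambda>r. csc k (rmul \<omega> c r))"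
  "rmul \<omega> (c + d) = rmul \<omega> c + rmul \<omega> d" "rmul \<omega> (csc k c) = (\<lambda>r. csc k (rmul \<omega> c r))"
  by (simp_all add: fun_eq_iff rmul_def conv_add_left conv_add_right sum.distrib sum_distrib_left)

lemma rmul_lmult: "rmul (lmult a \<omega>) c = lmult a (rmul \<omega> c)"
  by (rule ext) (simp only: rmul_def lmult_def conv_assoc conv_sum_right)

lemma diff_conv: assumes "a \<in> D" "b \<in> D" shows "diff q (a \<star> b) = rmul (diff q a) b + lmult a (diff q b)"
  by (rule ext) (simp only: diff_def X_conv[OF assms] rmul_def lmult_def plus_fun_apply)

text \<open>The cotensor product of A with Lambda^1 over the torus, written in weights;
  \<open>Omega1_eq\<close> identifies it with the calculus on B.\<close>

definition Forms1 :: "form1 set" where "Forms1 = {\<omega>. \<forall>r. \<omega> r \<in> Aw (wt r)}"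

lemma Aw_sum: "(\<And>i. i \<in> S \<Longrightarrow> f i \<in> Aw \<nu>) \<Longrightarrow> (\<Sum>i\<in>S. f i) \<in> Aw \<nu>"
  using subspace_Aw by (rule fn.subspace_sum)

text \<open>The operator G_rs shifts weights by \<open>wt s - wt r\<close>, which exactly exchanges
  the weight of the old slot for that of the new one.\<close>

lemma rmul_Aw: assumes "\<And>r. \<omega> r \<in> Aw (wt r + \<mu>)" "c \<in> Aw \<nu>" shows "rmul \<omega> c s \<in> Aw (wt s + (\<mu> + \<nu>))"
proof -
  have "\<omega> r \<star> (GG r s \<triangleright> c) \<in> Aw (wt s + (\<mu> + \<nu>))" for r
    using Aw_conv[OF assms(1)[of r] Aw_G[OF assms(2), of r s]] by (simp add: algebra_simps)
  then show ?thesis unfolding rmul_def by (intro Aw_sum)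
qed

lemma Forms1_rm: "\<omega> \<in> Forms1 \<Longrightarrow> b \<in> BB \<Longrightarrow> rmul \<omega> b \<in> Forms1"
  using rmul_Aw[of \<omega> 0 b 0] by (auto simp: Forms1_def B_eq)

lemma B_A: "b \<in> BB \<Longrightarrow> b \<in> AA" by (simp only: B_eq Aw_A)

lemma Omega1_sub: "\<omega> \<in> Omega1 q \<Longrightarrow> \<omega> \<in> Forms1"
proof (induction rule: Omega1.induct)
  case (diff b)
  then show ?case using Aw_X_B by (simp only: Forms1_def diff_def mem_Collect_eq simp_thms)
next
  case (add \<omega> \<eta>)
  then have "\<omega> r + \<eta> r \<in> Aw (wt r)" for r using subspace_Aw fn.subspace_add by (auto simp: Forms1_def)
  then show ?case unfolding Forms1_def plus_fun_def[of \<omega> \<eta>] by blast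
next
  case (left b \<omega>)
  then have "b \<star> \<omega> r \<in> Aw (0 + wt r)" for r by (intro Aw_conv) (auto simp: B_eq Forms1_def)
  then show ?case by (simp only: Forms1_def mem_Collect_eq lmult_def add_0_left simp_thms)
next
  case (right b \<omega>)
  then have "rmul \<omega> b \<in> Forms1" by (intro Forms1_rm)
  then show ?case using right rmult_eq[OF B_A] by metis
qed

text \<open>\<open>a \<otimes> [b] = \<Sum> a S(b\<^sub>(\<^sub>1\<^sub>)) d b\<^sub>(\<^sub>2\<^sub>)\<close>.\<close>

lemma antipode_X:
  assumes "b \<in> D" "coproduct_rep b ps" shows "(\<Sum>(x, y)\<leftarrow>ps. a \<star> antip x \<star> (X \<triangleright> y)) = csc (pair X b) a"
proof -
  have "(\<Sum>(x, y)\<leftarrow>ps. a \<star> antip x \<star> (X \<triangleright> y)) = a \<star> (\<Sum>(x, y)\<leftarrow>map (\<lambda>(x, y). (x, X \<triangleright> y)) ps. antip x \<star> y)"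
    unfolding conv_sum_list_right by (simp only: case_prod_unfold conv_assoc map_map comp_def fst_conv snd_conv)
  also have "\<dots> = a \<star> csc ((X \<triangleright> b) 0) unit"
    using antipode_left[OF act_Uq_dual[OF assms(1)] coproduct_rep_act_right[OF assms(2)]] by simp
  finally show ?thesis by (simp add: act_apply_0)
qed

text \<open>The coproduct is chosen with weights on all legs, so that S of a first leg has right
  weight \<open>- wt r\<close> and the second leg lies in B.\<close>

definition dual_coproduct :: "rvec \<Rightarrow> (fnl \<times> fnl) list"
  where "dual_coproduct r = (SOME ps. coproduct_rep (dual_element r) ps \<and> (\<forall>(x, y)\<in>set ps. \<exists>\<kappa>. homA (wt r) \<kappa> x \<and> homA \<kappa> 0 y))"

lemma dual_coproduct: "coproduct_rep (dual_element r) (dual_coproduct r)"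
  "(x, y) \<in> set (dual_coproduct r) \<Longrightarrow> x \<in> AA" "(x, y) \<in> set (dual_coproduct r) \<Longrightarrow> antip x \<in> Aw (- wt r)"
  "(x, y) \<in> set (dual_coproduct r) \<Longrightarrow> y \<in> BB"
proof -
  have *: "coproduct_rep (dual_element r) (dual_coproduct r) \<and> (\<forall>(x, y)\<in>set (dual_coproduct r). \<exists>\<kappa>. homA (wt r) \<kappa> x \<and> homA \<kappa> 0 y)"
    unfolding dual_coproduct_def by (rule someI_ex[OF homA_sweedler[OF dual_element(1)]])
  then show "coproduct_rep (dual_element r) (dual_coproduct r)" ..
  assume "(x, y) \<in> set (dual_coproduct r)"
  with * obtain \<kappa> where "homA (wt r) \<kappa> x" "homA \<kappa> 0 y" by blast
  then show "x \<in> AA" "antip x \<in> Aw (- wt r)" "y \<in> BB"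
    using homA_A homA_Aw homA_antip B_eq by blast+
qed

lemma dual_antipode: "(\<Sum>(x, y)\<leftarrow>dual_coproduct r. a \<star> antip x \<star> (XX s \<triangleright> y)) = (if r = s then a else 0)"
proof -
  have "pair (XX s) (dual_element r) = of_bool (s = r)"
    using fun_cong[OF cot_dual_element[of r], of s] by (simp add: cot_def unitvec_def)
  then show ?thesis
    using antipode_X[OF homA_Uq_dual[OF dual_element(1)] dual_coproduct(1), of a "XX s"] by (auto simp del: Xvec.simps)
qed

lemma Omega1_zero: "0 \<in> Omega1 q"
proof -
  have "0 \<in> BB" using fn.subspace_0[OF subspace_Aw] by (simp only: B_eq)
  then have "diff q 0 \<in> Omega1 q" by (rule Omega1.diff)
  moreover have "diff q 0 = 0" by (simp add: diff_def fun_eq_iff del: Xvec.simps)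
  ultimately show ?thesis by simp
qed

lemma Omega1_sum_list: "(\<And>i. i \<in> set is \<Longrightarrow> f i \<in> Omega1 q) \<Longrightarrow> (\<Sum>i\<leftarrow>is. f i) \<in> Omega1 q"
proof (induction "is")
  case Nil
  show ?case by (simp only: list.map sum_list.Nil Omega1_zero)
next
  case (Cons a "is")
  then have "f a \<in> Omega1 q" "(\<Sum>i\<leftarrow>is. f i) \<in> Omega1 q" by (meson list.set_intros)+
  then show ?case by (simp only: list.map sum_list.Cons Omega1.add)
qed

definition all_rvecs :: "rvec list" where "all_rvecs = [Eix A1, Eix A2, Eix A12, Fix A1, Fix A2, Fix A12]"

lemma sum_all_rvecs: "(\<Sum>r\<leftarrow>all_rvecs. f r) = (\<Sum>r\<in>UNIV. f r)" for f :: "rvec \<Rightarrow> 'a::comm_monoid_add"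
  by (simp add: all_rvecs_def sum_rvec add.assoc)

lemma form1_decomp:
  "\<omega> = (\<Sum>r\<leftarrow>all_rvecs. \<Sum>(x, y)\<leftarrow>dual_coproduct r. lmult (\<omega> r \<star> antip x) (diff q y))"
proof
  fix s
  have "(\<Sum>r\<leftarrow>all_rvecs. \<Sum>(x, y)\<leftarrow>dual_coproduct r. lmult (\<omega> r \<star> antip x) (diff q y)) s
      = (\<Sum>r\<leftarrow>all_rvecs. \<Sum>(x, y)\<leftarrow>dual_coproduct r. \<omega> r \<star> antip x \<star> (XX s \<triangleright> y))"
    by (simp only: sum_list_fun_apply lmult_def diff_def case_prod_unfold)
  also have "\<dots> = (\<Sum>r\<in>UNIV. if r = s then \<omega> r else 0)"
    unfolding dual_antipode sum_all_rvecs ..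
  also have "\<dots> = \<omega> s" by (simp only: sum.delta finite_rvec if_True UNIV_I)
  finally show "\<omega> s = (\<Sum>r\<leftarrow>all_rvecs. \<Sum>(x, y)\<leftarrow>dual_coproduct r. lmult (\<omega> r \<star> antip x) (diff q y)) s" ..
qed

lemma Aw_antip_B: assumes "a \<in> Aw (wt r)" "(x, y) \<in> set (dual_coproduct r)" shows "a \<star> antip x \<in> BB"
  using Aw_conv[OF assms(1) dual_coproduct(3)[OF assms(2)]] by (simp add: B_eq)

text \<open>Takeuchi's equivalence in degree one. In \<open>form1_decomp\<close> the coefficient at
  r has weight \<open>wt r\<close> and S(x) the opposite weight, so any form with the prescribed
  weights is a B-combination of differentials.\<close>

lemma Omega1_eq: "Omega1 q = Forms1"
proof
  show "Omega1 q \<subseteq> Forms1" using Omega1_sub by blast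
  show "Forms1 \<subseteq> Omega1 q"
  proof
    fix \<omega> assume w: "\<omega> \<in> Forms1"
    have "(\<Sum>r\<leftarrow>all_rvecs. \<Sum>(x, y)\<leftarrow>dual_coproduct r. lmult (\<omega> r \<star> antip x) (diff q y)) \<in> Omega1 q"
    proof (intro Omega1_sum_list)
      fix r p assume p: "p \<in> set (dual_coproduct r)"
      obtain x y where [simp]: "p = (x, y)" by (cases p)
      have "\<omega> r \<star> antip x \<in> BB" using p w by (intro Aw_antip_B) (auto simp: Forms1_def)
      moreover have "y \<in> BB" using p dual_coproduct(4) by simp
      ultimately show "(case p of (x, y) \<Rightarrow> lmult (\<omega> r \<star> antip x) (diff q y)) \<in> Omega1 q"
        by (auto intro: Omega1.left Omega1.diff)
    qed
    then show "\<omega> \<in> Omega1 q" by (simp only: form1_decomp[of \<omega>, symmetric])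
  qed
qed

end

section \<open>Ideals of free algebras and coactions\<close>

lemma lett_mult: "lett a * lett b = mon (Word [a, b])"
  by (simp add: lett_def mon_def mult_single)

text \<open>Congruence arithmetic modulo a generated ideal, used for both V and Omega.
  Multiplication by a letter requires that the letter belong to M, because \<open>ideal_gen\<close>
  admits only words over M.\<close>

locale word_ideal =
  fixes M :: "'m set" and S :: "'m free_alg set"
begin

abbreviation J :: "'m free_alg set" where "J \<equiv> ideal_gen M S"

lemma subspace_J: "flin.subspace J"
  by (simp add: ideal_gen_def)

lemma J_zero: "0 \<in> J" and J_add: "x \<in> J \<Longrightarrow> y \<in> J \<Longrightarrow> x + y \<in> J" and J_minus: "x \<in> J \<Longrightarrow> y \<in> J \<Longrightarrow> x - y \<in> J"
  and J_scale: "x \<in> J \<Longrightarrow> fscale c x \<in> J" and J_neg: "x \<in> J \<Longrightarrow> - x \<in> J"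
  using subspace_J by (simp_all add: flin.subspace_0 flin.subspace_add flin.subspace_diff flin.subspace_scale flin.subspace_neg)

lemma J_gen: "s \<in> S \<Longrightarrow> set (letters u) \<subseteq> M \<Longrightarrow> set (letters v) \<subseteq> M \<Longrightarrow> mon u * s * mon v \<in> J"
  unfolding ideal_gen_def by (rule flin.span_base) auto

lemma J_base: "s \<in> S \<Longrightarrow> s \<in> J"
  using J_gen[of s 0 0] by simp

lemma fscale_mult_left: "fscale c x * y = fscale c (x * y)" and fscale_mult_right: "x * fscale c y = fscale c (x * y)"
  for x y :: "'m free_alg"
proof -
  have *: "fscale c x = Poly_Mapping.single 0 c * x" for c and x :: "'m free_alg"
    by (simp add: fscale_def mult_map_scale_conv_mult)
  have comm: "Poly_Mapping.single 0 c * x = x * Poly_Mapping.single 0 c" for c and x :: "'m free_alg"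
    by (induction x rule: poly_mapping_single_induct) (simp_all add: mult_single algebra_simps)
  show "fscale c x * y = fscale c (x * y)" by (simp add: * mult.assoc)
  show "x * fscale c y = fscale c (x * y)" by (metis * comm mult.assoc)
qed

lemma J_lett_left: assumes "x \<in> J" "a \<in> M" shows "lett a * x \<in> J"
proof -
  have "flin.span {mon u * s * mon v |u s v. set (letters u) \<subseteq> M \<and> s \<in> S \<and> set (letters v) \<subseteq> M} \<subseteq> {x. lett a * x \<in> J}"
  proof (rule flin.span_minimal)
    show "{mon u * s * mon v |u s v. set (letters u) \<subseteq> M \<and> s \<in> S \<and> set (letters v) \<subseteq> M} \<subseteq> {x. lett a * x \<in> J}"
    proof clarify
      fix u s v assume "set (letters u) \<subseteq> M" "s \<in> S" "set (letters v) \<subseteq> M"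
      then have "mon (Word [a] + u) * s * mon v \<in> J" using assms by (intro J_gen) auto
      then show "lett a * (mon u * s * mon v) \<in> J" by (simp add: mon_plus lett_def mult.assoc)
    qed
    show "flin.subspace {x. lett a * x \<in> J}"
      by (auto simp: flin.subspace_def J_zero distrib_left J_add fscale_mult_right J_scale)
  qed
  moreover have "x \<in> flin.span {mon u * s * mon v |u s v. set (letters u) \<subseteq> M \<and> s \<in> S \<and> set (letters v) \<subseteq> M}" using assms(1) unfolding ideal_gen_def .
  ultimately show ?thesis by blast
qed

lemma J_lett_right: assumes "x \<in> J" "a \<in> M" shows "x * lett a \<in> J"
proof -
  have "flin.span {mon u * s * mon v |u s v. set (letters u) \<subseteq> M \<and> s \<in> S \<and> set (letters v) \<subseteq> M} \<subseteq> {x. x * lett a \<in> J}"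
  proof (rule flin.span_minimal)
    show "{mon u * s * mon v |u s v. set (letters u) \<subseteq> M \<and> s \<in> S \<and> set (letters v) \<subseteq> M} \<subseteq> {x. x * lett a \<in> J}"
    proof clarify
      fix u s v assume "set (letters u) \<subseteq> M" "s \<in> S" "set (letters v) \<subseteq> M"
      then have "mon u * s * mon (v + Word [a]) \<in> J" using assms by (intro J_gen) auto
      then show "mon u * s * mon v * lett a \<in> J" by (simp add: mon_plus lett_def mult.assoc)
    qed
    show "flin.subspace {x. x * lett a \<in> J}"
      by (auto simp: flin.subspace_def J_zero distrib_right J_add fscale_mult_left J_scale)
  qed
  moreover have "x \<in> flin.span {mon u * s * mon v |u s v. set (letters u) \<subseteq> M \<and> s \<in> S \<and> set (letters v) \<subseteq> M}" using assms(1) unfolding ideal_gen_def .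
  ultimately show ?thesis by blast
qed

definition cong :: "'m free_alg \<Rightarrow> 'm free_alg \<Rightarrow> bool"  (infix \<open>\<approx>\<close> 50)
  where "x \<approx> y \<longleftrightarrow> x - y \<in> J"

lemma cong_refl [simp]: "x \<approx> x" by (simp add: cong_def J_zero)
lemma cong_sym: "x \<approx> y \<Longrightarrow> y \<approx> x" using J_neg[of "x - y"] by (simp add: cong_def)
lemma cong_trans [trans]: "x \<approx> y \<Longrightarrow> y \<approx> z \<Longrightarrow> x \<approx> z" using J_add[of "x - y" "y - z"] by (simp add: cong_def)
lemma cong_add: "x \<approx> y \<Longrightarrow> x' \<approx> y' \<Longrightarrow> x + x' \<approx> y + y'" using J_add[of "x - y" "x' - y'"] by (simp add: cong_def algebra_simps)
lemma cong_scale: "x \<approx> y \<Longrightarrow> fscale c x \<approx> fscale c y" using J_scale[of "x - y" c] by (simp add: cong_def flin.scale_right_diff_distrib)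
lemma cong_sum: "(\<And>i. i \<in> A \<Longrightarrow> f i \<approx> g i) \<Longrightarrow> (\<Sum>i\<in>A. f i) \<approx> (\<Sum>i\<in>A. g i)"
  by (induction A rule: infinite_finite_induct) (auto intro: cong_add)
lemma cong_sum_list: "(\<And>i. i \<in> set is \<Longrightarrow> f i \<approx> g i) \<Longrightarrow> (\<Sum>i\<leftarrow>is. f i) \<approx> (\<Sum>i\<leftarrow>is. g i)"
  by (induction "is") (auto intro: cong_add)
lemma cong_lett_left: "x \<approx> y \<Longrightarrow> a \<in> M \<Longrightarrow> lett a * x \<approx> lett a * y"
  using J_lett_left[of "x - y" a] by (simp add: cong_def right_diff_distrib)
lemma cong_lett_right: "x \<approx> y \<Longrightarrow> a \<in> M \<Longrightarrow> x * lett a \<approx> y * lett a"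
  using J_lett_right[of "x - y" a] by (simp add: cong_def left_diff_distrib)
lemma cong_mem: "x \<approx> y \<Longrightarrow> x \<in> J \<longleftrightarrow> y \<in> J"
  using J_add[of "x - y" y] J_minus[of x "x - y"] by (auto simp: cong_def)

lemma cls_eq_iff: "cls J x = cls J y \<longleftrightarrow> x \<approx> y"
proof
  assume "cls J x = cls J y"
  moreover have "x \<in> cls J x" by (simp add: cls_def J_zero)
  ultimately show "x \<approx> y" by (simp add: cls_def cong_def)
next
  assume "x \<approx> y"
  then have "z - x \<in> J \<longleftrightarrow> z - y \<in> J" for z
    using J_add[of "z - x" "x - y"] J_minus[of "z - y" "x - y"] by (auto simp: cong_def)
  then show "cls J x = cls J y" by (simp add: cls_def)
qed

lemma qspan_eq: "qspan J ((\<lambda>i. cls J (b i)) ` A) = {cls J (\<Sum>i\<in>A. fscale (c i) (b i)) |c. True}" if "finite A"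
proof -
  let ?T = "{x. \<exists>i\<in>A. x \<approx> b i}"
  have T: "{x. cls J x \<in> (\<lambda>i. cls J (b i)) ` A} = ?T" by (auto simp: cls_eq_iff)
  let ?U = "{x. \<exists>c. x \<approx> (\<Sum>i\<in>A. fscale (c i) (b i))}"
  have "flin.span ?T \<subseteq> ?U"
  proof (rule flin.span_minimal)
    show "?T \<subseteq> ?U"
    proof clarify
      fix x i assume i: "i \<in> A" "x \<approx> b i"
      have "(\<Sum>j\<in>A. fscale (of_bool (j = i)) (b j)) = (\<Sum>j\<in>A. if j = i then b j else 0)" by (intro sum.cong) auto
      also have "\<dots> = b i" using i that by simp
      finally show "\<exists>c. x \<approx> (\<Sum>i\<in>A. fscale (c i) (b i))" using i by (intro exI[of _ "\<lambda>j. of_bool (j = i)"]) simp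
    qed
    show "flin.subspace ?U"
      unfolding flin.subspace_def
    proof (intro conjI ballI allI)
      show "0 \<in> ?U" by (intro CollectI exI[of _ "\<lambda>_. 0"]) simp
    next
      fix x y assume "x \<in> ?U" "y \<in> ?U"
      then obtain c d where "x \<approx> (\<Sum>i\<in>A. fscale (c i) (b i))" "y \<approx> (\<Sum>i\<in>A. fscale (d i) (b i))" by auto
      then have "x + y \<approx> (\<Sum>i\<in>A. fscale (c i + d i) (b i))"
        using cong_add by (fastforce simp: flin.scale_left_distrib sum.distrib)
      then show "x + y \<in> ?U" by (intro CollectI exI[of _ "\<lambda>i. c i + d i"])
    next
      fix x k assume "x \<in> ?U"
      then obtain c where "x \<approx> (\<Sum>i\<in>A. fscale (c i) (b i))" by auto
      then have "fscale k x \<approx> (\<Sum>i\<in>A. fscale (k * c i) (b i))"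
        by (drule_tac cong_scale[where c = k]) (simp add: flin.scale_sum_right)
      then show "fscale k x \<in> ?U" by (intro CollectI exI[of _ "\<lambda>i. k * c i"])
    qed
  qed
  moreover have "(\<Sum>i\<in>A. fscale (c i) (b i)) \<in> flin.span ?T" for c
    by (intro flin.span_sum flin.span_scale flin.span_base) (use cong_refl in blast)
  ultimately show ?thesis unfolding qspan_def T by (fastforce simp: cls_eq_iff)
qed

end

text \<open>Letters become linear in their vector only modulo the relations \<open>lin_rels\<close>;
  the free algebra itself treats x + y as a new letter.\<close>

lemma cong_lett_add:
  fixes M :: "'m::ab_group_add set"
  assumes "lin_rels sc M \<subseteq> S" "x \<in> M" "y \<in> M" shows "word_ideal.cong M S (lett (x + y)) (lett x + lett y)"
proof -
  interpret word_ideal M S .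
  have "lett (x + y) - lett x - lett y \<in> J" using assms by (intro J_base) (auto simp: lin_rels_def)
  then show ?thesis by (simp add: cong_def diff_diff_eq)
qed

lemma cong_lett_scale:
  fixes M :: "'m::ab_group_add set"
  assumes "lin_rels sc M \<subseteq> S" "x \<in> M" shows "word_ideal.cong M S (lett (sc c x)) (fscale c (lett x))"
proof -
  interpret word_ideal M S .
  have "lett (sc c x) - fscale c (lett x) \<in> J" using assms by (intro J_base) (auto simp: lin_rels_def)
  then show ?thesis by (simp add: cong_def)
qed

lemma cong_lett_sum_list:
  fixes M :: "'m::ab_group_add set"
  assumes "lin_rels sc M \<subseteq> S" "0 \<in> M" "\<And>x y. x \<in> M \<Longrightarrow> y \<in> M \<Longrightarrow> x + y \<in> M" "\<And>i. i \<in> set is \<Longrightarrow> f i \<in> M"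
  shows "word_ideal.cong M S (lett (\<Sum>i\<leftarrow>is. f i)) (\<Sum>i\<leftarrow>is. lett (f i)) \<and> (\<Sum>i\<leftarrow>is. f i) \<in> M"
  using assms(4)
proof (induction "is")
  case Nil
  interpret word_ideal M S .
  have "lett (0 + 0 :: 'm) \<approx> lett 0 + lett 0" using cong_lett_add[OF assms(1,2,2)] .
  then have "lett (0 :: 'm) \<approx> 0" using J_neg by (fastforce simp: cong_def)
  then show ?case using assms(2) by simp
next
  case (Cons i "is")
  interpret word_ideal M S .
  have IH: "lett (\<Sum>i\<leftarrow>is. f i) \<approx> (\<Sum>i\<leftarrow>is. lett (f i))" "(\<Sum>i\<leftarrow>is. f i) \<in> M" "f i \<in> M"
    using Cons by auto
  have "lett (f i + (\<Sum>i\<leftarrow>is. f i)) \<approx> lett (f i) + lett (\<Sum>i\<leftarrow>is. f i)"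
    using cong_lett_add[OF assms(1) IH(3,2)] .
  also have "\<dots> \<approx> lett (f i) + (\<Sum>i\<leftarrow>is. lett (f i))" using IH by (intro cong_add) simp_all
  finally show ?case using IH assms(3) by simp
qed

text \<open>A test functional on A \<otimes> T: evaluation at X on the first leg and the linear
  extension of L on the second. Congruences modulo N \<otimes> T + A \<otimes> J are exploited with
  X annihilating N and L controlled on J.\<close>

definition ev :: "gen word \<Rightarrow> ('m word \<Rightarrow> complex) \<Rightarrow> ('m word \<Rightarrow>\<^sub>0 fnl) \<Rightarrow> complex"
  where "ev X L T = (\<Sum>w\<in>Poly_Mapping.keys T. Poly_Mapping.lookup T w X * L w)"

lemma ev_superset:
  assumes "finite S" "Poly_Mapping.keys T \<subseteq> S"
  shows "ev X L T = (\<Sum>w\<in>S. Poly_Mapping.lookup T w X * L w)"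
  unfolding ev_def using assms
  by (intro sum.mono_neutral_left) (auto simp: in_keys_iff)

lemma ev_add: "ev X L (s + t) = ev X L s + ev X L t"
proof -
  let ?S = "Poly_Mapping.keys s \<union> Poly_Mapping.keys t"
  have "ev X L z = (\<Sum>k\<in>?S. Poly_Mapping.lookup z k X * L k)" if "z \<in> {s, t, s + t}" for z
    using that keys_add[of s t] by (intro ev_superset) auto
  then show ?thesis
    by (simp add: lookup_add algebra_simps sum.distrib)
qed

lemma ev_zero [simp]: "ev X L 0 = 0" by (simp add: ev_def)

lemma ev_minus: "ev X L (s - t) = ev X L s - ev X L t"
  using ev_add[of X L "s - t" t] by simp

lemma ev_sum: "ev X L (\<Sum>i\<in>A. f i) = (\<Sum>i\<in>A. ev X L (f i))"
  by (induction A rule: infinite_finite_induct) (simp_all add: ev_add)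

lemma ev_sum_list: "ev X L (\<Sum>i\<leftarrow>is. f i) = (\<Sum>i\<leftarrow>is. ev X L (f i))"
  by (induction "is") (simp_all add: ev_add)

lemma lookup_otimes: "Poly_Mapping.lookup (otimes a x) w = csc (Poly_Mapping.lookup x w) a"
  unfolding otimes_def by (simp add: map.rep_eq when_def)

lemma ev_otimes: "ev X L (otimes a x) = a X * lsum L x"
proof -
  have "ev X L (otimes a x) = (\<Sum>w\<in>Poly_Mapping.keys x. Poly_Mapping.lookup (otimes a x) w X * L w)"
    by (intro ev_superset) (auto simp: in_keys_iff lookup_otimes)
  then show ?thesis by (simp add: lookup_otimes lsum_def sum_distrib_left mult_ac)
qed

lemma otimes_linear:
  "otimes (a + b) x = otimes a x + otimes b x" "otimes a (x + y) = otimes a x + otimes a y"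
  "otimes (csc c a) x = otimes a (fscale c x)" "otimes 0 x = 0" "otimes a 0 = 0"
  "otimes a (x - y) = otimes a x - otimes a y" "otimes (a - b) x = otimes a x - otimes b x" "otimes (- a) x = - otimes a x"
  by (rule poly_mapping_eqI, simp add: lookup_otimes lookup_add lookup_minus fun_eq_iff algebra_simps)+

lemma otimes_sum_list_left: "otimes (\<Sum>i\<leftarrow>is. f i) x = (\<Sum>i\<leftarrow>is. otimes (f i) x)"
  by (induction "is") (simp_all only: list.map sum_list.Nil sum_list.Cons otimes_linear)

lemma otimes_sum_right: "otimes a (\<Sum>i\<in>A. f i) = (\<Sum>i\<in>A. otimes a (f i))"
  by (induction A rule: infinite_finite_induct)
    (simp_all only: sum.infinite sum.empty sum.insert not_False_eq_True otimes_linear)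

lemma single_otimes: "Poly_Mapping.single w (csc c a) = otimes a (fscale c (mon w))"
  by (rule poly_mapping_eqI) (simp add: lookup_otimes mon_def lookup_single when_def)

lemma coact_superset:
  assumes "finite S" "Poly_Mapping.keys x \<subseteq> S"
  shows "coact \<delta> x = (\<Sum>w\<in>S. \<Sum>(a, ms)\<leftarrow>coact_list \<delta> (letters w). otimes a (fscale (Poly_Mapping.lookup x w) (mon (Word ms))))"
proof -
  have "coact \<delta> x = (\<Sum>w\<in>Poly_Mapping.keys x. \<Sum>(a, ms)\<leftarrow>coact_list \<delta> (letters w). otimes a (fscale (Poly_Mapping.lookup x w) (mon (Word ms))))"
    unfolding coact_def single_otimes ..
  also have "\<dots> = (\<Sum>w\<in>S. \<Sum>(a, ms)\<leftarrow>coact_list \<delta> (letters w). otimes a (fscale (Poly_Mapping.lookup x w) (mon (Word ms))))"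
    using assms
    by (intro sum.mono_neutral_left) (auto simp: in_keys_iff case_prod_unfold otimes_linear(5) sum_list_0)
  finally show ?thesis .
qed

lemma coact_add: "coact \<delta> (x + y) = coact \<delta> x + coact \<delta> y"
proof -
  let ?S = "Poly_Mapping.keys x \<union> Poly_Mapping.keys y"
  have "coact \<delta> z = (\<Sum>w\<in>?S. \<Sum>(a, ms)\<leftarrow>coact_list \<delta> (letters w). otimes a (fscale (Poly_Mapping.lookup z w) (mon (Word ms))))"
    if "z \<in> {x, y, x + y}" for z
    using that keys_add[of x y] by (intro coact_superset) auto
  then show ?thesis
    by (simp add: lookup_add case_prod_unfold flin.scale_left_distrib otimes_linear(2) sum_list_addf sum.distrib)
qed

lemma coact_zero [simp]: "coact \<delta> 0 = 0" by (simp add: coact_def)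

lemma coact_sum: "coact \<delta> (\<Sum>i\<in>A. f i) = (\<Sum>i\<in>A. coact \<delta> (f i))"
  by (induction A rule: infinite_finite_induct) (simp_all add: coact_add)

lemma coact_mon: "coact \<delta> (fscale c (mon w)) = (\<Sum>(a, ms)\<leftarrow>coact_list \<delta> (letters w). otimes a (fscale c (mon (Word ms))))"
proof -
  have "coact \<delta> (fscale c (mon w)) = (\<Sum>v\<in>{w}. \<Sum>(a, ms)\<leftarrow>coact_list \<delta> (letters v). otimes a (fscale (Poly_Mapping.lookup (fscale c (mon w)) v) (mon (Word ms))))"
    by (rule coact_superset) (auto simp: in_keys_iff mon_def lookup_single when_def split: if_splits)
  then show ?thesis by (simp add: mon_def)
qed

lemma coact_list_2: "(\<Sum>(a, ms)\<leftarrow>coact_list \<delta> [m, n]. f a ms) = (\<Sum>(a, m')\<leftarrow>\<delta> m. \<Sum>(b, n')\<leftarrow>\<delta> n. f (a \<star> b) [m', n'])"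
  for f :: "fnl \<Rightarrow> 'm list \<Rightarrow> 'b::comm_monoid_add"
proof -
  have *: "(\<Sum>p\<leftarrow>concat (map h xs). g p) = (\<Sum>x\<leftarrow>xs. \<Sum>p\<leftarrow>h x. g p)" for h g and xs :: "(fnl \<times> 'm) list"
    by (induction xs) simp_all
  show ?thesis
    by (simp add: * case_prod_unfold comp_def)
qed

lemma cls_eq_group:
  assumes "\<And>x y. x \<in> Z \<Longrightarrow> y \<in> Z \<Longrightarrow> x + y \<in> Z" "\<And>x. x \<in> Z \<Longrightarrow> - x \<in> Z" "0 \<in> Z"
  shows "cls Z x = cls Z y \<longleftrightarrow> x - y \<in> Z"
proof
  assume "cls Z x = cls Z y"
  moreover have "x \<in> cls Z x" using assms by (simp add: cls_def)
  ultimately show "x - y \<in> Z" by (simp add: cls_def)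
next
  assume *: "x - y \<in> Z"
  have "z - x \<in> Z \<longleftrightarrow> z - y \<in> Z" for z
    using assms(1)[of "z - x" "x - y"] assms(1)[of "z - y" "- (x - y)"] assms(2)[OF *] * by auto
  then show "cls Z x = cls Z y" by (simp add: cls_def)
qed

lemma otimes_set_zero: "0 \<in> otimes_set N P"
  unfolding otimes_set_def by (intro CollectI exI[of _ "[]"]) simp

lemma otimes_set_add: "s \<in> otimes_set N P \<Longrightarrow> t \<in> otimes_set N P \<Longrightarrow> s + t \<in> otimes_set N P"
proof -
  assume "s \<in> otimes_set N P" "t \<in> otimes_set N P"
  then obtain ps qs where "s = (\<Sum>(a, x)\<leftarrow>ps. otimes a x)" "set ps \<subseteq> N \<times> P" "t = (\<Sum>(a, x)\<leftarrow>qs. otimes a x)" "set qs \<subseteq> N \<times> P"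
    by (auto simp: otimes_set_def)
  then show ?thesis unfolding otimes_set_def by (intro CollectI exI[of _ "ps @ qs"]) auto
qed

lemma otimes_set_base: "a \<in> N \<Longrightarrow> x \<in> P \<Longrightarrow> otimes a x \<in> otimes_set N P"
  unfolding otimes_set_def by (intro CollectI exI[of _ "[(a, x)]"]) auto

lemma otimes_set_sum: "(\<And>i. i \<in> A \<Longrightarrow> f i \<in> otimes_set N P) \<Longrightarrow> (\<Sum>i\<in>A. f i) \<in> otimes_set N P"
  by (induction A rule: infinite_finite_induct) (auto intro: otimes_set_zero otimes_set_add)

lemma otimes_set_sum_list: "(\<And>i. i \<in> set is \<Longrightarrow> f i \<in> otimes_set N P) \<Longrightarrow> (\<Sum>i\<leftarrow>is. f i) \<in> otimes_set N P"
  by (induction "is") (auto intro: otimes_set_zero otimes_set_add)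

lemma otimes_set_neg:
  assumes "\<And>x. x \<in> P \<Longrightarrow> - x \<in> P" "s \<in> otimes_set N P" shows "- s \<in> otimes_set N P"
proof -
  obtain ps where ps: "s = (\<Sum>(a, x)\<leftarrow>ps. otimes a x)" "set ps \<subseteq> N \<times> P" using assms by (auto simp: otimes_set_def)
  have neg: "- otimes a x = otimes a (- x)" for a x using otimes_linear(6)[of a 0 x] by (simp add: otimes_linear(5))
  have "- s = (\<Sum>p\<leftarrow>ps. otimes (fst p) (- snd p))"
    unfolding ps(1) case_prod_unfold uminus_sum_list_map comp_def neg ..
  also have "\<dots> \<in> otimes_set N P" using ps(2) assms(1) by (intro otimes_set_sum_list otimes_set_base) auto
  finally show ?thesis .
qed

section \<open>The quadratic relations\<close>

lemma UNIV_root: "UNIV = {A1, A2, A12}"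
proof (rule UNIV_eq_I)
  show "\<gamma> \<in> {A1, A2, A12}" for \<gamma> by (cases \<gamma>) simp_all
qed

lemma sum_root: "(\<Sum>\<gamma>\<in>UNIV. f \<gamma>) = f A1 + f A2 + f A12" for f :: "root \<Rightarrow> 'a::comm_monoid_add"
  by (simp add: UNIV_root add.assoc)

type_synonym mtx = "rvec \<Rightarrow> rvec \<Rightarrow> complex"

definition proj :: "(node \<Rightarrow> int) \<Rightarrow> mtx \<Rightarrow> mtx"
  where "proj \<mu> m = (\<lambda>t s. if wt t + wt s = \<mu> then m t s else 0)"

definition fe :: "root \<Rightarrow> mtx" where "fe \<gamma> = (\<lambda>t s. of_bool (t = Fix \<gamma> \<and> s = Eix \<gamma>))"
definition ef :: "root \<Rightarrow> mtx" where "ef \<gamma> = (\<lambda>t s. of_bool (t = Eix \<gamma> \<and> s = Fix \<gamma>))"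

fun opp :: "rvec \<Rightarrow> rvec" where "opp (Eix \<gamma>) = Fix \<gamma>" | "opp (Fix \<gamma>) = Eix \<gamma>"

text \<open>Weights add to zero only for a root vector and its opposite, which leaves 6 of the 36
  matrix positions in weight zero.\<close>

lemma wt_sum_zero: "wt t + wt s = 0 \<longleftrightarrow> t = opp s"
proof -
  have "wt (opp s) = - wt s" by (rule ext, cases s) simp_all
  then have "wt t + wt s = 0 \<longleftrightarrow> wt t = wt (opp s)" by (metis eq_neg_iff_add_eq_0)
  then show ?thesis by (simp add: wt_inj)
qed

context quantum_parameter
begin

text \<open>The entry is \<langle>X_t X_s, y\<rangle>: the row index sees the first leg of the
  coproduct of y, the column index the second.\<close>

definition mat :: "fnl \<Rightarrow> mtx" where "mat y = (\<lambda>t s. (XX t \<triangleright> (XX s \<triangleright> y)) 0)"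

definition W :: "mtx set" where "W = mat ` cot_ideal q"

lemma cot_ideal_iff: "y \<in> cot_ideal q \<longleftrightarrow> y \<in> BB \<and> y 0 = 0 \<and> (\<forall>r. (XX r \<triangleright> y) 0 = 0)"
proof -
  have "(\<forall>X\<in>Tspace q. pair X y = 0) \<longleftrightarrow> (\<forall>r. pair (XX r) y = 0)"
  proof
    assume *: "\<forall>r. pair (XX r) y = 0"
    have "flin.span (range XX) \<subseteq> {X. pair X y = 0}"
      using * by (intro flin.span_minimal) (auto simp: flin.subspace_def pair_eq_lsum simp del: Xvec.simps)
    then show "\<forall>X\<in>Tspace q. pair X y = 0" by (auto simp: Tspace_def)
  qed (auto simp: Tspace_def intro: flin.span_base simp del: Xvec.simps)
  then show ?thesis by (simp add: cot_ideal_def OqF3_plus_def counit_def act_apply_0 del: Xvec.simps)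
qed

lemma B_zero: "0 \<in> BB" and B_add: "a \<in> BB \<Longrightarrow> b \<in> BB \<Longrightarrow> a + b \<in> BB" and B_csc: "a \<in> BB \<Longrightarrow> csc c a \<in> BB"
  and B_minus: "a \<in> BB \<Longrightarrow> b \<in> BB \<Longrightarrow> a - b \<in> BB" and B_unit: "unit \<in> BB"
  and B_conv: "a \<in> BB \<Longrightarrow> b \<in> BB \<Longrightarrow> a \<star> b \<in> BB"
  using subspace_Aw[of 0] homA_Aw[OF homA_unit] Aw_conv[of a 0 b 0]
  by (simp_all add: B_eq fn.subspace_0 fn.subspace_add fn.subspace_scale fn.subspace_diff)

lemma subspace_cot_ideal: "fn.subspace (cot_ideal q)"
  unfolding fn.subspace_def by (auto simp: cot_ideal_iff B_zero B_add B_csc simp del: Xvec.simps)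

lemma mat_linear: "mat (a + b) = mat a + mat b" "mat (csc c a) = (\<lambda>t s. c * mat a t s)" "mat 0 = 0"
  by (simp_all add: mat_def fun_eq_iff del: Xvec.simps)

lemma W_zero: "0 \<in> W"
  using imageI[OF fn.subspace_0[OF subspace_cot_ideal], of mat] by (simp only: W_def mat_linear)

lemma W_add: assumes "m \<in> W" "n \<in> W" shows "m + n \<in> W"
proof -
  obtain y z where "y \<in> cot_ideal q" "z \<in> cot_ideal q" "m = mat y" "n = mat z" using assms by (auto simp: W_def)
  then show ?thesis
    using imageI[OF fn.subspace_add[OF subspace_cot_ideal], of y z mat] by (simp only: W_def mat_linear)
qed

lemma W_scale: assumes "m \<in> W" shows "(\<lambda>t s. c * m t s) \<in> W"
proof -
  obtain y where "y \<in> cot_ideal q" "m = mat y" using assms by (auto simp: W_def)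
  then show ?thesis
    using imageI[OF fn.subspace_scale[OF subspace_cot_ideal], of y mat c] by (simp only: W_def mat_linear)
qed

lemma W_sum: "(\<And>i. i \<in> A \<Longrightarrow> f i \<in> W) \<Longrightarrow> (\<Sum>i\<in>A. f i) \<in> W"
proof (induction A rule: infinite_finite_induct)
  case (insert x F)
  then have "f x \<in> W" "sum f F \<in> W" by blast+
  then show ?case using insert.hyps by (simp only: sum.insert W_add not_False_eq_True)
next
  case (infinite A)
  then have "sum f A = 0" by (intro sum.infinite)
  then show ?case using W_zero by metis
qed (simp only: sum.empty W_zero)

lemma W_sum_list: "(\<And>i. i \<in> set is \<Longrightarrow> f i \<in> W) \<Longrightarrow> (\<Sum>i\<leftarrow>is. f i) \<in> W"
proof (induction "is")
  case (Cons a "is")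
  then have "f a \<in> W" "(\<Sum>i\<leftarrow>is. f i) \<in> W" by (meson list.set_intros)+
  then show ?case by (simp only: list.map sum_list.Cons W_add)
qed (simp only: list.map sum_list.Nil W_zero)

text \<open>Same comparison of left and right translation by K_i as for single root vectors, now for
  the product X_t X_s.\<close>

lemma mat_weight: assumes "homA \<mu> 0 y" "wt t + wt s \<noteq> \<mu>" shows "mat y t s = 0"
proof -
  from assms(2) obtain i where i: "(wt t + wt s) i \<noteq> \<mu> i" by (auto simp: fun_eq_iff)
  have y: "y \<in> D" "lt (K i) y = csc (qc powi \<mu> i) y" "rt (K i) y = y"
    using homA_Uq_dual[OF assms(1)] homA_weights[OF assms(1), of i] by simp_all
  have "(rt (K i) (XX t \<triangleright> (XX s \<triangleright> y))) 0 = (lt (K i) (XX t \<triangleright> (XX s \<triangleright> y))) 0"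
    by (simp add: rt_apply lt_apply)
  then have "qc powi wt t i * (qc powi wt s i * mat y t s) = qc powi \<mu> i * mat y t s"
    by (simp only: K_X[OF y(1)] K_X[OF act_Uq_dual[OF y(1)]] lt_act y csc_apply act_linear mat_def)
  then have "qc powi ((wt t + wt s) i) * mat y t s = qc powi \<mu> i * mat y t s"
    by (simp add: power_int_add)
  then show ?thesis using i by (simp add: q_powi_inj del: plus_fun_apply)
qed

text \<open>I is stable under taking components of a given left weight: each X_r and the counit see
  only one component of y, so every component meets the conditions for I separately, and the one of
  weight \<mu> produces the part of \<open>mat y\<close> of that weight.\<close>

lemma W_proj:
  assumes "y \<in> cot_ideal q"
  shows "\<exists>z\<in>cot_ideal q. (z = 0 \<or> homA \<mu> 0 z) \<and> mat z = proj \<mu> (mat y)"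
proof -
  have yB: "y \<in> BB" and y0: "y 0 = 0" and yX: "\<And>r. (XX r \<triangleright> y) 0 = 0"
    using assms by (auto simp: cot_ideal_iff simp del: Xvec.simps)
  obtain S f where S: "finite S" "\<forall>\<mu>\<in>S. homA \<mu> 0 (f \<mu>)" and y: "y = (\<Sum>\<mu>\<in>S. f \<mu>)"
    using Aw_decomp[of y 0] yB by (auto simp: B_eq)
  \<comment> \<open>For a weight that does not occur in y the component is 0, a case in which
    \<open>homA\<close> is not claimed.\<close>
  define z where "z = (if \<mu> \<in> S then f \<mu> else 0)"
  have single: "(\<Sum>\<nu>\<in>S. g \<nu>) = (if \<nu>0 \<in> S then g \<nu>0 else 0)" if "\<And>\<nu>. \<nu> \<in> S \<Longrightarrow> \<nu> \<noteq> \<nu>0 \<Longrightarrow> g \<nu> = 0" for g :: "(node \<Rightarrow> int) \<Rightarrow> complex" and \<nu>0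
  proof -
    have "(\<Sum>\<nu>\<in>S. g \<nu>) = (\<Sum>\<nu>\<in>S. if \<nu> = \<nu>0 then g \<nu> else 0)" using that by (intro sum.cong) auto
    then show ?thesis using S(1) by simp
  qed
  have fX: "(XX r \<triangleright> f \<nu>) 0 = 0" if "\<nu> \<in> S" for r \<nu>
  proof -
    have ne: "(XX r \<triangleright> f \<nu>') 0 = 0" if "\<nu>' \<in> S" "\<nu>' \<noteq> wt r" for \<nu>'
      using pair_X_weight[of \<nu>' "f \<nu>'" r] S(2) that by (simp add: act_apply_0 del: Xvec.simps)
    have "0 = (\<Sum>\<nu>\<in>S. (XX r \<triangleright> f \<nu>) 0)" using yX[of r] unfolding y act_sum by simp
    also have "\<dots> = (if wt r \<in> S then (XX r \<triangleright> f (wt r)) 0 else 0)" using ne by (intro single)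
    finally show ?thesis using ne that by (cases "\<nu> = wt r") auto
  qed
  have f0: "f \<nu> 0 = 0" if "\<nu> \<in> S" for \<nu>
  proof -
    have ne: "f \<nu>' 0 = 0" if "\<nu>' \<in> S" "\<nu>' \<noteq> 0" for \<nu>' using homA_eps S(2) that by blast
    have "0 = (\<Sum>\<nu>\<in>S. f \<nu> 0)" using y0 y by simp
    also have "\<dots> = (if 0 \<in> S then f 0 0 else 0)" using ne by (intro single)
    finally show ?thesis using ne that by (cases "\<nu> = 0") auto
  qed
  have "z \<in> cot_ideal q"
    using S(2) fX f0 subspace_cot_ideal homA_Aw
    by (auto simp: z_def cot_ideal_iff B_eq B_zero[unfolded B_eq] simp del: Xvec.simps)
  moreover have "z = 0 \<or> homA \<mu> 0 z" using S(2) by (auto simp: z_def)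
  moreover have "mat z t s = proj \<mu> (mat y) t s" for t s
  proof -
    have "mat y t s = (\<Sum>\<nu>\<in>S. mat (f \<nu>) t s)" unfolding y mat_def act_sum by simp
    also have "\<dots> = (if wt t + wt s \<in> S then mat (f (wt t + wt s)) t s else 0)"
      using mat_weight S(2) by (intro single) metis
    finally show ?thesis
      using mat_weight[of \<mu> "f \<mu>" t s] S(2) by (auto simp: proj_def z_def mat_linear)
  qed
  ultimately show ?thesis by (intro bexI[of _ z]) (auto simp: fun_eq_iff)
qed

text \<open>For \<mu> \<noteq> 0 some i has q^(\<mu> i) \<noteq> 1. The weight-\<mu> part of the
  assumption is q^(\<mu> i) - 1 times that of m, so division puts every part of nonzero weight into
  W.\<close>

lemma W_weight_zero:
  assumes "\<And>i. (\<lambda>t s. (qc powi (wt t i + wt s i) - 1) * m t s) \<in> W"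
  shows "m - proj 0 m \<in> W"
proof -
  let ?M = "range (\<lambda>(t, s). wt t + wt s)"
  have fin: "finite ?M"
  proof -
    have "finite (UNIV :: (rvec \<times> rvec) set)" unfolding UNIV_Times_UNIV[symmetric] by (intro finite_cartesian_product) simp_all
    then show ?thesis by (rule finite_imageI)
  qed
  have "proj \<mu> m \<in> W" if "\<mu> \<in> ?M - {0}" for \<mu>
  proof -
    from that obtain i where i: "\<mu> i \<noteq> 0" by (auto simp: fun_eq_iff)
    obtain y where y: "y \<in> cot_ideal q" "mat y = (\<lambda>t s. (qc powi (wt t i + wt s i) - 1) * m t s)"
      using assms[of i] by (auto simp: W_def)
    then have "proj \<mu> (\<lambda>t s. (qc powi (wt t i + wt s i) - 1) * m t s) \<in> W"
      using W_proj[OF y(1), of \<mu>] by (auto simp: W_def intro: rev_image_eqI)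
    moreover have "proj \<mu> (\<lambda>t s. (qc powi (wt t i + wt s i) - 1) * m t s) = (\<lambda>t s. (qc powi \<mu> i - 1) * proj \<mu> m t s)"
      by (auto simp: proj_def fun_eq_iff)
    ultimately have "(\<lambda>t s. (qc powi \<mu> i - 1) * proj \<mu> m t s) \<in> W" by simp
    then have "(\<lambda>t s. 1 / (qc powi \<mu> i - 1) * ((qc powi \<mu> i - 1) * proj \<mu> m t s)) \<in> W" by (rule W_scale)
    moreover have "qc powi \<mu> i - 1 \<noteq> 0" using i q_powi_eq_1 by simp
    ultimately show ?thesis by simp
  qed
  then have "(\<Sum>\<mu>\<in>?M - {0}. proj \<mu> m) \<in> W" by (rule W_sum)
  moreover have "(\<Sum>\<mu>\<in>?M - {0}. proj \<mu> m) = m - proj 0 m"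
  proof (intro ext)
    fix t s
    have "(\<Sum>\<mu>\<in>?M - {0}. proj \<mu> m) t s = (\<Sum>\<mu>\<in>?M - {0}. if \<mu> = wt t + wt s then m t s else 0)"
    proof -
      have "proj \<mu> m t s = (if \<mu> = wt t + wt s then m t s else 0)" for \<mu> by (auto simp: proj_def)
      then show ?thesis by (simp only: sum_fun_apply)
    qed
    also have "\<dots> = (if wt t + wt s \<in> ?M - {0} then m t s else 0)" using fin by simp
    also have "\<dots> = (m - proj 0 m) t s" by (auto simp: proj_def)
    finally show "(\<Sum>\<mu>\<in>?M - {0}. proj \<mu> m) t s = (m - proj 0 m) t s" .
  qed
  ultimately show ?thesis by simp
qed

text \<open>The left weight is 0 and no root vector has weight 0, so all X_r vanish on the product;
  its counit vanishes because i and j differ.\<close>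

lemma u_antip_cot_ideal: assumes "i \<in> {1..3}" "j \<in> {1..3}" "i \<noteq> j"
  shows "u_coef q i j \<star> antip (u_coef q j i) \<in> cot_ideal q" "homA 0 0 (u_coef q i j \<star> antip (u_coef q j i))"
proof -
  show h: "homA 0 0 (u_coef q i j \<star> antip (u_coef q j i))"
    using homA_u_antip[OF assms(1,2,1)] by simp
  have "pair (XX r) (u_coef q i j \<star> antip (u_coef q j i)) = 0" for r
    using pair_X_weight[OF h, of r] wt_nz[of r] by metis
  then show "u_coef q i j \<star> antip (u_coef q j i) \<in> cot_ideal q"
    using homA_Aw[OF h] assms(3) by (simp add: cot_ideal_iff B_eq conv_0 u_coef_0 act_apply_0 del: Xvec.simps)
qed

lemma mat_eqI:
  assumes "\<And>t s. wt t + wt s \<noteq> 0 \<Longrightarrow> m t s = 0" "homA 0 0 z"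
    "\<And>\<gamma>. mat z (Eix \<gamma>) (Fix \<gamma>) = m (Eix \<gamma>) (Fix \<gamma>)" "\<And>\<gamma>. mat z (Fix \<gamma>) (Eix \<gamma>) = m (Fix \<gamma>) (Eix \<gamma>)"
  shows "mat z = m"
proof (intro ext)
  fix t s
  show "mat z t s = m t s"
  proof (cases "wt t + wt s = 0")
    case True
    then have "t = opp s" by (simp add: wt_sum_zero)
    then show ?thesis using assms(3,4) by (cases s) auto
  next
    case False
    then show ?thesis using assms(1) mat_weight[OF assms(2)] by metis
  qed
qed

lemma index_mem: "(1::nat) \<in> {1..3}" "2 \<in> {1..3::nat}" "3 \<in> {1..3::nat}" "Suc 0 \<in> {1..3}" "Suc (Suc 0) \<in> {1..3}" "Suc 2 \<in> {1..3}"
  by auto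

lemmas mat_u_simps = mat_def act_X rt_conv rt_u_coef rt_antip lt_u_coef index_mem conv_0 antip_0 u_coef_0 wtu_def
  power_int_minus

text \<open>Weight reduces the claim to six entries, computed by the translation rules. Only the
  highest root occurs here, while the two simple roots treated next also involve
  \<open>ef A12\<close>: the system is triangular.\<close>

lemma mat_u_antip_13: "mat (u_coef q 1 3 \<star> antip (u_coef q 3 1)) = (\<lambda>t s. - (1 / qc\<^sup>2) * ef A12 t s - fe A12 t s)"
proof (rule mat_eqI)
  show "homA 0 0 (u_coef q 1 3 \<star> antip (u_coef q 3 1))" by (rule u_antip_cot_ideal) auto
  show "- (1 / qc\<^sup>2) * ef A12 t s - fe A12 t s = 0" if "wt t + wt s \<noteq> 0" for t s
    using that by (auto simp: wt_sum_zero ef_def fe_def)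
  fix \<gamma>
  show "mat (u_coef q 1 3 \<star> antip (u_coef q 3 1)) (Eix \<gamma>) (Fix \<gamma>) = - (1 / qc\<^sup>2) * ef A12 (Eix \<gamma>) (Fix \<gamma>) - fe A12 (Eix \<gamma>) (Fix \<gamma>)"
    by (cases \<gamma>; simp add: mat_u_simps ef_def fe_def del: Xvec.simps; simp add: field_simps power2_eq_square power4_eq_xxxx)
  show "mat (u_coef q 1 3 \<star> antip (u_coef q 3 1)) (Fix \<gamma>) (Eix \<gamma>) = - (1 / qc\<^sup>2) * ef A12 (Fix \<gamma>) (Eix \<gamma>) - fe A12 (Fix \<gamma>) (Eix \<gamma>)"
    by (cases \<gamma>; simp add: mat_u_simps ef_def fe_def del: Xvec.simps; simp add: field_simps power2_eq_square power4_eq_xxxx)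
qed

lemma mat_u_antip_12: "mat (u_coef q 1 2 \<star> antip (u_coef q 2 1)) = (\<lambda>t s. (qc\<^sup>2 - 1) / qc ^ 4 * ef A12 t s - 1 / qc * ef A1 t s - qc * fe A1 t s)"
proof (rule mat_eqI)
  show "homA 0 0 (u_coef q 1 2 \<star> antip (u_coef q 2 1))" by (rule u_antip_cot_ideal) auto
  show "(qc\<^sup>2 - 1) / qc ^ 4 * ef A12 t s - 1 / qc * ef A1 t s - qc * fe A1 t s = 0" if "wt t + wt s \<noteq> 0" for t s
    using that by (auto simp: wt_sum_zero ef_def fe_def)
  fix \<gamma>
  show "mat (u_coef q 1 2 \<star> antip (u_coef q 2 1)) (Eix \<gamma>) (Fix \<gamma>) = (qc\<^sup>2 - 1) / qc ^ 4 * ef A12 (Eix \<gamma>) (Fix \<gamma>) - 1 / qc * ef A1 (Eix \<gamma>) (Fix \<gamma>) - qc * fe A1 (Eix \<gamma>) (Fix \<gamma>)"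
    by (cases \<gamma>; simp add: mat_u_simps ef_def fe_def del: Xvec.simps; simp add: field_simps power2_eq_square power4_eq_xxxx)
  show "mat (u_coef q 1 2 \<star> antip (u_coef q 2 1)) (Fix \<gamma>) (Eix \<gamma>) = (qc\<^sup>2 - 1) / qc ^ 4 * ef A12 (Fix \<gamma>) (Eix \<gamma>) - 1 / qc * ef A1 (Fix \<gamma>) (Eix \<gamma>) - qc * fe A1 (Fix \<gamma>) (Eix \<gamma>)"
    by (cases \<gamma>; simp add: mat_u_simps ef_def fe_def del: Xvec.simps; simp add: field_simps power2_eq_square power4_eq_xxxx)
qed

lemma mat_u_antip_23: "mat (u_coef q 2 3 \<star> antip (u_coef q 3 2)) = (\<lambda>t s. - (qc\<^sup>2 - 1) / qc ^ 4 * ef A12 t s - 1 / qc * ef A2 t s - qc * fe A2 t s)"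
proof (rule mat_eqI)
  show "homA 0 0 (u_coef q 2 3 \<star> antip (u_coef q 3 2))" by (rule u_antip_cot_ideal) auto
  show "- (qc\<^sup>2 - 1) / qc ^ 4 * ef A12 t s - 1 / qc * ef A2 t s - qc * fe A2 t s = 0" if "wt t + wt s \<noteq> 0" for t s
    using that by (auto simp: wt_sum_zero ef_def fe_def)
  fix \<gamma>
  show "mat (u_coef q 2 3 \<star> antip (u_coef q 3 2)) (Eix \<gamma>) (Fix \<gamma>) = - (qc\<^sup>2 - 1) / qc ^ 4 * ef A12 (Eix \<gamma>) (Fix \<gamma>) - 1 / qc * ef A2 (Eix \<gamma>) (Fix \<gamma>) - qc * fe A2 (Eix \<gamma>) (Fix \<gamma>)"
    by (cases \<gamma>; simp add: mat_u_simps ef_def fe_def del: Xvec.simps; simp add: field_simps power2_eq_square power4_eq_xxxx)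
  show "mat (u_coef q 2 3 \<star> antip (u_coef q 3 2)) (Fix \<gamma>) (Eix \<gamma>) = - (qc\<^sup>2 - 1) / qc ^ 4 * ef A12 (Fix \<gamma>) (Eix \<gamma>) - 1 / qc * ef A2 (Fix \<gamma>) (Eix \<gamma>) - qc * fe A2 (Fix \<gamma>) (Eix \<gamma>)"
    by (cases \<gamma>; simp add: mat_u_simps ef_def fe_def del: Xvec.simps; simp add: field_simps power2_eq_square power4_eq_xxxx)
qed

text \<open>The three relations are solved for e \<otimes> f in triangular order; the one for the
  highest root eliminates \<open>ef A12\<close> from the other two.\<close>

lemma ef_reduce: "\<exists>c. ef \<gamma> - (\<lambda>t s. \<Sum>\<delta>\<in>UNIV. c \<delta> * fe \<delta> t s) \<in> W"
proof -
  have z: "mat (u_coef q 1 3 \<star> antip (u_coef q 3 1)) \<in> W" "mat (u_coef q 1 2 \<star> antip (u_coef q 2 1)) \<in> W"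
    "mat (u_coef q 2 3 \<star> antip (u_coef q 3 2)) \<in> W"
    unfolding W_def by (intro imageI u_antip_cot_ideal; simp)+
  have z12: "ef A12 - (\<lambda>t s. \<Sum>\<delta>\<in>UNIV. (if \<delta> = A12 then - qc\<^sup>2 else 0) * fe \<delta> t s) \<in> W"
  proof -
    have "(\<lambda>t s. - qc\<^sup>2 * mat (u_coef q 1 3 \<star> antip (u_coef q 3 1)) t s) \<in> W" by (rule W_scale[OF z(1)])
    moreover have "(\<lambda>t s. - qc\<^sup>2 * mat (u_coef q 1 3 \<star> antip (u_coef q 3 1)) t s) = ef A12 - (\<lambda>t s. \<Sum>\<delta>\<in>UNIV. (if \<delta> = A12 then - qc\<^sup>2 else 0) * fe \<delta> t s)"
      unfolding mat_u_antip_13 by (simp add: fun_eq_iff sum_root field_simps)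
    ultimately show ?thesis by simp
  qed
  show ?thesis
  proof (cases \<gamma>)
    case A1
    \<comment> \<open>The coefficient of \<open>ef A12\<close> in the relation for this root.
      Scaling that relation by -q turns it into -qk, which is cancelled by adding qk times
      \<open>z12\<close>.\<close>
    define k where "k = (qc\<^sup>2 - 1) / qc ^ 4"
    have "(\<lambda>t s. - qc * mat (u_coef q 1 2 \<star> antip (u_coef q 2 1)) t s)
        + (\<lambda>t s. (qc * k) * (ef A12 - (\<lambda>t s. \<Sum>\<delta>\<in>UNIV. (if \<delta> = A12 then - qc\<^sup>2 else 0) * fe \<delta> t s)) t s) \<in> W"
      by (intro W_add W_scale z z12)
    moreover have "(\<lambda>t s. - qc * mat (u_coef q 1 2 \<star> antip (u_coef q 2 1)) t s)
        + (\<lambda>t s. (qc * k) * (ef A12 - (\<lambda>t s. \<Sum>\<delta>\<in>UNIV. (if \<delta> = A12 then - qc\<^sup>2 else 0) * fe \<delta> t s)) t s)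
      = ef A1 - (\<lambda>t s. \<Sum>\<delta>\<in>UNIV. (case \<delta> of A1 \<Rightarrow> - qc\<^sup>2 | A2 \<Rightarrow> 0 | A12 \<Rightarrow> - (qc * k * qc\<^sup>2)) * fe \<delta> t s)"
      unfolding mat_u_antip_12 k_def[symmetric] by (simp add: fun_eq_iff sum_root algebra_simps power2_eq_square)
    ultimately show ?thesis unfolding A1
      by (intro exI[of _ "\<lambda>\<delta>. case \<delta> of A1 \<Rightarrow> - qc\<^sup>2 | A2 \<Rightarrow> 0 | A12 \<Rightarrow> - (qc * k * qc\<^sup>2)"]) (simp only:)
  next
    case A2
    define k where "k = - (qc\<^sup>2 - 1) / qc ^ 4"
    have "(\<lambda>t s. - qc * mat (u_coef q 2 3 \<star> antip (u_coef q 3 2)) t s)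
        + (\<lambda>t s. (qc * k) * (ef A12 - (\<lambda>t s. \<Sum>\<delta>\<in>UNIV. (if \<delta> = A12 then - qc\<^sup>2 else 0) * fe \<delta> t s)) t s) \<in> W"
      by (intro W_add W_scale z z12)
    moreover have "(\<lambda>t s. - qc * mat (u_coef q 2 3 \<star> antip (u_coef q 3 2)) t s)
        + (\<lambda>t s. (qc * k) * (ef A12 - (\<lambda>t s. \<Sum>\<delta>\<in>UNIV. (if \<delta> = A12 then - qc\<^sup>2 else 0) * fe \<delta> t s)) t s)
      = ef A2 - (\<lambda>t s. \<Sum>\<delta>\<in>UNIV. (case \<delta> of A1 \<Rightarrow> 0 | A2 \<Rightarrow> - qc\<^sup>2 | A12 \<Rightarrow> - (qc * k * qc\<^sup>2)) * fe \<delta> t s)"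
      unfolding mat_u_antip_23 k_def[symmetric] by (simp add: fun_eq_iff sum_root algebra_simps power2_eq_square)
    ultimately show ?thesis unfolding A2
      by (intro exI[of _ "\<lambda>\<delta>. case \<delta> of A1 \<Rightarrow> 0 | A2 \<Rightarrow> - qc\<^sup>2 | A12 \<Rightarrow> - (qc * k * qc\<^sup>2)"]) (simp only:)
  next
    case A12
    then show ?thesis using z12 by (intro exI[of _ "\<lambda>\<delta>. if \<delta> = A12 then - qc\<^sup>2 else 0"]) simp
  qed
qed

lemma W_normal_form:
  assumes "\<And>i. (\<lambda>t s. (qc powi (wt t i + wt s i) - 1) * m t s) \<in> W"
  shows "\<exists>c. m - (\<lambda>t s. \<Sum>\<delta>\<in>UNIV. c \<delta> * fe \<delta> t s) \<in> W"
proof -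
  define c where "c \<gamma> = (SOME c. ef \<gamma> - (\<lambda>t s. \<Sum>\<delta>\<in>UNIV. c \<delta> * fe \<delta> t s) \<in> W)" for \<gamma>
  have c: "ef \<gamma> - (\<lambda>t s. \<Sum>\<delta>\<in>UNIV. c \<gamma> \<delta> * fe \<delta> t s) \<in> W" for \<gamma>
    unfolding c_def by (rule someI_ex[OF ef_reduce])
  \<comment> \<open>The entry of m at f \<otimes> e, plus the contributions from rewriting the
    entries at e \<otimes> f.\<close>
  define d where "d \<delta> = m (Fix \<delta>) (Eix \<delta>) + (\<Sum>\<gamma>\<in>UNIV. m (Eix \<gamma>) (Fix \<gamma>) * c \<gamma> \<delta>)" for \<delta>
  let ?r = "\<lambda>\<gamma>. (\<lambda>t s. m (Eix \<gamma>) (Fix \<gamma>) * (ef \<gamma> - (\<lambda>t s. \<Sum>\<delta>\<in>UNIV. c \<gamma> \<delta> * fe \<delta> t s)) t s)"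
  have "m - proj 0 m + (\<Sum>\<gamma>\<in>UNIV. ?r \<gamma>) \<in> W"
    by (intro W_add W_sum W_scale c W_weight_zero assms)
  moreover have "m - proj 0 m + (\<Sum>\<gamma>\<in>UNIV. ?r \<gamma>) = m - (\<lambda>t s. \<Sum>\<delta>\<in>UNIV. d \<delta> * fe \<delta> t s)"
  proof (intro ext)
    fix t s
    have "proj 0 m t s = (\<Sum>\<gamma>\<in>UNIV. m (Eix \<gamma>) (Fix \<gamma>) * ef \<gamma> t s + m (Fix \<gamma>) (Eix \<gamma>) * fe \<gamma> t s)"
      by (cases t; cases s; rename_tac \<gamma> \<delta>; case_tac \<gamma>; case_tac \<delta>; simp add: proj_def wt_sum_zero sum_root ef_def fe_def)
    then show "(m - proj 0 m + (\<Sum>\<gamma>\<in>UNIV. ?r \<gamma>)) t s = (m - (\<lambda>t s. \<Sum>\<delta>\<in>UNIV. d \<delta> * fe \<delta> t s)) t s"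
      by (simp add: d_def sum_root algebra_simps)
  qed
  ultimately show ?thesis by (intro exI[of _ d]) (simp only:)
qed

text \<open>E_i and F_i commute up to a multiple of K_i - K_i^{-1}, which acts as 0 on y because y
  is invariant under right translation by K_i. Hence K_i F_i E_i and q^2 E_i K_i F_i agree on y. For
  the highest root the commutators leave products of simple root vectors, whence the extra
  term.\<close>

lemma mat_relations:
  assumes "y \<in> cot_ideal q"
  shows "mat y (Fix A1) (Eix A1) = qc\<^sup>2 * mat y (Eix A1) (Fix A1)"
    "mat y (Fix A2) (Eix A2) = qc\<^sup>2 * mat y (Eix A2) (Fix A2)"
    "mat y (Fix A12) (Eix A12) = (qc - 1 / qc) * (mat y (Eix A1) (Fix A1) - mat y (Eix A2) (Fix A2))
       + qc\<^sup>2 * mat y (Eix A12) (Fix A12)"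
proof -
  have y: "y \<in> D" "\<And>i. rt (K i) y = y" "\<And>i. rt (Kinv i) y = y"
  proof -
    show D: "y \<in> D" using assms B_A by (simp add: cot_ideal_iff)
    show K: "rt (K i) y = y" for i using assms by (simp add: cot_ideal_iff B_eq Aw_def)
    show "rt (Kinv i) y = y" for i using rt_Kinv_eq[OF D, of i 0] K by simp
  qed
  have nz: "qc * qc - 1 \<noteq> 0" by simp
  have h: "1 / (qc - 1 / qc) = qc / (qc * qc - 1)" using nz by (simp add: field_simps)
  note S = mat_def act_X rt_K_rules rt_E_F[unfolded h] cartan_def y csc_add csc_minus
  show "mat y (Fix A1) (Eix A1) = qc\<^sup>2 * mat y (Eix A1) (Fix A1)"
    by (simp add: S del: Xvec.simps; simp add: field_simps power_int_minus power2_eq_square)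
  show "mat y (Fix A2) (Eix A2) = qc\<^sup>2 * mat y (Eix A2) (Fix A2)"
    by (simp add: S del: Xvec.simps; simp add: field_simps power_int_minus power2_eq_square)
  show "mat y (Fix A12) (Eix A12) = (qc - 1 / qc) * (mat y (Eix A1) (Fix A1) - mat y (Eix A2) (Fix A2))
       + qc\<^sup>2 * mat y (Eix A12) (Fix A12)"
  proof -
    \<comment> \<open>With names for the two inverses the claim becomes a polynomial identity modulo
      their defining equations.\<close>
    define H where "H = inverse (qc * qc - 1)"
    define p where "p = inverse qc"
    have Hq: "H * (qc * qc - 1) = 1" using nz by (simp add: H_def)
    have pq: "p * qc = 1" by (simp add: p_def)
    have inv: "inverse qc = p" "x / qc = x * p" "x / (qc * qc - 1) = x * H" for x by (simp_all add: p_def H_def divide_inverse)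
    show ?thesis
      by (simp add: S del: Xvec.simps,
          simp only: power_int_minus power2_eq_square power_int_1_right power_int_numeral inverse_mult_distrib inv,
          use Hq pq in algebra)
  qed
qed

text \<open>On W the f \<otimes> e entries are determined by the e \<otimes> f entries, and the
  latter all vanish for a combination of the \<open>fe\<close>.\<close>

lemma fe_independent:
  assumes "(\<lambda>t s. \<Sum>\<delta>\<in>UNIV. c \<delta> * fe \<delta> t s) \<in> W"
  shows "c \<delta> = 0"
proof -
  obtain y where y: "y \<in> cot_ideal q" "mat y = (\<lambda>t s. \<Sum>\<delta>\<in>UNIV. c \<delta> * fe \<delta> t s)"
    using assms by (auto simp: W_def)
  show ?thesis
    using mat_relations[OF y(1)] unfolding y(2) by (cases \<delta>) (simp_all add: sum_root fe_def)
qed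

end

section \<open>The quantum exterior algebra\<close>

text \<open>The subspace Z is an additive group, so equality of cosets is membership of the
  difference. The resulting witnesses s and t are what test functionals are applied to.\<close>

lemma coinvariants_iff:
  assumes "\<And>x. x \<in> J \<Longrightarrow> - x \<in> J"
  shows "C \<in> coinvariants H N \<delta> M J k \<longleftrightarrow> (\<exists>x. C = cls J x \<and> x \<in> words_deg M k \<and>
    (\<exists>s\<in>otimes_set N (words_on M). \<exists>t\<in>otimes_set H J. coact \<delta> x - otimes unit x = s + t))"
proof -
  define Z where "Z = {s + t | s t. s \<in> otimes_set N (words_on M) \<and> t \<in> otimes_set H J}"
  have neg: "- x \<in> words_on M" if "x \<in> words_on M" for x :: "'a free_alg"
    using that by (simp add: words_on_def)
  have "cls Z x = cls Z y \<longleftrightarrow> x - y \<in> Z" for x y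
  proof (rule cls_eq_group)
    show "0 \<in> Z" unfolding Z_def using otimes_set_zero by (metis (mono_tags, lifting) add_0_left mem_Collect_eq)
    show "- z \<in> Z" if z: "z \<in> Z" for z
    proof -
      obtain s t where st: "z = s + t" "s \<in> otimes_set N (words_on M)" "t \<in> otimes_set H J" using z by (auto simp: Z_def)
      have "- z = - s + - t" by (simp add: st)
      then show ?thesis using otimes_set_neg[OF neg st(2)] otimes_set_neg[OF assms st(3)] unfolding Z_def by blast
    qed
    show "z + z' \<in> Z" if zz: "z \<in> Z" "z' \<in> Z" for z z'
    proof -
      obtain s t s' t' where st: "z = s + t" "s \<in> otimes_set N (words_on M)" "t \<in> otimes_set H J"
        "z' = s' + t'" "s' \<in> otimes_set N (words_on M)" "t' \<in> otimes_set H J" using zz by (auto simp: Z_def)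
      have "z + z' = (s + s') + (t + t')" by (simp add: st algebra_simps)
      then show ?thesis using otimes_set_add[OF st(2,5)] otimes_set_add[OF st(3,6)] unfolding Z_def by blast
    qed
  qed
  then show ?thesis
    unfolding coinvariants_def Let_def Z_def[symmetric] by (auto simp: Z_def)
qed

lemma words_deg_2_induct:
  assumes "x \<in> words_deg M 2"
  shows "x = (\<Sum>w\<in>Poly_Mapping.keys x. fscale (Poly_Mapping.lookup x w) (mon w))"
    and "w \<in> Poly_Mapping.keys x \<Longrightarrow> \<exists>a b. w = Word [a, b] \<and> a \<in> M \<and> b \<in> M"
proof -
  have "fscale c (mon w) = Poly_Mapping.single w c" for c and w :: "'a word"
    by (rule poly_mapping_eqI) (simp add: mon_def lookup_single when_def)
  then show "x = (\<Sum>w\<in>Poly_Mapping.keys x. fscale (Poly_Mapping.lookup x w) (mon w))"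
    using poly_mapping_decomp[of x] by simp
  assume "w \<in> Poly_Mapping.keys x"
  then have "length (letters w) = 2" "set (letters w) \<subseteq> M" using assms by (auto simp: words_deg_def words_on_def)
  then show "\<exists>a b. w = Word [a, b] \<and> a \<in> M \<and> b \<in> M"
    by (cases w) (auto simp: numeral_2_eq_2 length_Suc_conv)
qed

lemma words_deg_add: "x \<in> words_deg M k \<Longrightarrow> y \<in> words_deg M k \<Longrightarrow> x + y \<in> words_deg M k"
  using keys_add[of x y] unfolding words_deg_def words_on_def by simp blast

lemma words_deg_zero: "0 \<in> words_deg M k" by (simp add: words_deg_def words_on_def)

lemma words_deg_scale: "x \<in> words_deg M k \<Longrightarrow> fscale c x \<in> words_deg M k"
  by (auto simp: words_deg_def words_on_def in_keys_iff)

lemma words_deg_sum: "(\<And>i. i \<in> A \<Longrightarrow> f i \<in> words_deg M k) \<Longrightarrow> (\<Sum>i\<in>A. f i) \<in> words_deg M k"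
  by (induction A rule: infinite_finite_induct) (auto intro: words_deg_add words_deg_zero)

lemma words_deg_sum_list: "(\<And>i. i \<in> set is \<Longrightarrow> f i \<in> words_deg M k) \<Longrightarrow> (\<Sum>i\<leftarrow>is. f i) \<in> words_deg M k"
  by (induction "is") (auto intro: words_deg_add words_deg_zero)

lemma words_deg_lett2: "a \<in> M \<Longrightarrow> b \<in> M \<Longrightarrow> lett a * lett b \<in> words_deg M 2"
  by (simp add: lett_mult mon_def words_deg_def words_on_def)

text \<open>Words of length other than 2 are sent to 0. The ideal has elements of every degree, and
  this default makes its image depend on its degree-2 part only.\<close>

definition word_matrix :: "coords list \<Rightarrow> mtx"
  where "word_matrix ws = (\<lambda>t s. case ws of [a, b] \<Rightarrow> a t * b s | _ \<Rightarrow> 0)"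

definition tensor_matrix :: "coords free_alg \<Rightarrow> mtx"
  where "tensor_matrix x = (\<lambda>t s. lsum (\<lambda>w. word_matrix (letters w) t s) x)"

lemma tensor_matrix_linear: "tensor_matrix (x + y) = tensor_matrix x + tensor_matrix y" "tensor_matrix (fscale c x) = (\<lambda>t s. c * tensor_matrix x t s)" "tensor_matrix 0 = 0"
  by (simp_all add: tensor_matrix_def fun_eq_iff)

lemma word_matrix_Pair [simp]: "word_matrix [a, b] = (\<lambda>t s. a t * b s)"
  by (simp add: word_matrix_def)

lemma word_matrix_length: "length ws \<noteq> 2 \<Longrightarrow> word_matrix ws t s = 0"
  by (auto simp: word_matrix_def split: list.splits)

text \<open>A letter contributes only when exactly one other letter is present, which reduces
  multilinearity to two positions.\<close>

lemma word_matrix_cases: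
  assumes "\<And>b. us = [] \<Longrightarrow> vs = [b] \<Longrightarrow> P" "\<And>a. us = [a] \<Longrightarrow> vs = [] \<Longrightarrow> P"
    "(\<And>x t s. word_matrix (us @ x # vs) t s = 0) \<Longrightarrow> P"
  shows P
proof (cases "length us + length vs = 1")
  case True
  then show ?thesis using assms(1,2) by (cases us; cases vs) auto
next
  case False
  then show ?thesis using assms(3) word_matrix_length by simp
qed

lemma word_matrix_add: "word_matrix (us @ (x + y) # vs) t s = word_matrix (us @ x # vs) t s + word_matrix (us @ y # vs) t s"
  by (rule word_matrix_cases[of us vs]) (simp_all add: algebra_simps)

lemma word_matrix_scale: "word_matrix (us @ (\<lambda>r. c * x r) # vs) t s = c * word_matrix (us @ x # vs) t s"
  by (rule word_matrix_cases[of us vs]) (simp_all add: algebra_simps)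

text \<open>A section of \<open>tensor_matrix\<close>. With \<open>V_reduce\<close> and the two
  passages between the ideal and W it identifies V^2 with matrices modulo W.\<close>

definition matrix_element :: "mtx \<Rightarrow> coords free_alg"
  where "matrix_element m = (\<Sum>t\<in>UNIV. \<Sum>s\<in>UNIV. fscale (m t s) (lett (unitvec t) * lett (unitvec s)))"

lemma matrix_element_linear: "matrix_element (m + n) = matrix_element m + matrix_element n" "matrix_element (\<lambda>t s. c * m t s) = fscale c (matrix_element m)" "matrix_element 0 = 0"
  by (simp_all add: matrix_element_def flin.scale_left_distrib sum.distrib flin.scale_sum_right)

lemma matrix_element_sum: "matrix_element (\<Sum>i\<in>A. f i) = (\<Sum>i\<in>A. matrix_element (f i))"
  by (induction A rule: infinite_finite_induct)
    (simp_all only: sum.infinite sum.empty sum.insert not_False_eq_True matrix_element_linear)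

lemma matrix_element_sum_list: "matrix_element (\<Sum>i\<leftarrow>is. f i) = (\<Sum>i\<leftarrow>is. matrix_element (f i))"
  by (induction "is") (simp_all only: list.map sum_list.Nil sum_list.Cons matrix_element_linear)

context quantum_parameter
begin

lemma V1_eq: "V1 q = UNIV"
proof -
  have "v \<in> V1 q" for v
  proof -
    define y where "y = (\<Sum>r\<in>UNIV. csc (v r) (dual_element r))"
    have "y \<in> OqF3_plus q"
      unfolding y_def sum_rvec using dual_element_B by (simp add: OqF3_plus_def counit_def B_add B_csc)
    moreover have "cot q y = v"
    proof
      fix s
      have "cot q y s = (\<Sum>r\<in>UNIV. v r * cot q (dual_element r) s)"
        unfolding y_def cot_act act_sum by (simp del: Xvec.simps)
      then show "cot q y s = v s" unfolding cot_dual_element unitvec_def by (cases s; rename_tac \<gamma>; case_tac \<gamma>; simp add: sum_rvec)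
    qed
    ultimately show ?thesis by (auto simp: V1_def)
  qed
  then show ?thesis by auto
qed

abbreviation V_rels :: "coords free_alg set" where "V_rels \<equiv> lin_rels (\<lambda>c v r. c * v r) UNIV \<union> I2 q"

lemma V_ideal_eq: "V_ideal q = ideal_gen UNIV V_rels"
  by (simp only: V_ideal_def V1_eq)

sublocale V: word_ideal UNIV V_rels .

lemma cot_plus_part [simp]: "cot q (plus_part y) = cot q y"
  by (simp add: fun_eq_iff cot_act plus_part_def X_unit del: Xvec.simps)

text \<open>X_t X_s pairs with y through the coproduct of y, so a generator of I^(2) has matrix
  \<open>mat y\<close>. This ties the quadratic relations to W.\<close>

lemma mat_sw: assumes "coproduct_rep y ps" shows "mat y = (\<Sum>(x, z)\<leftarrow>ps. (\<lambda>t s. cot q x t * cot q z s))"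
proof (intro ext)
  fix t s
  have "mat y t s = (\<Sum>p\<leftarrow>ps. pair (XX s) (snd p) * (XX t \<triangleright> fst p) 0)"
    unfolding mat_def coproduct_rep_act[OF assms] act_sum_list by (simp add: sum_list_fun_apply case_prod_unfold del: Xvec.simps)
  then show "mat y t s = (\<Sum>(x, z)\<leftarrow>ps. (\<lambda>t s. cot q x t * cot q z s)) t s"
    by (simp add: sum_list_fun_apply case_prod_unfold cot_def act_apply_0 mult.commute del: Xvec.simps)
qed

lemma tensor_matrix_V_ideal: assumes "x \<in> V_ideal q" shows "tensor_matrix x \<in> W"
proof -
  have "flin.span {mon u * s * mon v |u s v. set (letters u) \<subseteq> UNIV \<and> s \<in> V_rels \<and> set (letters v) \<subseteq> UNIV} \<subseteq> {x. tensor_matrix x \<in> W}"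
  proof (rule flin.span_minimal)
    show "flin.subspace {x. tensor_matrix x \<in> W}"
      by (simp add: flin.subspace_def tensor_matrix_linear W_zero W_add W_scale)
    show "{mon u * s * mon v |u s v. set (letters u) \<subseteq> UNIV \<and> s \<in> V_rels \<and> set (letters v) \<subseteq> UNIV} \<subseteq> {x. tensor_matrix x \<in> W}"
    proof clarify
      fix u s v assume s: "s \<in> V_rels"
      have Th: "tensor_matrix (mon u * s * mon v) = (\<lambda>t s'. lsum (\<lambda>k. word_matrix (letters u @ letters k @ letters v) t s') s)"
        by (simp add: tensor_matrix_def lsum_mult)
      from s consider (add) x y where "s = lett (x + y) - lett x - lett y" | (scale) c x where "s = lett (\<lambda>r. c * x r) - fscale c (lett x)"
        | (I2) "s \<in> I2 q" unfolding lin_rels_def by blast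
      then show "tensor_matrix (mon u * s * mon v) \<in> W"
      proof cases
        case add
        have "tensor_matrix (mon u * s * mon v) = 0" unfolding Th unfolding add by (intro ext) (simp add: word_matrix_add)
        then show ?thesis using W_zero by simp
      next
        case scale
        have "tensor_matrix (mon u * s * mon v) = 0" unfolding Th unfolding scale by (intro ext) (simp add: word_matrix_scale)
        then show ?thesis using W_zero by simp
      next
        case I2
        then obtain y ps where y: "y \<in> cot_ideal q" "coproduct_rep y ps" and s: "s = (\<Sum>(y1, y2)\<leftarrow>ps. lett (cot q y1) * lett (cot q y2))"
          by (auto simp: I2_def sweedler_iff)
        have eq: "tensor_matrix (mon u * s * mon v) = (\<lambda>t s'. \<Sum>p\<leftarrow>ps. word_matrix (letters u @ [cot q (fst p), cot q (snd p)] @ letters v) t s')"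
          unfolding Th unfolding s lsum_sum_list by (simp add: case_prod_unfold lett_mult)
        show ?thesis
        proof (cases "letters u = [] \<and> letters v = []")
          case True
          then have "tensor_matrix (mon u * s * mon v) = mat y"
            unfolding eq mat_sw[OF y(2)] by (simp add: fun_eq_iff sum_list_fun_apply case_prod_unfold)
          then show ?thesis using y(1) by (simp add: W_def)
        next
          \<comment> \<open>A multiple of a quadratic relation by further letters has degree above 2
            and is sent to 0.\<close>
          case False
          then have "length (letters u @ [cot q (fst p), cot q (snd p)] @ letters v) \<noteq> 2" for p by auto
          then have "tensor_matrix (mon u * s * mon v) = 0" unfolding eq using word_matrix_length by (simp add: fun_eq_iff)
          then show ?thesis using W_zero by simp
        qed
      qed
    qed
  qed
  then show ?thesis using assms unfolding V_ideal_eq ideal_gen_def by blast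
qed

lemma lett_basis: "V.cong (lett a) (\<Sum>t\<leftarrow>all_rvecs. fscale (a t) (lett (unitvec t)))"
proof -
  have a: "a = (\<Sum>t\<leftarrow>all_rvecs. (\<lambda>r. a t * unitvec t r))"
  proof
    fix s show "a s = (\<Sum>t\<leftarrow>all_rvecs. (\<lambda>r. a t * unitvec t r)) s"
      unfolding sum_all_rvecs sum_fun_apply unitvec_def by (cases s; rename_tac \<gamma>; case_tac \<gamma>; simp add: sum_rvec)
  qed
  have lin: "lin_rels (\<lambda>c v r. c * v r) UNIV \<subseteq> V_rels" by blast
  have "V.cong (lett (\<Sum>t\<leftarrow>all_rvecs. (\<lambda>r. a t * unitvec t r))) (\<Sum>t\<leftarrow>all_rvecs. lett (\<lambda>r. a t * unitvec t r))"
    by (rule cong_lett_sum_list[OF lin, THEN conjunct1]) simp_all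
  then have "V.cong (lett a) (\<Sum>t\<leftarrow>all_rvecs. lett (\<lambda>r. a t * unitvec t r))" by (simp only: a[symmetric])
  also have "V.cong \<dots> (\<Sum>t\<leftarrow>all_rvecs. fscale (a t) (lett (unitvec t)))"
    by (intro V.cong_sum_list cong_lett_scale[OF lin]) simp
  finally show ?thesis .
qed

lemma lett_lett_basis: "V.cong (lett a * lett b) (matrix_element (\<lambda>t s. a t * b s))"
proof -
  have "V.cong (lett a * lett b) ((\<Sum>t\<leftarrow>all_rvecs. fscale (a t) (lett (unitvec t))) * lett b)"
    by (intro V.cong_lett_right lett_basis) simp
  also have "\<dots> = (\<Sum>t\<leftarrow>all_rvecs. fscale (a t) (lett (unitvec t) * lett b))"
    by (simp add: sum_list_mult_const[symmetric] V.fscale_mult_left)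
  also have "V.cong \<dots> (\<Sum>t\<leftarrow>all_rvecs. fscale (a t) (lett (unitvec t) * (\<Sum>s\<leftarrow>all_rvecs. fscale (b s) (lett (unitvec s)))))"
    by (intro V.cong_sum_list V.cong_scale V.cong_lett_left lett_basis) simp
  also have "\<dots> = matrix_element (\<lambda>t s. a t * b s)"
    by (simp add: matrix_element_def sum_all_rvecs sum_distrib_left V.fscale_mult_right flin.scale_sum_right)
  finally show ?thesis .
qed

lemma V_reduce: assumes "x \<in> words_deg UNIV 2" shows "V.cong x (matrix_element (tensor_matrix x))"
proof -
  let ?c = "Poly_Mapping.lookup x"
  have "V.cong (\<Sum>w\<in>Poly_Mapping.keys x. fscale (?c w) (mon w)) (\<Sum>w\<in>Poly_Mapping.keys x. fscale (?c w) (matrix_element (word_matrix (letters w))))"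
  proof (intro V.cong_sum V.cong_scale)
    fix w assume "w \<in> Poly_Mapping.keys x"
    then obtain a b where "w = Word [a, b]" using words_deg_2_induct(2)[OF assms] by blast
    then show "V.cong (mon w) (matrix_element (word_matrix (letters w)))" using lett_lett_basis[of a b] by (simp add: lett_mult)
  qed
  also have "(\<Sum>w\<in>Poly_Mapping.keys x. fscale (?c w) (matrix_element (word_matrix (letters w)))) = matrix_element (tensor_matrix x)"
  proof -
    have "tensor_matrix x = (\<Sum>w\<in>Poly_Mapping.keys x. (\<lambda>t s. ?c w * word_matrix (letters w) t s))"
      by (simp add: fun_eq_iff tensor_matrix_def lsum_def)
    then show ?thesis by (simp only: matrix_element_sum matrix_element_linear)
  qed
  finally show ?thesis using words_deg_2_induct(1)[OF assms] by metis
qed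

lemma matrix_element_W: assumes "m \<in> W" shows "matrix_element m \<in> V_ideal q"
proof -
  obtain y where y: "y \<in> cot_ideal q" "m = mat y" using assms by (auto simp: W_def)
  have "y \<in> AA" using y B_A by (simp add: cot_ideal_iff)
  then obtain ps where ps: "coproduct_rep y ps" "set ps \<subseteq> AA \<times> AA" using A_sw by blast
  let ?z = "\<Sum>(y1, y2)\<leftarrow>ps. lett (cot q (plus_part y1)) * lett (cot q (plus_part y2))"
  have "?z \<in> I2 q" using ps y(1) unfolding I2_def by (auto simp: sweedler_iff)
  then have zJ: "?z \<in> V.J" by (intro V.J_base) blast
  have zc: "V.cong ?z (\<Sum>p\<leftarrow>ps. matrix_element (\<lambda>t s. cot q (fst p) t * cot q (snd p) s))"
    unfolding case_prod_unfold cot_plus_part by (intro V.cong_sum_list lett_lett_basis)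
  have eq: "(\<Sum>p\<leftarrow>ps. matrix_element (\<lambda>t s. cot q (fst p) t * cot q (snd p) s)) = matrix_element m"
    unfolding y(2) mat_sw[OF ps(1)] matrix_element_sum_list case_prod_unfold ..
  show ?thesis using V.cong_mem[OF zc] zJ unfolding V_ideal_eq eq by (simp only:)
qed

end

section \<open>Torus coinvariants of the exterior algebra in degree two\<close>

lemma sum_list_swap: "(\<Sum>x\<leftarrow>xs. \<Sum>y\<leftarrow>ys. f x y) = (\<Sum>y\<leftarrow>ys. \<Sum>x\<leftarrow>xs. f x y)"
  for f :: "'a \<Rightarrow> 'b \<Rightarrow> 'c::comm_monoid_add"
  by (induction xs) (simp_all add: sum_list_addf)

lemma sum_list_swap4: "(\<Sum>p\<leftarrow>A. \<Sum>p'\<leftarrow>B. \<Sum>t\<leftarrow>C. \<Sum>s\<leftarrow>D. f p p' t s) = (\<Sum>t\<leftarrow>C. \<Sum>s\<leftarrow>D. \<Sum>p\<leftarrow>A. \<Sum>p'\<leftarrow>B. f p p' t s)"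
  for f :: "'a \<Rightarrow> 'b \<Rightarrow> 'c \<Rightarrow> 'd \<Rightarrow> 'e::comm_monoid_add"
  by (simp only: sum_list_swap[where xs = B and ys = C] sum_list_swap[where xs = B and ys = D] sum_list_swap[where xs = A and ys = C] sum_list_swap[where xs = A and ys = D])

lemma unit_K [simp]: "unit (Word [K i]) = 1"
  by (simp add: unit_def)

lemma conv_K: "(a \<star> b) (Word [K i]) = a (Word [K i]) * b (Word [K i])"
  using fun_cong[OF lt_conv(3)[of i a b], of 0] by (simp add: lt_apply conv_0)

context quantum_parameter
begin

text \<open>Whichever representative b and coproduct were selected, summing the first legs against
  the t-th coordinate of the second gives X_t \<triangleright> b. This is the property shared by all
  selections.\<close>

lemma coact_cot_list:
  obtains b where "b \<in> BB" "cot q b = v" "\<And>a n. (a, n) \<in> set (coact_cot q v) \<Longrightarrow> a \<in> AA"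
    "\<And>t. (\<Sum>(a, n)\<leftarrow>coact_cot q v. csc (n t) a) = XX t \<triangleright> b"
proof -
  let ?P = "\<lambda>ps. \<exists>b qs. b \<in> OqF3_plus q \<and> cot q b = v \<and>
     sweedler AA BB b qs \<and> ps = map (\<lambda>(x, y). (x, cot q (plus_part y))) qs"
  have "v \<in> V1 q" by (simp only: V1_eq UNIV_I)
  then obtain b where b: "b \<in> OqF3_plus q" "cot q b = v" by (auto simp: V1_def)
  then obtain qs where "coproduct_rep b qs" "set qs \<subseteq> AA \<times> BB" using Aw_sw[of b 0] by (auto simp: OqF3_plus_def B_eq)
  then have "?P (map (\<lambda>(x, y). (x, cot q (plus_part y))) qs)" using b by (auto simp: sweedler_iff)
  then have "?P (coact_cot q v)" unfolding coact_cot_def by (rule someI)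
  then obtain b qs where b: "b \<in> OqF3_plus q" "cot q b = v" "coproduct_rep b qs" "set qs \<subseteq> AA \<times> BB"
    and c: "coact_cot q v = map (\<lambda>(x, y). (x, cot q y)) qs" by (auto simp: sweedler_iff)
  show ?thesis
  proof (rule that)
    show "b \<in> BB" "cot q b = v" using b by (auto simp: OqF3_plus_def)
    show "a \<in> AA" if "(a, n) \<in> set (coact_cot q v)" for a n using that b(4) unfolding c by auto
    show "(\<Sum>(a, n)\<leftarrow>coact_cot q v. csc (n t) a) = XX t \<triangleright> b" for t
      unfolding c coproduct_rep_act[OF b(3)] by (simp only: map_map comp_def case_prod_unfold fst_conv snd_conv cot_def)
  qed
qed

text \<open>X_t \<triangleright> b has right weight \<open>wt t\<close> and value v t at the empty
  word, which determines its value at K_i.\<close>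

lemma coact_cot_K: "(\<Sum>(a, n)\<leftarrow>coact_cot q v. a (Word [K i]) * n t) = qc powi wt t i * v t"
proof -
  obtain b where b: "b \<in> BB" "cot q b = v" "\<And>t. (\<Sum>(a, n)\<leftarrow>coact_cot q v. csc (n t) a) = XX t \<triangleright> b"
    by (rule coact_cot_list[of v]) blast
  have "(\<Sum>(a, n)\<leftarrow>coact_cot q v. a (Word [K i]) * n t) = (\<Sum>(a, n)\<leftarrow>coact_cot q v. csc (n t) a) (Word [K i])"
    by (simp only: sum_list_fun_apply case_prod_unfold csc_apply mult.commute)
  also have "\<dots> = rt (K i) (XX t \<triangleright> b) 0" by (simp only: b(3)) (simp add: rt_apply)
  also have "\<dots> = qc powi wt t i * (XX t \<triangleright> b) 0"
    using Aw_X_B[OF b(1), of t] by (simp add: Aw_def del: Xvec.simps)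
  finally show ?thesis using b(2) by (simp add: cot_act[symmetric] del: Xvec.simps)
qed

text \<open>K_i is group-like and acts trivially on B, so b(K_i) = eps(b) = 0 for b in B^+.
  Evaluation at K_i thus descends to \<pi>_B(A): it is a character of the coordinate algebra of the
  torus.\<close>

lemma BplusA_K: "n \<in> BplusA q \<Longrightarrow> n (Word [K i]) = 0"
proof -
  assume "n \<in> BplusA q"
  then obtain ps where ps: "n = (\<Sum>(b, a)\<leftarrow>ps. b \<star> a)" "set ps \<subseteq> OqF3_plus q \<times> AA" by (auto simp: BplusA_def)
  have "b (Word [K i]) = 0" if "b \<in> OqF3_plus q" for b
  proof -
    have "rt (K i) b 0 = b 0" using that by (simp add: OqF3_plus_def B_eq Aw_def)
    then show ?thesis using that by (simp add: rt_apply OqF3_plus_def counit_def)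
  qed
  then have "map (\<lambda>(b, a). (b \<star> a) (Word [K i])) ps = map (\<lambda>_. 0) ps"
    using ps(2) by (auto simp: conv_K)
  then show ?thesis
    unfolding ps(1) by (simp add: sum_list_fun_apply case_prod_unfold del: map_eq_conv) 
qed

lemma ev_coact_K:
  assumes "x \<in> words_deg UNIV 2"
  shows "ev (Word [K i]) (\<lambda>w. word_matrix (letters w) t s) (coact (coact_cot q) x) = qc powi (wt t i + wt s i) * tensor_matrix x t s"
proof -
  let ?L = "\<lambda>w. word_matrix (letters w) t s" and ?k = "Word [K i]"
  have "ev ?k ?L (coact (coact_cot q) (fscale c (mon w))) = c * (qc powi (wt t i + wt s i) * word_matrix (letters w) t s)"
    if "w \<in> Poly_Mapping.keys x" for c w
  proof -
    obtain u v where w: "w = Word [u, v]" using words_deg_2_induct(2)[OF assms \<open>w \<in> _\<close>] by blast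
    have "ev ?k ?L (coact (coact_cot q) (fscale c (mon w)))
        = (\<Sum>(a, ms)\<leftarrow>coact_list (coact_cot q) [u, v]. a ?k * (c * word_matrix ms t s))"
      unfolding coact_mon w by (simp add: ev_sum_list case_prod_unfold ev_otimes)
    also have "\<dots> = (\<Sum>(a, u')\<leftarrow>coact_cot q u. \<Sum>(b, v')\<leftarrow>coact_cot q v. (a \<star> b) ?k * (c * word_matrix [u', v'] t s))"
      by (rule coact_list_2)
    also have "\<dots> = (\<Sum>p\<leftarrow>coact_cot q u. \<Sum>p'\<leftarrow>coact_cot q v. c * ((fst p ?k * snd p t) * (fst p' ?k * snd p' s)))"
      by (simp add: case_prod_unfold conv_K mult_ac)
    also have "\<dots> = c * ((\<Sum>(a, n)\<leftarrow>coact_cot q u. a ?k * n t) * (\<Sum>(a, n)\<leftarrow>coact_cot q v. a ?k * n s))"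
      by (simp add: case_prod_unfold sum_list_const_mult sum_list_mult_const)
    also have "\<dots> = c * (qc powi (wt t i + wt s i) * word_matrix (letters w) t s)"
      unfolding coact_cot_K by (simp add: w power_int_add)
    finally show ?thesis .
  qed
  then have "ev ?k ?L (coact (coact_cot q) (\<Sum>w\<in>Poly_Mapping.keys x. fscale (Poly_Mapping.lookup x w) (mon w)))
      = (\<Sum>w\<in>Poly_Mapping.keys x. Poly_Mapping.lookup x w * (qc powi (wt t i + wt s i) * word_matrix (letters w) t s))"
    by (simp add: coact_sum ev_sum)
  then show ?thesis
    unfolding words_deg_2_induct(1)[OF assms, symmetric] by (simp add: tensor_matrix_def lsum_def sum_distrib_left mult_ac)
qed

text \<open>Surjectivity onto B of the multiplication pairing between the line bundles of weights
  -\<mu> and \<mu>.\<close>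

definition invertible_wt :: "(node \<Rightarrow> int) \<Rightarrow> bool"
  where "invertible_wt \<mu> \<longleftrightarrow> (\<exists>ps. set ps \<subseteq> Aw (- \<mu>) \<times> Aw \<mu> \<and> (\<Sum>(x, y)\<leftarrow>ps. x \<star> y) = unit)"

lemma invertible_wt_add: assumes "invertible_wt \<mu>" "invertible_wt \<nu>" shows "invertible_wt (\<mu> + \<nu>)"
proof -
  obtain ps qs where ps: "set ps \<subseteq> Aw (- \<mu>) \<times> Aw \<mu>" "(\<Sum>(x, y)\<leftarrow>ps. x \<star> y) = unit"
    and qs: "set qs \<subseteq> Aw (- \<nu>) \<times> Aw \<nu>" "(\<Sum>(x, y)\<leftarrow>qs. x \<star> y) = unit"
    using assms by (auto simp: invertible_wt_def)
  \<comment> \<open>The new factors are nested around the old ones, as in x' x y y', so that the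
    inner sum collapses to 1 first.\<close>
  let ?rs = "concat (map (\<lambda>(x, y). map (\<lambda>(x', y'). (x' \<star> x, y \<star> y')) qs) ps)"
  have "set ?rs \<subseteq> Aw (- (\<mu> + \<nu>)) \<times> Aw (\<mu> + \<nu>)"
  proof
    fix p assume "p \<in> set ?rs"
    then obtain x y x' y' where p: "p = (x' \<star> x, y \<star> y')" "(x, y) \<in> set ps" "(x', y') \<in> set qs" by auto
    then have "x \<in> Aw (- \<mu>)" "y \<in> Aw \<mu>" "x' \<in> Aw (- \<nu>)" "y' \<in> Aw \<nu>" using ps(1) qs(1) by auto
    then show "p \<in> Aw (- (\<mu> + \<nu>)) \<times> Aw (\<mu> + \<nu>)"
      unfolding p(1) using Aw_conv[of x' "- \<nu>" x "- \<mu>"] Aw_conv[of y \<mu> y' \<nu>] by (simp add: algebra_simps)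
  qed
  moreover have "(\<Sum>(x, y)\<leftarrow>?rs. x \<star> y) = unit"
  proof -
    have c: "(\<Sum>p\<leftarrow>concat (map h xs). g p) = (\<Sum>x\<leftarrow>xs. \<Sum>p\<leftarrow>h x. g p)" for h :: "fnl \<times> fnl \<Rightarrow> (fnl \<times> fnl) list" and g :: "fnl \<times> fnl \<Rightarrow> fnl" and xs
      by (induction xs) (simp_all only: list.map concat.simps sum_list.Nil sum_list.Cons map_append sum_list_append)
    have "(\<Sum>(x, y)\<leftarrow>?rs. x \<star> y) = (\<Sum>p\<leftarrow>ps. \<Sum>p'\<leftarrow>qs. fst p' \<star> ((fst p \<star> snd p) \<star> snd p'))"
      unfolding c by (simp only: case_prod_unfold map_map comp_def fst_conv snd_conv conv_assoc)
    also have "\<dots> = (\<Sum>p'\<leftarrow>qs. \<Sum>p\<leftarrow>ps. fst p' \<star> ((fst p \<star> snd p) \<star> snd p'))"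
      by (rule sum_list_swap)
    also have "\<dots> = (\<Sum>p'\<leftarrow>qs. fst p' \<star> ((\<Sum>p\<leftarrow>ps. fst p \<star> snd p) \<star> snd p'))"
      by (simp only: conv_sum_list_left conv_sum_list_right)
    also have "\<dots> = unit"
      using ps(2) qs(2) by (simp only: case_prod_unfold unit_conv)
    finally show ?thesis .
  qed
  ultimately show ?thesis unfolding invertible_wt_def by blast
qed

text \<open>The antipode axiom for u_ii: the sum over m of S(u_im) u_mi is 1, with factors of right
  weights \<open>- wtu i\<close> and \<open>wtu i\<close>.\<close>

lemma invertible_wtu: assumes "i \<in> {1..3}" shows "invertible_wt (wtu i)"
proof -
  let ?ps = "map (\<lambda>m. (antip (u_coef q i m), u_coef q m i)) [1, 2, 3]"
  have "(\<Sum>(x, y)\<leftarrow>map (\<lambda>m. (u_coef q i m, u_coef q m i)) [1, 2, 3]. antip x \<star> y) = csc (u_coef q i i 0) unit"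
    using assms by (intro antipode_left u_coef_Uq_dual coproduct_rep_u_coef)
  then have "(\<Sum>(x, y)\<leftarrow>?ps. x \<star> y) = unit" by (simp add: u_coef_0)
  moreover have "set ?ps \<subseteq> Aw (- wtu i) \<times> Aw (wtu i)"
  proof -
    have "antip (u_coef q i m) \<in> Aw (- wtu i)" "u_coef q m i \<in> Aw (wtu i)" if "m \<in> {1..3}" for m
      using homA_Aw homA_antip homA_u assms that by blast+
    from this[of 1] this[of 2] this[of 3] show ?thesis by simp
  qed
  ultimately show ?thesis unfolding invertible_wt_def by blast
qed

text \<open>Invertibility is known for sums of the \<open>wtu\<close>, while a root is a difference
  of two. Since the three add up to zero, the subtracted one is replaced by the sum of the other
  two.\<close>

lemma invertible_wt_root: "invertible_wt (wt r)"
proof -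
  have I: "invertible_wt (wtu 1)" "invertible_wt (wtu 2)" "invertible_wt (wtu 3)" by (intro invertible_wtu; simp)+
  have "\<exists>i j k. wt r = wtu i + wtu j + wtu k \<and> {i, j, k} \<subseteq> {1, 2, 3}"
  proof -
    define i :: nat where "i = (case r of Eix A1 \<Rightarrow> 2 | Eix A2 \<Rightarrow> 3 | Eix A12 \<Rightarrow> 3 | Fix A1 \<Rightarrow> 1 | Fix A2 \<Rightarrow> 2 | Fix A12 \<Rightarrow> 1)"
    define j :: nat where "j = (case r of Eix A1 \<Rightarrow> 2 | Eix A2 \<Rightarrow> 1 | Eix A12 \<Rightarrow> 2 | Fix A1 \<Rightarrow> 1 | Fix A2 \<Rightarrow> 1 | Fix A12 \<Rightarrow> 1)"
    define k :: nat where "k = (case r of Eix A1 \<Rightarrow> 3 | Eix A2 \<Rightarrow> 3 | Eix A12 \<Rightarrow> 3 | Fix A1 \<Rightarrow> 3 | Fix A2 \<Rightarrow> 2 | Fix A12 \<Rightarrow> 2)"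
    have "wt r = wtu i + wtu j + wtu k"
    proof
      fix n show "wt r n = (wtu i + wtu j + wtu k) n"
        unfolding i_def j_def k_def
        by (cases n; cases r; rename_tac \<gamma>; case_tac \<gamma>; simp add: wtu_def cartan_def)
    qed
    moreover have "{i, j, k} \<subseteq> {1, 2, 3}" unfolding i_def j_def k_def by (simp split: rvec.split root.split)
    ultimately show ?thesis by blast
  qed
  then obtain i j k where "wt r = wtu i + wtu j + wtu k" "{i, j, k} \<subseteq> {1, 2, 3}" by blast
  moreover have "invertible_wt (wtu n)" if "n \<in> {1, 2, 3}" for n using I that by auto
  ultimately show ?thesis using invertible_wt_add by auto
qed

text \<open>Writing \<open>a = \<Sum> (a x\<^sub>k) y\<^sub>k\<close> with \<open>\<Sum> x\<^sub>k y\<^sub>k = 1\<close> puts \<open>a\<close> into \<open>B\<^sup>+ A\<close>.\<close>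

lemma Aw_BplusA: assumes "a \<in> Aw \<mu>" "a 0 = 0" "invertible_wt \<mu>" shows "a \<in> BplusA q"
proof -
  obtain ps where ps: "set ps \<subseteq> Aw (- \<mu>) \<times> Aw \<mu>" "(\<Sum>(x, y)\<leftarrow>ps. x \<star> y) = unit" using assms by (auto simp: invertible_wt_def)
  have "a = a \<star> (\<Sum>(x, y)\<leftarrow>ps. x \<star> y)" by (simp only: ps conv_unit)
  also have "\<dots> = (\<Sum>(b, a)\<leftarrow>map (\<lambda>(x, y). (a \<star> x, y)) ps. b \<star> a)"
    by (simp only: conv_sum_list_right case_prod_unfold map_map comp_def fst_conv snd_conv conv_assoc)
  also have "\<dots> \<in> BplusA q"
  proof -
    have "a \<star> x \<in> OqF3_plus q" if "x \<in> Aw (- \<mu>)" for x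
      using Aw_conv[OF assms(1) that] assms(2) by (simp add: OqF3_plus_def B_eq counit_def conv_0)
    then have "set (map (\<lambda>(x, y). (a \<star> x, y)) ps) \<subseteq> OqF3_plus q \<times> AA" using ps(1) Aw_A by fastforce
    then show ?thesis unfolding BplusA_def by blast
  qed
  finally show ?thesis .
qed

text \<open>The coaction comes from arbitrary representatives b and b', so its coefficients are
  compared with 1 only after expansion in basis letters. Each difference then has a definite weight
  and counit 0, hence lies in B^+A.\<close>

lemma coact_fe:
  "\<exists>s\<in>otimes_set (BplusA q) (words_on UNIV). \<exists>t\<in>otimes_set AA (V_ideal q).
     coact (coact_cot q) (fscale c (lett (f_form \<gamma>) * lett (e_form \<gamma>))) - otimes unit (fscale c (lett (f_form \<gamma>) * lett (e_form \<gamma>))) = s + t"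
proof -
  let ?f = "f_form \<gamma>" and ?e = "e_form \<gamma>"
  obtain b where b: "b \<in> BB" "cot q b = ?f" "\<And>a n. (a, n) \<in> set (coact_cot q ?f) \<Longrightarrow> a \<in> AA"
    "\<And>t. (\<Sum>(a, n)\<leftarrow>coact_cot q ?f. csc (n t) a) = XX t \<triangleright> b" using coact_cot_list[of ?f] by blast
  obtain b' where b': "b' \<in> BB" "cot q b' = ?e" "\<And>a n. (a, n) \<in> set (coact_cot q ?e) \<Longrightarrow> a \<in> AA"
    "\<And>t. (\<Sum>(a, n)\<leftarrow>coact_cot q ?e. csc (n t) a) = XX t \<triangleright> b'" using coact_cot_list[of ?e] by blast
  let ?A = "coact_cot q ?f" and ?B = "coact_cot q ?e"
  let ?e2 = "\<lambda>t s. lett (unitvec t) * lett (unitvec s) :: coords free_alg"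
  \<comment> \<open>The error of replacing each pair of letters by its expansion in basis letters;
    it lies in A \<otimes> J.\<close>
  define y where "y = (\<Sum>(a, n)\<leftarrow>?A. \<Sum>(a', n')\<leftarrow>?B. otimes (a \<star> a') (fscale c (lett n * lett n' - matrix_element (\<lambda>t s. n t * n' s))))"
  \<comment> \<open>The coefficient of the basis pair (t, s) once the sums over both coactions are
    carried out.\<close>
  define z where "z = (\<lambda>t s. (XX t \<triangleright> b) \<star> (XX s \<triangleright> b'))"
  have 1: "coact (coact_cot q) (fscale c (lett ?f * lett ?e)) = (\<Sum>(a, n)\<leftarrow>?A. \<Sum>(a', n')\<leftarrow>?B. otimes (a \<star> a') (fscale c (lett n * lett n')))"
    unfolding lett_mult coact_mon by (simp only: word.sel coact_list_2)
  have y: "y \<in> otimes_set AA (V_ideal q)"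
    unfolding y_def
  proof (intro otimes_set_sum_list, clarsimp, intro otimes_set_sum_list, clarsimp)
    fix a n a' n' assume "(a, n) \<in> set ?A" "(a', n') \<in> set ?B"
    then have "a \<star> a' \<in> AA" using b(3) b'(3) by auto
    moreover have "lett n * lett n' - matrix_element (\<lambda>t s. n t * n' s) \<in> V_ideal q"
      using lett_lett_basis[of n n'] unfolding V.cong_def V_ideal_eq .
    ultimately show "otimes (a \<star> a') (fscale c (lett n * lett n' - matrix_element (\<lambda>t s. n t * n' s))) \<in> otimes_set AA (V_ideal q)"
      unfolding V_ideal_eq by (intro otimes_set_base V.J_scale)
  qed
  have 2: "coact (coact_cot q) (fscale c (lett ?f * lett ?e)) - y = (\<Sum>t\<in>UNIV. \<Sum>s\<in>UNIV. otimes (z t s) (fscale c (?e2 t s)))"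
  proof -
    have "coact (coact_cot q) (fscale c (lett ?f * lett ?e)) - y
       = (\<Sum>(a, n)\<leftarrow>?A. \<Sum>(a', n')\<leftarrow>?B. otimes (a \<star> a') (fscale c (matrix_element (\<lambda>t s. n t * n' s))))"
      unfolding 1 y_def case_prod_unfold
      by (simp only: sum_list_subtractf[symmetric] otimes_linear(6)[symmetric] flin.scale_right_diff_distrib[symmetric] diff_diff_eq2 add_diff_cancel_left')
    also have "\<dots> = (\<Sum>p\<leftarrow>?A. \<Sum>p'\<leftarrow>?B. \<Sum>t\<leftarrow>all_rvecs. \<Sum>s\<leftarrow>all_rvecs. otimes (csc (snd p t) (fst p) \<star> csc (snd p' s) (fst p')) (fscale c (?e2 t s)))"
      unfolding matrix_element_def case_prod_unfold sum_all_rvecs flin.scale_sum_right otimes_sum_right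
      by (simp only: conv_csc_left conv_csc_right csc_csc otimes_linear(3) flin.scale_scale mult_ac)
    also have "\<dots> = (\<Sum>t\<leftarrow>all_rvecs. \<Sum>s\<leftarrow>all_rvecs. \<Sum>p\<leftarrow>?A. \<Sum>p'\<leftarrow>?B. otimes (csc (snd p t) (fst p) \<star> csc (snd p' s) (fst p')) (fscale c (?e2 t s)))"
      by (rule sum_list_swap4)
    also have "\<dots> = (\<Sum>t\<leftarrow>all_rvecs. \<Sum>s\<leftarrow>all_rvecs. otimes (z t s) (fscale c (?e2 t s)))"
      unfolding z_def b(4)[symmetric] b'(4)[symmetric] conv_sum_list_left conv_sum_list_right otimes_sum_list_left case_prod_unfold
      by (simp only: sum_list_swap[where xs = ?A and ys = ?B])
    finally show ?thesis unfolding sum_all_rvecs .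
  qed
  have 3: "otimes unit (fscale c (lett ?f * lett ?e)) = (\<Sum>t\<in>UNIV. \<Sum>s\<in>UNIV. otimes (csc (of_bool (t = Fix \<gamma> \<and> s = Eix \<gamma>)) unit) (fscale c (?e2 t s)))"
    by (cases \<gamma>; simp add: sum_rvec otimes_linear f_form_def e_form_def)
  define x where "x = (\<Sum>t\<in>UNIV. \<Sum>s\<in>UNIV. otimes (z t s - csc (of_bool (t = Fix \<gamma> \<and> s = Eix \<gamma>)) unit) (fscale c (?e2 t s)))"
  have "x \<in> otimes_set (BplusA q) (words_on UNIV)"
    unfolding x_def
  proof (intro otimes_set_sum otimes_set_base)
    fix t s
    show "fscale c (?e2 t s) \<in> words_on UNIV" by (simp add: words_on_def)
    have zw: "z t s \<in> Aw (wt t + wt s)" unfolding z_def by (intro Aw_conv Aw_X_B b b')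
    have z0: "z t s 0 = of_bool (t = Fix \<gamma> \<and> s = Eix \<gamma>)"
      unfolding z_def conv_0 cot_act[symmetric] b(2) b'(2) by (simp add: f_form_def e_form_def unitvec_def)
    show "z t s - csc (of_bool (t = Fix \<gamma> \<and> s = Eix \<gamma>)) unit \<in> BplusA q"
    proof (rule Aw_BplusA)
      show "invertible_wt (wt t + wt s)" by (intro invertible_wt_add invertible_wt_root)
      show "(z t s - csc (of_bool (t = Fix \<gamma> \<and> s = Eix \<gamma>)) unit) 0 = 0" using z0 by simp
      show "z t s - csc (of_bool (t = Fix \<gamma> \<and> s = Eix \<gamma>)) unit \<in> Aw (wt t + wt s)"
      \<comment> \<open>The unit is subtracted at a single position, where
        \<open>wt t + wt s\<close> is 0 and therefore equal to the weight of the unit.\<close>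
      proof (cases "t = Fix \<gamma> \<and> s = Eix \<gamma>")
        case True
        then have "wt t + wt s = 0" by (simp add: wt_sum_zero)
        then show ?thesis using zw True subspace_Aw[of 0] homA_Aw[OF homA_unit]
          by (simp add: fn.subspace_diff)
      next
        case False
        then show ?thesis using zw by auto
      qed
    qed
  qed
  moreover have "coact (coact_cot q) (fscale c (lett ?f * lett ?e)) - otimes unit (fscale c (lett ?f * lett ?e)) = x + y"
  proof -
    have "x = (\<Sum>t\<in>UNIV. \<Sum>s\<in>UNIV. otimes (z t s) (fscale c (?e2 t s))) - otimes unit (fscale c (lett ?f * lett ?e))"
      unfolding x_def 3 by (simp only: otimes_linear(7) sum_subtractf)
    then show ?thesis unfolding 2[symmetric] by (simp add: algebra_simps)
  qed
  ultimately show ?thesis using y by blast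
qed

lemma tensor_matrix_fe: "tensor_matrix (lett (f_form \<gamma>) * lett (e_form \<gamma>)) = fe \<gamma>"
  by (simp add: tensor_matrix_def lett_mult fe_def f_form_def e_form_def unitvec_def fun_eq_iff)

lemma V_coinv_eq:
  "V_coinv q 2 = qspan (V_ideal q) ((\<lambda>\<gamma>. cls (V_ideal q) (lett (f_form \<gamma>) * lett (e_form \<gamma>))) ` UNIV)"
proof -
  let ?b = "\<lambda>\<gamma>. lett (f_form \<gamma>) * lett (e_form \<gamma>)"
  have fin: "finite (UNIV :: root set)" by (simp add: UNIV_root)
  have deg: "(\<Sum>\<gamma>\<in>UNIV. fscale (c \<gamma>) (?b \<gamma>)) \<in> words_deg UNIV 2" for c
    by (intro words_deg_sum words_deg_scale words_deg_lett2) simp_all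
  have Th: "tensor_matrix (\<Sum>\<gamma>\<in>UNIV. fscale (c \<gamma>) (?b \<gamma>)) = (\<lambda>t s. \<Sum>\<gamma>\<in>UNIV. c \<gamma> * fe \<gamma> t s)" for c
    unfolding sum_root tensor_matrix_linear tensor_matrix_fe by (simp add: fun_eq_iff)
  have coinv: "C \<in> V_coinv q 2 \<longleftrightarrow> (\<exists>x. C = cls V.J x \<and> x \<in> words_deg UNIV 2 \<and>
      (\<exists>s\<in>otimes_set (BplusA q) (words_on UNIV). \<exists>t\<in>otimes_set AA V.J. coact (coact_cot q) x - otimes unit x = s + t))" for C
    unfolding V_coinv_def V_ideal_eq V1_eq by (rule coinvariants_iff[OF V.J_neg])
  have "C \<in> V_coinv q 2 \<longleftrightarrow> (\<exists>c. C = cls V.J (\<Sum>\<gamma>\<in>UNIV. fscale (c \<gamma>) (?b \<gamma>)))" for C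
    unfolding coinv
  proof (intro iffI)
    assume "\<exists>x. C = cls V.J x \<and> x \<in> words_deg UNIV 2 \<and>
      (\<exists>s\<in>otimes_set (BplusA q) (words_on UNIV). \<exists>t\<in>otimes_set AA V.J. coact (coact_cot q) x - otimes unit x = s + t)"
    then obtain x s t where x: "C = cls V.J x" "x \<in> words_deg UNIV 2" and s: "s \<in> otimes_set (BplusA q) (words_on UNIV)"
      and t: "t \<in> otimes_set AA V.J" and eq: "coact (coact_cot q) x - otimes unit x = s + t" by blast
    obtain ss where ss: "s = (\<Sum>(a, y)\<leftarrow>ss. otimes a y)" "set ss \<subseteq> BplusA q \<times> words_on UNIV" using s by (auto simp: otimes_set_def)
    obtain ts where ts: "t = (\<Sum>(a, y)\<leftarrow>ts. otimes a y)" "set ts \<subseteq> AA \<times> V.J" using t by (auto simp: otimes_set_def)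
    \<comment> \<open>Evaluation at K_i annihilates the part from B^+A and sends the part from A
      \<otimes> J into W, which leaves the weight condition on the matrix of x.\<close>
    have "(\<lambda>t s. (qc powi (wt t i + wt s i) - 1) * tensor_matrix x t s) \<in> W" for i
    proof -
      have "(qc powi (wt t' i + wt s' i) - 1) * tensor_matrix x t' s' = (\<Sum>(a, y)\<leftarrow>ts. (\<lambda>t s. a (Word [K i]) * tensor_matrix y t s)) t' s'" for t' s'
      proof -
        let ?ev = "ev (Word [K i]) (\<lambda>w. word_matrix (letters w) t' s')"
        have "?ev s = (\<Sum>p\<leftarrow>ss. 0)"
          unfolding ss(1) ev_sum_list case_prod_unfold ev_otimes using ss(2) BplusA_K
          by (intro arg_cong[where f = sum_list] map_cong) fastforce+
        then have "?ev (s + t) = (\<Sum>(a, y)\<leftarrow>ts. a (Word [K i]) * tensor_matrix y t' s')"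
          unfolding ts(1) by (simp add: ev_add ev_sum_list case_prod_unfold ev_otimes tensor_matrix_def)
        moreover have "?ev (coact (coact_cot q) x - otimes unit x) = (qc powi (wt t' i + wt s' i) - 1) * tensor_matrix x t' s'"
          unfolding ev_minus ev_coact_K[OF x(2)] ev_otimes by (simp add: tensor_matrix_def algebra_simps)
        ultimately show ?thesis using eq by (simp add: sum_list_fun_apply case_prod_unfold)
      qed
      then have "(\<lambda>t s. (qc powi (wt t i + wt s i) - 1) * tensor_matrix x t s) = (\<Sum>(a, y)\<leftarrow>ts. (\<lambda>t s. a (Word [K i]) * tensor_matrix y t s))"
        by (intro ext)
      also have "\<dots> \<in> W"
        using ts(2) tensor_matrix_V_ideal unfolding V_ideal_eq case_prod_unfold by (intro W_sum_list W_scale) auto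
      finally show ?thesis .
    qed
    from W_normal_form[OF this] obtain c where "tensor_matrix x - (\<lambda>t s. \<Sum>\<gamma>\<in>UNIV. c \<gamma> * fe \<gamma> t s) \<in> W" by blast
    from matrix_element_W[OF this] have "matrix_element (tensor_matrix x - (\<lambda>t s. \<Sum>\<gamma>\<in>UNIV. c \<gamma> * fe \<gamma> t s)) \<in> V.J" by (simp only: V_ideal_eq)
    moreover have "matrix_element (m - n) = matrix_element m - matrix_element n" for m n using matrix_element_linear(1)[of "m - n" n] by (simp add: algebra_simps)
    ultimately have "V.cong (matrix_element (tensor_matrix x)) (matrix_element (tensor_matrix (\<Sum>\<gamma>\<in>UNIV. fscale (c \<gamma>) (?b \<gamma>))))"
      unfolding Th by (simp add: V.cong_def)
    then have "V.cong x (\<Sum>\<gamma>\<in>UNIV. fscale (c \<gamma>) (?b \<gamma>))"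
      using V_reduce[OF x(2)] V_reduce[OF deg, of c] V.cong_trans V.cong_sym by blast
    then show "\<exists>c. C = cls V.J (\<Sum>\<gamma>\<in>UNIV. fscale (c \<gamma>) (?b \<gamma>))" using x(1) V.cls_eq_iff by blast
  next
    assume "\<exists>c. C = cls V.J (\<Sum>\<gamma>\<in>UNIV. fscale (c \<gamma>) (?b \<gamma>))"
    then obtain c where C: "C = cls V.J (\<Sum>\<gamma>\<in>UNIV. fscale (c \<gamma>) (?b \<gamma>))" by blast
    let ?Q = "\<lambda>x. \<exists>s\<in>otimes_set (BplusA q) (words_on UNIV). \<exists>t\<in>otimes_set AA V.J. coact (coact_cot q) x - otimes unit x = s + t"
    have add: "?Q (x + y)" if Q: "?Q x" "?Q y" for x y
    proof -
      obtain s t s' t' where st: "s \<in> otimes_set (BplusA q) (words_on UNIV)" "t \<in> otimes_set AA V.J" "coact (coact_cot q) x - otimes unit x = s + t"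
        "s' \<in> otimes_set (BplusA q) (words_on UNIV)" "t' \<in> otimes_set AA V.J" "coact (coact_cot q) y - otimes unit y = s' + t'"
        using Q by blast
      have "coact (coact_cot q) (x + y) - otimes unit (x + y) = (coact (coact_cot q) x - otimes unit x) + (coact (coact_cot q) y - otimes unit y)"
        by (simp add: coact_add otimes_linear)
      also have "\<dots> = (s + s') + (t + t')" unfolding st(3,6) by (simp add: algebra_simps)
      finally show ?thesis using otimes_set_add[OF st(1,4)] otimes_set_add[OF st(2,5)] by blast
    qed
    have "?Q (\<Sum>\<gamma>\<in>UNIV. fscale (c \<gamma>) (?b \<gamma>))"
      unfolding sum_root by (intro add coact_fe[unfolded V_ideal_eq])
    then show "\<exists>x. C = cls V.J x \<and> x \<in> words_deg UNIV 2 \<and>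
      (\<exists>s\<in>otimes_set (BplusA q) (words_on UNIV). \<exists>t\<in>otimes_set AA V.J. coact (coact_cot q) x - otimes unit x = s + t)"
      using C deg by blast
  qed
  then show ?thesis
    unfolding V_ideal_eq V.qspan_eq[OF fin] by blast
qed

end

section \<open>The maximal prolongation\<close>

type_synonym form2 = "rvec \<Rightarrow> rvec \<Rightarrow> fnl"

definition mscale :: "complex \<Rightarrow> mtx \<Rightarrow> mtx" where "mscale c m = (\<lambda>t s. c * m t s)"

lemma vector_space_msc: "vector_space mscale"
  by standard (simp_all add: mscale_def fun_eq_iff algebra_simps)

text \<open>The P t s are the images of the matrix units under a linear projection onto V. An
  A-valued matrix with all values in V thereby becomes a finite sum of its own entries times fixed
  members of V.\<close>

lemma projection_onto_subspace:
  assumes "0 \<in> V" "\<And>v w. v \<in> V \<Longrightarrow> w \<in> V \<Longrightarrow> v + w \<in> V" "\<And>c v. v \<in> V \<Longrightarrow> (\<lambda>t s. c * v t s) \<in> V"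
  shows "\<exists>P :: rvec \<Rightarrow> rvec \<Rightarrow> mtx. (\<forall>t s. P t s \<in> V) \<and> (\<forall>v\<in>V. v = (\<Sum>t\<in>UNIV. \<Sum>s\<in>UNIV. mscale (v t s) (P t s)))"
proof -
  interpret vector_space_pair mscale mscale by (intro vector_space_pair.intro vector_space_msc)
  have V: "vs1.subspace V" using assms by (simp add: vs1.subspace_def mscale_def)
  have id: "Vector_Spaces.linear mscale mscale (\<lambda>x. x)" by (rule vs1.linear_ident)
  obtain g where g: "range g \<subseteq> V" "Vector_Spaces.linear mscale mscale g" "\<forall>v\<in>V. g v = v"
    using linear_exists_left_inverse_on[OF id V] by auto
  define e :: "rvec \<Rightarrow> rvec \<Rightarrow> mtx" where "e t s = (\<lambda>t' s'. of_bool (t' = t \<and> s' = s))" for t s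
  have decomp: "v = (\<Sum>t\<in>UNIV. \<Sum>s\<in>UNIV. mscale (v t s) (e t s))" for v
  proof (intro ext)
    fix t s
    show "v t s = (\<Sum>t\<in>UNIV. \<Sum>s\<in>UNIV. mscale (v t s) (e t s)) t s"
      by (cases t; cases s; rename_tac \<gamma> \<delta>; case_tac \<gamma>; case_tac \<delta>; simp add: mscale_def e_def sum_rvec)
  qed
  have "v = (\<Sum>t\<in>UNIV. \<Sum>s\<in>UNIV. mscale (v t s) (g (e t s)))" if "v \<in> V" for v
  proof -
    have "g (\<Sum>t\<in>UNIV. \<Sum>s\<in>UNIV. mscale (v t s) (e t s)) = (\<Sum>t\<in>UNIV. \<Sum>s\<in>UNIV. mscale (v t s) (g (e t s)))"
      by (simp only: linear_sum[OF g(2)] linear_scale[OF g(2)])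
    then show ?thesis using decomp[of v] g(3) that by metis
  qed
  then show ?thesis using g(1) by (intro exI[of _ "\<lambda>t s. g (e t s)"]) blast
qed

text \<open>Coefficients are attached to list positions, since the first components of the pairs may
  repeat.\<close>

lemma span_list:
  "a \<in> fn.span (fst ` set ps) \<Longrightarrow> \<exists>qs. map snd qs = ps \<and> a = (\<Sum>r\<leftarrow>qs. csc (fst r) (fst (snd r)))"
proof (induction ps arbitrary: a)
  case Nil
  then have "a = 0" by (simp only: list.set image_empty fn.span_empty singleton_iff)
  then show ?case by (intro exI[of _ "[]"]) (simp only: list.map sum_list.Nil simp_thms)
next
  case (Cons p ps)
  then have "a \<in> fn.span (insert (fst p) (fst ` set ps))" by (simp only: list.set image_insert)
  then obtain k where "a - csc k (fst p) \<in> fn.span (fst ` set ps)" unfolding fn.span_insert by blast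
  then obtain qs where qs: "map snd qs = ps" "a - csc k (fst p) = (\<Sum>r\<leftarrow>qs. csc (fst r) (fst (snd r)))" using Cons.IH by blast
  then have "a = csc k (fst p) + (\<Sum>r\<leftarrow>qs. csc (fst r) (fst (snd r)))" by (metis diff_add_cancel add.commute)
  then have "map snd ((k, p) # qs) = p # ps \<and> a = (\<Sum>r\<leftarrow>(k, p) # qs. csc (fst r) (fst (snd r)))"
    using qs(1) by (simp only: list.map fst_conv snd_conv sum_list.Cons simp_thms)
  then show ?case by (intro exI[of _ "(k, p) # qs"])
qed

context quantum_parameter
begin

lemma rmul_sum_list_right: "rmul \<omega> (\<Sum>i\<leftarrow>is. f i) = (\<Sum>i\<leftarrow>is. rmul \<omega> (f i))"
proof (induction "is")
  case Nil
  have "rmul \<omega> 0 = 0" using rmul_linear(4)[of \<omega> 0 0] by (simp add: fun_eq_iff)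
  then show ?case by (simp only: list.map sum_list.Nil)
qed (simp only: list.map sum_list.Cons rmul_linear)

lemma rmul_sum_list_left: "rmul (\<Sum>i\<leftarrow>is. f i) c = (\<Sum>i\<leftarrow>is. rmul (f i) c)"
proof (induction "is")
  case Nil
  have "rmul 0 c = 0" using rmul_linear(2)[of 0 0 c] by (simp add: fun_eq_iff zero_fun_def)
  then show ?case by (simp only: list.map sum_list.Nil)
qed (simp only: list.map sum_list.Cons rmul_linear)

abbreviation Omega_rels :: "form1 free_alg set"
  where "Omega_rels \<equiv> lin_rels (\<lambda>c \<omega> r. csc c (\<omega> r)) Forms1 \<union> balance_rels q \<union> prolongation_rels q"

sublocale O: word_ideal Forms1 Omega_rels .

lemma Omega_ideal_eq: "Omega_ideal q = ideal_gen Forms1 Omega_rels"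
  by (simp only: Omega_ideal_def Omega1_eq)

lemma Forms1_D: "\<omega> \<in> Forms1 \<Longrightarrow> \<omega> r \<in> D" using Aw_A A_Uq_dual unfolding Forms1_def by blast
lemma Forms1_add: "\<omega> \<in> Forms1 \<Longrightarrow> \<eta> \<in> Forms1 \<Longrightarrow> \<omega> + \<eta> \<in> Forms1"
  using Omega1.add by (simp only: Omega1_eq[symmetric])
lemma Forms1_zero: "0 \<in> Forms1" using Omega1_zero by (simp only: Omega1_eq)
lemma Forms1_diff: "b \<in> BB \<Longrightarrow> diff q b \<in> Forms1" using Omega1.diff by (simp only: Omega1_eq[symmetric])
lemma Forms1_lmult: "b \<in> BB \<Longrightarrow> \<omega> \<in> Forms1 \<Longrightarrow> lmult b \<omega> \<in> Forms1" using Omega1.left by (simp only: Omega1_eq[symmetric])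

text \<open>\<open>tensor_form\<close> is the map \<open>\<Omega>\<^sup>1 \<otimes>\<^sub>B \<Omega>\<^sup>1 \<rightarrow> A \<otimes> \<Lambda>\<^sup>1 \<otimes> \<Lambda>\<^sup>1\<close>,
  \<open>(a \<otimes> r) \<otimes> (b \<otimes> s) \<mapsto> a b\<^sub>(\<^sub>1\<^sub>) \<otimes> r b\<^sub>(\<^sub>2\<^sub>) \<otimes> s\<close>, and \<open>lift_form\<close> below is its inverse.\<close>

definition word_form :: "form1 list \<Rightarrow> form2"
  where "word_form ws = (\<lambda>t s. case ws of [\<omega>, \<eta>] \<Rightarrow> rmul \<omega> (\<eta> s) t | _ \<Rightarrow> 0)"

definition tensor_form :: "form1 free_alg \<Rightarrow> form2"
  where "tensor_form x = (\<lambda>t s Y. lsum (\<lambda>w. word_form (letters w) t s Y) x)"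

lemma word_form_Pair [simp]: "word_form [\<omega>, \<eta>] = (\<lambda>t s. rmul \<omega> (\<eta> s) t)" by (simp add: word_form_def)

lemma word_form_length: "length ws \<noteq> 2 \<Longrightarrow> word_form ws t s = 0"
  by (auto simp: word_form_def split: list.splits)

lemma tensor_form_linear: "tensor_form (x + y) t s = tensor_form x t s + tensor_form y t s" "tensor_form (fscale c x) t s = csc c (tensor_form x t s)" "tensor_form 0 t s = 0"
  "tensor_form (x - y) t s = tensor_form x t s - tensor_form y t s"
  by (simp_all add: tensor_form_def fun_eq_iff)

lemma tensor_form_sum_list: "tensor_form (\<Sum>i\<leftarrow>is. f i) t s = (\<Sum>i\<leftarrow>is. tensor_form (f i) t s)"
  by (rule ext) (simp only: tensor_form_def lsum_sum_list sum_list_fun_apply)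

lemma tensor_form_lett2: "tensor_form (lett \<omega> * lett \<eta>) = (\<lambda>t s. rmul \<omega> (\<eta> s) t)"
  by (simp add: tensor_form_def lett_mult fun_eq_iff)

lemma word_form_cases:
  assumes "\<And>b. us = [] \<Longrightarrow> vs = [b] \<Longrightarrow> P" "\<And>a. us = [a] \<Longrightarrow> vs = [] \<Longrightarrow> P"
    "(\<And>x t s. word_form (us @ x # vs) t s = 0) \<Longrightarrow> P"
  shows P
proof (cases "length us + length vs = 1")
  case True
  then show ?thesis using assms(1,2) by (cases us; cases vs) auto
next
  case False
  then show ?thesis using assms(3) word_form_length by simp
qed

lemma word_form_add: "word_form (us @ (x + y) # vs) t s Y = word_form (us @ x # vs) t s Y + word_form (us @ y # vs) t s Y"
  by (rule word_form_cases[of us vs]) (simp_all add: rmul_linear)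

lemma word_form_scale: "word_form (us @ (\<lambda>r. csc c (x r)) # vs) t s Y = c * word_form (us @ x # vs) t s Y"
  by (rule word_form_cases[of us vs]) (simp_all add: rmul_linear)

text \<open>Apply X_t to \<Sum> b (X_s \<triangleright> c) = 0. The twisted Leibniz rule gives the
  image of \<Sum> db \<otimes> dc plus the sum with both operators on c.\<close>

lemma prolongation_sum:
  assumes "set ps \<subseteq> BB \<times> BB" "(\<Sum>(b, c)\<leftarrow>ps. lmult b (diff q c)) = 0"
  shows "(\<Sum>(b, c)\<leftarrow>ps. rmul (diff q b) (XX s \<triangleright> c) t) = - (\<Sum>(b, c)\<leftarrow>ps. b \<star> (XX t \<triangleright> (XX s \<triangleright> c)))"
proof -
  have "(\<Sum>(b, c)\<leftarrow>ps. b \<star> (XX s \<triangleright> c)) = (\<Sum>(b, c)\<leftarrow>ps. lmult b (diff q c)) s"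
    by (simp only: sum_list_fun_apply case_prod_unfold lmult_def diff_def)
  then have "(\<Sum>(b, c)\<leftarrow>ps. b \<star> (XX s \<triangleright> c)) = 0" using assms(2) by simp
  then have "0 = XX t \<triangleright> (\<Sum>(b, c)\<leftarrow>ps. b \<star> (XX s \<triangleright> c))" by (simp only: act_linear)
  also have "\<dots> = (\<Sum>(b, c)\<leftarrow>ps. rmul (diff q b) (XX s \<triangleright> c) t + b \<star> (XX t \<triangleright> (XX s \<triangleright> c)))"
    unfolding act_sum_list case_prod_unfold
  proof (intro arg_cong[where f = sum_list] map_cong refl)
    fix p assume "p \<in> set ps"
    then have "fst p \<in> D" "snd p \<in> D" using assms(1) B_A by auto
    then show "XX t \<triangleright> (fst p \<star> (XX s \<triangleright> snd p)) = rmul (diff q (fst p)) (XX s \<triangleright> snd p) t + fst p \<star> (XX t \<triangleright> (XX s \<triangleright> snd p))"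
      by (simp only: X_conv act_Uq_dual rmul_def diff_def)
  qed
  also have "\<dots> = (\<Sum>(b, c)\<leftarrow>ps. rmul (diff q b) (XX s \<triangleright> c) t) + (\<Sum>(b, c)\<leftarrow>ps. b \<star> (XX t \<triangleright> (XX s \<triangleright> c)))"
    by (simp only: case_prod_unfold sum_list_addf)
  finally show ?thesis by (simp only: eq_neg_iff_add_eq_0)
qed

text \<open>Evaluating everything but the last leg at Y yields y = \<Sum> (a b c_1)(Y) c_2 in B, on
  which X takes the value of a \<Sum> b (X \<triangleright> c) at Y. For X = X_r this is 0, so y
  minus its counit lies in I; for X = X_t X_s it is the matrix in question.\<close>

lemma prolongation_W:
  assumes "set ps \<subseteq> BB \<times> BB" "(\<Sum>(b, c)\<leftarrow>ps. lmult b (diff q c)) = 0"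
  shows "(\<lambda>t s. (a \<star> (\<Sum>(b, c)\<leftarrow>ps. b \<star> (XX t \<triangleright> (XX s \<triangleright> c)))) Y) \<in> W"
proof -
  define sc where "sc c = (SOME qs. coproduct_rep c qs \<and> set qs \<subseteq> AA \<times> BB)" for c
  have sc: "coproduct_rep c (sc c) \<and> set (sc c) \<subseteq> AA \<times> BB" if "c \<in> BB" for c
  proof -
    have "\<exists>qs. coproduct_rep c qs \<and> set qs \<subseteq> AA \<times> BB" using that Aw_sw[of c 0] unfolding B_eq by blast
    then show ?thesis unfolding sc_def by (rule someI_ex)
  qed
  define y where "y = (\<Sum>(b, c)\<leftarrow>ps. \<Sum>(x, z)\<leftarrow>sc c. csc ((a \<star> (b \<star> x)) Y) z)"
  have key: "(a \<star> (\<Sum>(b, c)\<leftarrow>ps. b \<star> (X \<triangleright> c))) Y = (X \<triangleright> y) 0" for X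
  proof -
    have "a \<star> (\<Sum>(b, c)\<leftarrow>ps. b \<star> (X \<triangleright> c)) = (\<Sum>(b, c)\<leftarrow>ps. \<Sum>(x, z)\<leftarrow>sc c. csc (pair X z) (a \<star> (b \<star> x)))"
      unfolding conv_sum_list_right case_prod_unfold
    proof (intro arg_cong[where f = sum_list] map_cong refl)
      fix p assume "p \<in> set ps"
      then have "snd p \<in> BB" using assms(1) by auto
      then have "X \<triangleright> snd p = (\<Sum>(x, z)\<leftarrow>sc (snd p). csc (pair X z) x)" using sc by (intro coproduct_rep_act) blast
      then show "a \<star> (fst p \<star> (X \<triangleright> snd p)) = (\<Sum>pa\<leftarrow>sc (snd p). csc (pair X (snd pa)) (a \<star> (fst p \<star> fst pa)))"
        by (simp only: conv_sum_list_right case_prod_unfold conv_csc_right)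
    qed
    moreover have "(X \<triangleright> y) 0 = (\<Sum>(b, c)\<leftarrow>ps. \<Sum>(x, z)\<leftarrow>sc c. (a \<star> (b \<star> x)) Y * pair X z)"
      unfolding y_def act_sum_list case_prod_unfold
      by (simp only: sum_list_fun_apply act_sum_list act_linear csc_apply act_apply_0)
    ultimately show ?thesis by (simp only: sum_list_fun_apply case_prod_unfold csc_apply mult.commute)
  qed
  have yB: "y \<in> BB"
  proof -
    have sl: "(\<Sum>i\<leftarrow>is. f i) \<in> BB" if "\<And>i. i \<in> set is \<Longrightarrow> f i \<in> BB" for f :: "fnl \<times> fnl \<Rightarrow> fnl" and "is"
      using that
    proof (induction "is")
      case Nil
      show ?case by (simp only: list.map sum_list.Nil B_zero)
    next
      case (Cons i "is")
      then have "f i \<in> BB" "(\<Sum>i\<leftarrow>is. f i) \<in> BB" by (meson list.set_intros)+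
      then show ?case by (simp only: list.map sum_list.Cons B_add)
    qed
    show ?thesis unfolding y_def case_prod_unfold
    proof (intro sl B_csc)
      fix p p' assume p: "p \<in> set ps" "p' \<in> set (sc (snd p))"
      have "snd p \<in> BB" using p(1) assms(1) by auto
      then have "set (sc (snd p)) \<subseteq> AA \<times> BB" using sc by blast
      then show "snd p' \<in> BB" using p(2) by auto
    qed
  qed
  have yX: "(XX r \<triangleright> y) 0 = 0" for r
  proof -
    have "(\<Sum>(b, c)\<leftarrow>ps. b \<star> (XX r \<triangleright> c)) = (\<Sum>(b, c)\<leftarrow>ps. lmult b (diff q c)) r"
      by (simp only: sum_list_fun_apply case_prod_unfold lmult_def diff_def)
    then show ?thesis using key[of "XX r"] assms(2) by (simp del: Xvec.simps)
  qed
  define z where "z = y - csc (y 0) unit"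
  have "z \<in> cot_ideal q"
    using yB yX by (simp add: z_def cot_ideal_iff B_minus B_csc B_unit X_unit del: Xvec.simps)
  moreover have "mat z = (\<lambda>t s. (a \<star> (\<Sum>(b, c)\<leftarrow>ps. b \<star> (XX t \<triangleright> (XX s \<triangleright> c)))) Y)"
  proof (intro ext)
    fix t s
    have "mat z t s = (XX t \<triangleright> (XX s \<triangleright> y)) 0" by (simp add: mat_def z_def X_unit del: Xvec.simps)
    then show "mat z t s = (a \<star> (\<Sum>(b, c)\<leftarrow>ps. b \<star> (XX t \<triangleright> (XX s \<triangleright> c)))) Y"
      using key[of "XX t * XX s"] by (simp only: act_mult)
  qed
  ultimately show ?thesis unfolding W_def by (metis image_eqI)
qed

text \<open>The outer factor x passes through by left linearity, and y is absorbed by (dc) y = d(c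
  y) - c dy, which leads back to a relation without outer factors.\<close>

lemma tensor_form_prolongation:
  assumes ps: "set ps \<subseteq> BB \<times> BB" "(\<Sum>(b, c)\<leftarrow>ps. lmult b (diff q c)) = 0" and xy: "x \<in> BB" "y \<in> BB"
  shows "(\<lambda>t s. (\<Sum>(b, c)\<leftarrow>ps. rmul (lmult x (diff q b)) (rmul (diff q c) y s) t) Y) \<in> W"
proof -
  define S where "S = (\<Sum>(b, c)\<leftarrow>ps. b \<star> c)"
  \<comment> \<open>Encodes \<Sum> b d(c y) - (\<Sum> b c) dy = 0; the terms in dy are collected
    into one extra pair.\<close>
  define qs where "qs = map (\<lambda>(b, c). (b, c \<star> y)) ps @ [(- S, y)]"
  have D: "fst p \<in> D" "snd p \<in> D" if "p \<in> set ps" for p using ps(1) that B_A by auto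
  have y: "y \<in> D" using xy B_A by simp
  have SB: "S \<in> BB"
  proof -
    have "(\<Sum>(b, c)\<leftarrow>ps. b \<star> c) \<in> BB" if "set ps \<subseteq> BB \<times> BB" for ps
      using that
    proof (induction ps)
      case Nil
      show ?case by (simp only: list.map sum_list.Nil B_zero)
    next
      case (Cons p ps)
      then have "fst p \<star> snd p \<in> BB" "(\<Sum>(b, c)\<leftarrow>ps. b \<star> c) \<in> BB" by (auto intro: B_conv)
      then show ?case by (simp only: list.map sum_list.Cons B_add case_prod_unfold)
    qed
    then show ?thesis using ps(1) unfolding S_def by blast
  qed
  have negS: "- S \<in> BB" using B_minus[OF B_zero SB] by simp
  have qs1: "set qs \<subseteq> BB \<times> BB" using ps(1) negS xy B_conv unfolding qs_def by auto
  have leib: "rmul (diff q c) y = diff q (c \<star> y) - lmult c (diff q y)" if "c \<in> D" for c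
    using diff_conv[OF that y] by simp
  have lm: "lmult b (\<omega> - \<eta>) = lmult b \<omega> - lmult b \<eta>" "lmult b (lmult c \<omega>) = lmult (b \<star> c) \<omega>"
    "lmult (- b) \<omega> = - lmult b \<omega>" for b c \<omega> \<eta>
    by (rule ext, simp only: lmult_def conv_minus_right conv_assoc conv_uminus_left minus_apply uminus_apply)+
  have lsum: "lmult (\<Sum>(b, c)\<leftarrow>ps. b \<star> c) \<omega> = (\<Sum>(b, c)\<leftarrow>ps. lmult (b \<star> c) \<omega>)" for \<omega>
    by (rule ext) (simp only: lmult_def conv_sum_list_left sum_list_fun_apply case_prod_unfold)
  have qs2: "(\<Sum>(b, c)\<leftarrow>qs. lmult b (diff q c)) = 0"
  proof -
    have "(\<Sum>(b, c)\<leftarrow>qs. lmult b (diff q c)) = (\<Sum>(b, c)\<leftarrow>ps. lmult b (diff q (c \<star> y))) - (\<Sum>(b, c)\<leftarrow>ps. lmult (b \<star> c) (diff q y))"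
      unfolding qs_def lsum[symmetric] S_def[symmetric]
      by (simp only: map_append sum_list_append map_map comp_def case_prod_unfold fst_conv snd_conv list.map sum_list.Cons sum_list.Nil lm add_0_right add_uminus_conv_diff)
    also have "\<dots> = (\<Sum>(b, c)\<leftarrow>ps. lmult b (rmul (diff q c) y))"
      unfolding sum_list_subtractf[symmetric] case_prod_unfold
    proof (intro arg_cong[where f = sum_list] map_cong refl)
      fix p assume "p \<in> set ps"
      then have "snd p \<in> D" using D by blast
      then show "lmult (fst p) (diff q (snd p \<star> y)) - lmult (fst p \<star> snd p) (diff q y) = lmult (fst p) (rmul (diff q (snd p)) y)"
        by (simp only: leib lm)
    qed
    also have "\<dots> = rmul (\<Sum>(b, c)\<leftarrow>ps. lmult b (diff q c)) y"
      by (simp only: rmul_sum_list_left case_prod_unfold rmul_lmult)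
    also have "\<dots> = 0" unfolding ps(2) using rmul_linear(2)[of 0 0 y] by (simp add: fun_eq_iff zero_fun_def)
    finally show ?thesis .
  qed
  have "(\<Sum>(b, c)\<leftarrow>ps. rmul (lmult x (diff q b)) (rmul (diff q c) y s) t) = x \<star> (\<Sum>(b, c)\<leftarrow>qs. rmul (diff q b) (XX s \<triangleright> c) t)" for s t
  proof -
    have "(\<Sum>(b, c)\<leftarrow>ps. rmul (lmult x (diff q b)) (rmul (diff q c) y s) t)
        = x \<star> (\<Sum>(b, c)\<leftarrow>ps. rmul (diff q b) (rmul (diff q c) y s) t)"
      unfolding case_prod_unfold rmul_lmult unfolding lmult_def conv_sum_list_right ..
    also have "(\<Sum>(b, c)\<leftarrow>ps. rmul (diff q b) (rmul (diff q c) y s) t)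
        = (\<Sum>(b, c)\<leftarrow>ps. rmul (diff q b) (XX s \<triangleright> (c \<star> y)) t) - (\<Sum>(b, c)\<leftarrow>ps. rmul (rmul (diff q b) c) (XX s \<triangleright> y) t)"
      unfolding sum_list_subtractf[symmetric] case_prod_unfold
    proof (intro arg_cong[where f = sum_list] map_cong refl)
      fix p assume "p \<in> set ps"
      then have Dp: "fst p \<in> D" "snd p \<in> D" using D by blast+
      have r: "rmul \<omega> (c - d) t = rmul \<omega> c t - rmul \<omega> d t" for \<omega> c d
        using fun_cong[OF rmul_linear(3)[of \<omega> "c - d" d], of t] by simp
      have "rmul (diff q (snd p)) y s = (XX s \<triangleright> (snd p \<star> y)) - snd p \<star> (XX s \<triangleright> y)"
        unfolding leib[OF Dp(2)] by (simp only: minus_apply diff_def lmult_def)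
      then show "rmul (diff q (fst p)) (rmul (diff q (snd p)) y s) t = rmul (diff q (fst p)) (XX s \<triangleright> (snd p \<star> y)) t - rmul (rmul (diff q (fst p)) (snd p)) (XX s \<triangleright> y) t"
        using Dp y by (simp only: r rmul_rm act_Uq_dual)
    qed
    also have "(\<Sum>(b, c)\<leftarrow>ps. rmul (rmul (diff q b) c) (XX s \<triangleright> y) t) = rmul (diff q S) (XX s \<triangleright> y) t"
    proof -
      have "(\<Sum>(b, c)\<leftarrow>ps. rmul (diff q b) c) = (\<Sum>(b, c)\<leftarrow>ps. diff q (b \<star> c)) - (\<Sum>(b, c)\<leftarrow>ps. lmult b (diff q c))"
        unfolding sum_list_subtractf[symmetric] case_prod_unfold
      proof (intro arg_cong[where f = sum_list] map_cong refl)
        fix p assume "p \<in> set ps"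
        then have "fst p \<in> D" "snd p \<in> D" using D by blast+
        then show "rmul (diff q (fst p)) (snd p) = diff q (fst p \<star> snd p) - lmult (fst p) (diff q (snd p))"
          by (simp add: diff_conv)
      qed
      also have "\<dots> = diff q S"
        unfolding ps(2) S_def by (rule ext) (simp only: diff_def act_sum_list sum_list_fun_apply case_prod_unfold diff_zero)
      finally have "rmul (diff q S) (XX s \<triangleright> y) t = rmul (\<Sum>(b, c)\<leftarrow>ps. rmul (diff q b) c) (XX s \<triangleright> y) t" by simp
      then show ?thesis by (simp only: rmul_sum_list_left sum_list_fun_apply case_prod_unfold)
    qed
    also have "(\<Sum>(b, c)\<leftarrow>ps. rmul (diff q b) (XX s \<triangleright> (c \<star> y)) t) - rmul (diff q S) (XX s \<triangleright> y) t = (\<Sum>(b, c)\<leftarrow>qs. rmul (diff q b) (XX s \<triangleright> c) t)"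
    proof -
      have "rmul (diff q (- S)) c t = - rmul (diff q S) c t" for c
      proof -
        have "diff q (- S) = (\<lambda>r. csc (-1) (diff q S r))" using act_linear(2)[of _ "-1" S] by (simp add: diff_def csc_def fun_Compl_def del: Xvec.simps)
        then show ?thesis by (simp only: rmul_linear) (simp add: csc_def fun_Compl_def)
      qed
      then show ?thesis unfolding qs_def
        by (simp only: map_append sum_list_append map_map comp_def case_prod_unfold fst_conv snd_conv list.map sum_list.Cons sum_list.Nil add_0_right add_uminus_conv_diff)
    qed
    finally show ?thesis .
  qed
  then have "(\<Sum>(b, c)\<leftarrow>ps. rmul (lmult x (diff q b)) (rmul (diff q c) y s) t) Y = (-1) * (x \<star> (\<Sum>(b, c)\<leftarrow>qs. b \<star> (XX t \<triangleright> (XX s \<triangleright> c)))) Y" for s t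
    unfolding prolongation_sum[OF qs1 qs2] by simp
  then show ?thesis using W_scale[OF prolongation_W[OF qs1 qs2, of x Y], of "-1"] by (simp only:)
qed

text \<open>Linear and balancing relations are mapped to 0, prolongation relations into W at every
  word Y; multiples of degree other than 2 are killed by the default in
  \<open>word_form\<close>.\<close>

lemma tensor_form_Omega_ideal: assumes "x \<in> Omega_ideal q" shows "(\<lambda>t s. tensor_form x t s Y) \<in> W"
proof -
  let ?T = "{x. \<forall>Y. (\<lambda>t s. tensor_form x t s Y) \<in> W}"
  have "flin.span {mon u * s * mon v |u s v. set (letters u) \<subseteq> Forms1 \<and> s \<in> Omega_rels \<and> set (letters v) \<subseteq> Forms1} \<subseteq> ?T"
  proof (rule flin.span_minimal)
    show "flin.subspace ?T"
      unfolding flin.subspace_def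
    proof (intro conjI ballI allI)
      show "0 \<in> ?T" using W_zero by (simp add: tensor_form_linear zero_fun_def)
      show "x + y \<in> ?T" if xy: "x \<in> ?T" "y \<in> ?T" for x y
      proof (intro CollectI allI)
        fix Y
        have "(\<lambda>t s. tensor_form x t s Y) + (\<lambda>t s. tensor_form y t s Y) \<in> W" using xy by (intro W_add) auto
        then show "(\<lambda>t s. tensor_form (x + y) t s Y) \<in> W" by (simp add: tensor_form_linear plus_fun_def)
      qed
      show "fscale c x \<in> ?T" if x: "x \<in> ?T" for x c
      proof (intro CollectI allI)
        fix Y
        have "(\<lambda>t s. c * tensor_form x t s Y) \<in> W" using x by (intro W_scale) auto
        then show "(\<lambda>t s. tensor_form (fscale c x) t s Y) \<in> W" by (simp add: tensor_form_linear)
      qed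
    qed
    show "{mon u * s * mon v |u s v. set (letters u) \<subseteq> Forms1 \<and> s \<in> Omega_rels \<and> set (letters v) \<subseteq> Forms1} \<subseteq> ?T"
    proof clarify
      fix u s v Y assume s: "s \<in> Omega_rels"
      have Th: "(\<lambda>t s'. tensor_form (mon u * s * mon v) t s' Y) = (\<lambda>t s'. lsum (\<lambda>k. word_form (letters u @ letters k @ letters v) t s' Y) s)"
        by (simp add: tensor_form_def lsum_mult)
      have zero: "(\<lambda>t s'. 0) \<in> W" using W_zero by (simp add: zero_fun_def)
      have pairs: "length (letters u @ [x, y] @ letters v) \<noteq> 2" if "\<not> (letters u = [] \<and> letters v = [])" for x y :: form1 using that by auto
      from s consider (add) x y where "s = lett (x + y) - lett x - lett y" | (scale) c x where "s = lett (\<lambda>r. csc c (x r)) - fscale c (lett x)"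
        | (bal) "s \<in> balance_rels q" | (pro) "s \<in> prolongation_rels q" unfolding lin_rels_def by blast
      then show "(\<lambda>t s'. tensor_form (mon u * s * mon v) t s' Y) \<in> W"
      proof cases
        case add
        have "(\<lambda>t s'. tensor_form (mon u * s * mon v) t s' Y) = (\<lambda>t s'. 0)" unfolding Th unfolding add by (intro ext) (simp add: word_form_add)
        then show ?thesis using zero by simp
      next
        case scale
        have "(\<lambda>t s'. tensor_form (mon u * s * mon v) t s' Y) = (\<lambda>t s'. 0)" unfolding Th unfolding scale by (intro ext) (simp add: word_form_scale)
        then show ?thesis using zero by simp
      next
        case bal
        then obtain \<omega> b \<eta> where w: "\<omega> \<in> Forms1" "b \<in> BB" "\<eta> \<in> Forms1" and s: "s = lett (rmult q \<omega> b) * lett \<eta> - lett \<omega> * lett (lmult b \<eta>)"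
          by (auto simp: balance_rels_def Omega1_eq)
        have "(\<lambda>t s'. tensor_form (mon u * s * mon v) t s' Y) = (\<lambda>t s'. 0)"
        proof (cases "letters u = [] \<and> letters v = []")
          case True
          then show ?thesis unfolding Th unfolding s lett_mult
            using w B_A Forms1_D by (intro ext) (simp add: rmult_eq rmul_rm lmult_def)
        next
          case False
          then show ?thesis unfolding Th unfolding s lett_mult using word_form_length[OF pairs] by (intro ext) simp
        qed
        then show ?thesis using zero by simp
      next
        case pro
        then obtain ps x y where ps: "set ps \<subseteq> BB \<times> BB" "(\<Sum>(b, c)\<leftarrow>ps. lmult b (diff q c)) = 0" and xy: "x \<in> BB" "y \<in> BB"
          and s: "s = (\<Sum>(b, c)\<leftarrow>ps. lett (lmult x (diff q b)) * lett (rmult q (diff q c) y))"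
          unfolding prolongation_rels_def by blast
        have eq: "(\<lambda>t s'. tensor_form (mon u * s * mon v) t s' Y) =
            (\<lambda>t s'. \<Sum>p\<leftarrow>ps. word_form (letters u @ [lmult x (diff q (fst p)), rmult q (diff q (snd p)) y] @ letters v) t s' Y)"
          unfolding Th unfolding s lsum_sum_list by (simp add: case_prod_unfold lett_mult)
        show ?thesis
        proof (cases "letters u = [] \<and> letters v = []")
          case True
          have "(\<lambda>t s'. tensor_form (mon u * s * mon v) t s' Y) = (\<lambda>t s. (\<Sum>(b, c)\<leftarrow>ps. rmul (lmult x (diff q b)) (rmul (diff q c) y s) t) Y)"
            unfolding eq using True rmult_eq[OF B_A[OF xy(2)]]
            by (intro ext) (simp add: sum_list_fun_apply case_prod_unfold)
          then show ?thesis using tensor_form_prolongation[OF ps xy] by simp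
        next
          case False
          then have "(\<lambda>t s'. tensor_form (mon u * s * mon v) t s' Y) = (\<lambda>t s'. 0)"
            unfolding eq using word_form_length[OF pairs] by (intro ext) simp
          then show ?thesis using zero by simp
        qed
      qed
    qed
  qed
  then show ?thesis using assms unfolding Omega_ideal_eq ideal_gen_def by blast
qed

definition Forms2 :: "form2 set" where "Forms2 = {m. \<forall>t s. m t s \<in> Aw (wt t + wt s)}"

text \<open>Only the second tensor factor is rebuilt, as S(x) dy; S(x) is absorbed into the first
  factor by right multiplication, and its weight \<open>- wt s\<close> is what makes the result a
  member of \<open>Forms1\<close>.\<close>

definition lift_form :: "form2 \<Rightarrow> form1 free_alg"
  where "lift_form m = (\<Sum>s\<leftarrow>all_rvecs. \<Sum>p\<leftarrow>dual_coproduct s. lett (rmul (\<lambda>t. m t s) (antip (fst p))) * lett (diff q (snd p)))"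

lemma lift_form_letters:
  assumes "m \<in> Forms2" "p \<in> set (dual_coproduct s)"
  shows "rmul (\<lambda>t. m t s) (antip (fst p)) \<in> Forms1" "diff q (snd p) \<in> Forms1"
proof -
  have "antip (fst p) \<in> Aw (- wt s)" "snd p \<in> BB" using dual_coproduct(3,4)[of "fst p" "snd p" s] assms(2) by simp_all
  then show "rmul (\<lambda>t. m t s) (antip (fst p)) \<in> Forms1" "diff q (snd p) \<in> Forms1"
    using rmul_Aw[of "\<lambda>t. m t s" "wt s" "antip (fst p)" "- wt s"] assms(1) Forms1_diff by (simp_all add: Forms1_def Forms2_def)
qed

lemma lift_form_deg: "m \<in> Forms2 \<Longrightarrow> lift_form m \<in> words_deg Forms1 2"
  unfolding lift_form_def by (intro words_deg_sum_list words_deg_lett2 lift_form_letters)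

lemma lin_SO: "lin_rels (\<lambda>c \<omega> r. csc c (\<omega> r)) Forms1 \<subseteq> Omega_rels" by blast

text \<open>Letters are additive only modulo the ideal, so \<open>lift_form\<close> is linear as a
  map into the quotient.\<close>

lemma lift_form_add: assumes "m \<in> Forms2" "n \<in> Forms2" shows "O.cong (lift_form (\<lambda>t s. m t s + n t s)) (lift_form m + lift_form n)"
  unfolding lift_form_def sum_list_addf[symmetric]
proof (intro O.cong_sum_list)
  fix s p assume p: "p \<in> set (dual_coproduct s)"
  let ?r = "\<lambda>m. rmul (\<lambda>t. m t s) (antip (fst p))" and ?d = "lett (diff q (snd p))"
  have "(\<lambda>t. m t s + n t s) = (\<lambda>t. m t s) + (\<lambda>t. n t s)" by (rule ext) simp
  then have "?r (\<lambda>t s. m t s + n t s) = ?r m + ?r n" by (simp only: rmul_linear)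
  then have "O.cong (lett (?r (\<lambda>t s. m t s + n t s)) * ?d) ((lett (?r m) + lett (?r n)) * ?d)"
    using cong_lett_add[OF lin_SO lift_form_letters(1)[OF assms(1) p] lift_form_letters(1)[OF assms(2) p]] lift_form_letters(2)[OF assms(1) p]
    by (intro O.cong_lett_right) (simp_all only:)
  then show "O.cong (lett (?r (\<lambda>t s. m t s + n t s)) * ?d) (lett (?r m) * ?d + lett (?r n) * ?d)" by (simp only: distrib_right)
qed

lemma lift_form_scale: assumes "m \<in> Forms2" shows "O.cong (lift_form (\<lambda>t s. csc c (m t s))) (fscale c (lift_form m))"
proof -
  have fs: "fscale c (\<Sum>i\<leftarrow>is. f i) = (\<Sum>i\<leftarrow>is. fscale c (f i))" for f :: "'i \<Rightarrow> form1 free_alg" and "is"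
    by (induction "is") (simp_all add: flin.scale_right_distrib)
  show ?thesis unfolding lift_form_def fs
  proof (intro O.cong_sum_list)
    fix s p assume p: "p \<in> set (dual_coproduct s)"
    let ?r = "\<lambda>m. rmul (\<lambda>t. m t s) (antip (fst p))" and ?d = "lett (diff q (snd p))"
    have "?r (\<lambda>t s. csc c (m t s)) = (\<lambda>r. csc c (?r m r))" by (simp only: rmul_linear)
    then have "O.cong (lett (?r (\<lambda>t s. csc c (m t s))) * ?d) (fscale c (lett (?r m)) * ?d)"
      using cong_lett_scale[OF lin_SO lift_form_letters(1)[OF assms p]] lift_form_letters(2)[OF assms p]
      by (intro O.cong_lett_right) (simp_all only:)
    then show "O.cong (lett (?r (\<lambda>t s. csc c (m t s))) * ?d) (fscale c (lett (?r m) * ?d))" by (simp only: O.fscale_mult_left)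
  qed
qed

lemma Forms2_zero: "(\<lambda>t s. 0) \<in> Forms2" using fn.subspace_0[OF subspace_Aw] by (simp add: Forms2_def)
lemma Forms2_add: "m \<in> Forms2 \<Longrightarrow> n \<in> Forms2 \<Longrightarrow> (\<lambda>t s. m t s + n t s) \<in> Forms2" using fn.subspace_add[OF subspace_Aw] by (simp add: Forms2_def)
lemma Forms2_scale: "m \<in> Forms2 \<Longrightarrow> (\<lambda>t s. csc c (m t s)) \<in> Forms2" using fn.subspace_scale[OF subspace_Aw] by (simp add: Forms2_def)

lemma lift_form_zero: "lift_form (\<lambda>t s. 0) \<in> O.J"
  using lift_form_scale[OF Forms2_zero, of 0] by (simp add: O.cong_def)

lemma lift_form_sum:
  assumes "finite A" "\<And>i. i \<in> A \<Longrightarrow> m i \<in> Forms2"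
  shows "O.cong (lift_form (\<lambda>t s. \<Sum>i\<in>A. m i t s)) (\<Sum>i\<in>A. lift_form (m i)) \<and> (\<lambda>t s. \<Sum>i\<in>A. m i t s) \<in> Forms2"
  using assms
proof (induction A rule: finite_induct)
  case empty
  show ?case using lift_form_zero Forms2_zero by (simp only: sum.empty O.cong_def diff_zero simp_thms)
next
  case (insert i A)
  then have IH: "O.cong (lift_form (\<lambda>t s. \<Sum>i\<in>A. m i t s)) (\<Sum>i\<in>A. lift_form (m i))" "(\<lambda>t s. \<Sum>i\<in>A. m i t s) \<in> Forms2" and mi: "m i \<in> Forms2" by blast+
  have "O.cong (lift_form (\<lambda>t s. m i t s + (\<Sum>i\<in>A. m i t s))) (lift_form (m i) + lift_form (\<lambda>t s. \<Sum>i\<in>A. m i t s))"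
    by (rule lift_form_add[OF mi IH(2)])
  also have "O.cong \<dots> (lift_form (m i) + (\<Sum>i\<in>A. lift_form (m i)))" by (intro O.cong_add O.cong_refl IH)
  finally have 1: "O.cong (lift_form (\<lambda>t s. m i t s + (\<Sum>i\<in>A. m i t s))) (lift_form (m i) + (\<Sum>i\<in>A. lift_form (m i)))" .
  have 2: "(\<lambda>t s. m i t s + (\<Sum>i\<in>A. m i t s)) \<in> Forms2" by (rule Forms2_add[OF mi IH(2)])
  show ?case using insert.hyps 1 2 by (simp only: sum.insert not_False_eq_True simp_thms)
qed

lemma Th2_M2: assumes "\<omega> \<in> Forms1" "\<eta> \<in> Forms1" shows "(\<lambda>t s. rmul \<omega> (\<eta> s) t) \<in> Forms2"
proof -
  have "rmul \<omega> (\<eta> s) t \<in> Aw (wt t + (0 + wt s))" for t s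
    using assms by (intro rmul_Aw) (simp_all add: Forms1_def)
  then show ?thesis by (simp add: Forms2_def)
qed

text \<open>Expand \<eta> by \<open>form1_decomp\<close> and carry its coefficients, which lie in B,
  across the tensor sign by the balancing relations.\<close>

lemma lett_lett_reduce: assumes "\<omega> \<in> Forms1" "\<eta> \<in> Forms1" shows "O.cong (lett \<omega> * lett \<eta>) (lift_form (\<lambda>t s. rmul \<omega> (\<eta> s) t))"
proof -
  let ?g = "\<lambda>s p. lmult (\<eta> s \<star> antip (fst p)) (diff q (snd p))"
  have B: "\<eta> s \<star> antip (fst p) \<in> BB" "snd p \<in> BB" if "p \<in> set (dual_coproduct s)" for s p
  proof -
    have p: "(fst p, snd p) \<in> set (dual_coproduct s)" using that by simp
    show "\<eta> s \<star> antip (fst p) \<in> BB" using assms(2) by (intro Aw_antip_B[OF _ p]) (simp add: Forms1_def)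
    show "snd p \<in> BB" by (rule dual_coproduct(4)[OF p])
  qed
  have g: "?g s p \<in> Forms1" if "p \<in> set (dual_coproduct s)" for s p
    using B[OF that] by (intro Forms1_lmult Forms1_diff)
  have inner: "O.cong (lett (\<Sum>p\<leftarrow>dual_coproduct s. ?g s p)) (\<Sum>p\<leftarrow>dual_coproduct s. lett (?g s p)) \<and> (\<Sum>p\<leftarrow>dual_coproduct s. ?g s p) \<in> Forms1" for s
    using g by (intro cong_lett_sum_list[OF lin_SO Forms1_zero Forms1_add])
  have "O.cong (lett (\<Sum>s\<leftarrow>all_rvecs. \<Sum>p\<leftarrow>dual_coproduct s. ?g s p)) (\<Sum>s\<leftarrow>all_rvecs. lett (\<Sum>p\<leftarrow>dual_coproduct s. ?g s p))"
    using inner by (intro cong_lett_sum_list[OF lin_SO Forms1_zero Forms1_add, THEN conjunct1]) blast+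
  also have "O.cong \<dots> (\<Sum>s\<leftarrow>all_rvecs. \<Sum>p\<leftarrow>dual_coproduct s. lett (?g s p))"
    using inner by (intro O.cong_sum_list) blast
  finally have "O.cong (lett \<eta>) (\<Sum>s\<leftarrow>all_rvecs. \<Sum>p\<leftarrow>dual_coproduct s. lett (?g s p))"
    using form1_decomp[of \<eta>] by (simp only: case_prod_unfold)
  then have "O.cong (lett \<omega> * lett \<eta>) (lett \<omega> * (\<Sum>s\<leftarrow>all_rvecs. \<Sum>p\<leftarrow>dual_coproduct s. lett (?g s p)))"
    using assms(1) by (rule O.cong_lett_left)
  also have "\<dots> = (\<Sum>s\<leftarrow>all_rvecs. \<Sum>p\<leftarrow>dual_coproduct s. lett \<omega> * lett (?g s p))"
    by (simp only: sum_list_const_mult[symmetric])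
  also have "O.cong \<dots> (lift_form (\<lambda>t s. rmul \<omega> (\<eta> s) t))"
    unfolding lift_form_def
  proof (intro O.cong_sum_list)
    fix s p assume p: "p \<in> set (dual_coproduct s)"
    have J1: "lett (rmult q \<omega> (\<eta> s \<star> antip (fst p))) * lett (diff q (snd p)) - lett \<omega> * lett (?g s p) \<in> O.J"
      using assms(1) B[OF p] Forms1_diff by (intro O.J_base) (auto simp: balance_rels_def Omega1_eq)
    have eq1: "rmult q \<omega> (\<eta> s \<star> antip (fst p)) = rmul (\<lambda>t. rmul \<omega> (\<eta> s) t) (antip (fst p))"
    proof -
      have "fst p \<in> AA" using dual_coproduct(2)[of "fst p" "snd p" s] p by simp
      then show ?thesis using B[OF p] Forms1_D[OF assms(2)] by (simp add: rmult_eq[OF B_A] rmul_rm)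
    qed
    show "O.cong (lett \<omega> * lett (?g s p)) (lett (rmul (\<lambda>t. rmul \<omega> (\<eta> s) t) (antip (fst p))) * lett (diff q (snd p)))"
      by (rule O.cong_sym) (use J1[unfolded eq1] in \<open>unfold O.cong_def\<close>)
  qed
  finally show ?thesis .
qed

lemma tensor_form_reduce:
  assumes "x \<in> words_deg Forms1 2"
  shows "O.cong x (lift_form (tensor_form x))" "tensor_form x \<in> Forms2"
proof -
  let ?c = "Poly_Mapping.lookup x" and ?k = "Poly_Mapping.keys x"
  have w: "O.cong (mon w) (lift_form (word_form (letters w)))" "word_form (letters w) \<in> Forms2" if wk: "w \<in> ?k" for w
  proof -
    obtain a b where "w = Word [a, b]" "a \<in> Forms1" "b \<in> Forms1" using words_deg_2_induct(2)[OF assms wk] by blast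
    then show "O.cong (mon w) (lift_form (word_form (letters w)))" "word_form (letters w) \<in> Forms2"
      using lett_lett_reduce[of a b] Th2_M2[of a b] by (simp_all add: lett_mult)
  qed
  have Th: "tensor_form x = (\<lambda>t s. \<Sum>w\<in>?k. csc (?c w) (word_form (letters w) t s))"
    by (simp add: fun_eq_iff tensor_form_def lsum_def)
  have S: "O.cong (lift_form (tensor_form x)) (\<Sum>w\<in>?k. lift_form (\<lambda>t s. csc (?c w) (word_form (letters w) t s))) \<and> tensor_form x \<in> Forms2"
    unfolding Th using w(2) by (intro lift_form_sum Forms2_scale) simp_all
  then show "tensor_form x \<in> Forms2" by blast
  have "O.cong (\<Sum>w\<in>?k. fscale (?c w) (mon w)) (\<Sum>w\<in>?k. fscale (?c w) (lift_form (word_form (letters w))))"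
    using w(1) by (intro O.cong_sum O.cong_scale)
  also have "O.cong \<dots> (\<Sum>w\<in>?k. lift_form (\<lambda>t s. csc (?c w) (word_form (letters w) t s)))"
    using w(2) by (intro O.cong_sum O.cong_sym[OF lift_form_scale])
  also have "O.cong \<dots> (lift_form (tensor_form x))" by (rule O.cong_sym[OF conjunct1[OF S]])
  finally show "O.cong x (lift_form (tensor_form x))" using words_deg_2_induct(1)[OF assms] by simp
qed

text \<open>S(x) and dy recombine by \<open>dual_antipode\<close>. Together with
  \<open>tensor_form_reduce\<close> this makes the two maps inverse to each other in degree 2,
  modulo the ideal on one side.\<close>

lemma tensor_form_Pm: assumes "m \<in> Forms2" shows "tensor_form (lift_form m) = m"
proof (intro ext)
  fix t s Y
  have "tensor_form (lift_form m) t s = (\<Sum>s'\<leftarrow>all_rvecs. \<Sum>p\<leftarrow>dual_coproduct s'. rmul (rmul (\<lambda>t. m t s') (antip (fst p))) (XX s \<triangleright> snd p) t)"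
    unfolding lift_form_def tensor_form_sum_list tensor_form_lett2 diff_def ..
  also have "\<dots> = (\<Sum>s'\<leftarrow>all_rvecs. rmul (\<lambda>t. m t s') (\<Sum>(x, y)\<leftarrow>dual_coproduct s'. unit \<star> antip x \<star> (XX s \<triangleright> y)) t)"
  proof (intro arg_cong[where f = sum_list] map_cong refl)
    fix s'
    have "(\<Sum>p\<leftarrow>dual_coproduct s'. rmul (rmul (\<lambda>t. m t s') (antip (fst p))) (XX s \<triangleright> snd p) t)
       = (\<Sum>p\<leftarrow>dual_coproduct s'. rmul (\<lambda>t. m t s') (antip (fst p) \<star> (XX s \<triangleright> snd p)) t)"
    proof (intro arg_cong[where f = sum_list] map_cong refl)
      fix p assume "p \<in> set (dual_coproduct s')"
      then have "(fst p, snd p) \<in> set (dual_coproduct s')" by simp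
      then have "fst p \<in> AA" "snd p \<in> AA" using dual_coproduct(2,4) B_A by blast+
      then show "rmul (rmul (\<lambda>t. m t s') (antip (fst p))) (XX s \<triangleright> snd p) t = rmul (\<lambda>t. m t s') (antip (fst p) \<star> (XX s \<triangleright> snd p)) t"
        by (simp add: rmul_rm del: Xvec.simps)
    qed
    then show "(\<Sum>p\<leftarrow>dual_coproduct s'. rmul (rmul (\<lambda>t. m t s') (antip (fst p))) (XX s \<triangleright> snd p) t)
       = rmul (\<lambda>t. m t s') (\<Sum>(x, y)\<leftarrow>dual_coproduct s'. unit \<star> antip x \<star> (XX s \<triangleright> y)) t"
      by (simp only: rmul_sum_list_right sum_list_fun_apply case_prod_unfold unit_conv)
  qed
  also have "\<dots> = (\<Sum>s'\<in>UNIV. if s' = s then m t s' else 0)"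
    unfolding dual_antipode sum_all_rvecs
  proof (intro sum.cong refl)
    fix s'
    have "rmul (\<lambda>t. m t s') 0 t = 0" using fun_cong[OF rmul_linear(4)[of "\<lambda>t. m t s'" 0 0], of t] by simp
    then show "rmul (\<lambda>t. m t s') (if s' = s then unit else 0) t = (if s' = s then m t s' else 0)" by simp
  qed
  also have "\<dots> = m t s" by (simp only: sum.delta finite_rvec if_True UNIV_I)
  finally show "tensor_form (lift_form m) t s Y = m t s Y" by simp
qed

text \<open>The prolongation relation obtained from \<open>\<Sum> a S(z\<^sub>(\<^sub>1\<^sub>)) d z\<^sub>(\<^sub>2\<^sub>) = 0\<close>.\<close>

lemma lift_form_cot_ideal:
  assumes a: "a \<in> Aw \<mu>" and z: "z \<in> cot_ideal q" "z = 0 \<or> homA \<mu> 0 z"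
  shows "lift_form (\<lambda>t s. csc (mat z t s) a) \<in> O.J" "(\<lambda>t s. csc (mat z t s) a) \<in> Forms2"
proof -
  show Forms2: "(\<lambda>t s. csc (mat z t s) a) \<in> Forms2"
  proof -
    have "csc (mat z t s) a \<in> Aw (wt t + wt s)" for t s
    proof (cases "mat z t s = 0")
      case True
      then show ?thesis using fn.subspace_0[OF subspace_Aw] by simp
    next
      case False
      then have "wt t + wt s = \<mu>" using z(2) mat_weight[of \<mu> z t s] by (auto simp: mat_linear)
      then show ?thesis using fn.subspace_scale[OF subspace_Aw a] by simp
    qed
    then show ?thesis by (simp add: Forms2_def)
  qed
  from z(2) show "lift_form (\<lambda>t s. csc (mat z t s) a) \<in> O.J"
  proof
    assume "z = 0"
    then show ?thesis using lift_form_zero by (simp add: mat_linear)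
  next
    assume h: "homA \<mu> 0 z"
    then obtain ps where ps: "coproduct_rep z ps" "\<forall>(x, y)\<in>set ps. \<exists>\<kappa>. homA \<mu> \<kappa> x \<and> homA \<kappa> 0 y" using homA_sweedler by blast
    define qs where "qs = map (\<lambda>p. (a \<star> antip (fst p), snd p)) ps"
    have zD: "z \<in> D" using homA_Uq_dual[OF h] .
    have qs1: "set qs \<subseteq> BB \<times> BB"
    proof -
      have "a \<star> antip (fst p) \<in> BB \<and> snd p \<in> BB" if p: "p \<in> set ps" for p
      proof -
        have "case p of (x, y) \<Rightarrow> \<exists>\<kappa>. homA \<mu> \<kappa> x \<and> homA \<kappa> 0 y" using ps(2) p by blast
        then obtain \<kappa> where k: "homA \<mu> \<kappa> (fst p)" "homA \<kappa> 0 (snd p)" unfolding case_prod_unfold by blast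
        have "a \<star> antip (fst p) \<in> Aw (\<mu> + (- \<mu>))" by (intro Aw_conv a homA_Aw[OF homA_antip[OF k(1)]])
        then show ?thesis using homA_Aw[OF k(2)] by (simp add: B_eq)
      qed
      then show ?thesis unfolding qs_def by auto
    qed
    have key: "(\<Sum>(b, c)\<leftarrow>qs. b \<star> (X \<triangleright> c)) = csc (pair X z) a" for X
      using antipode_X[OF zD ps(1), of a X] unfolding qs_def
      by (simp only: case_prod_unfold map_map comp_def fst_conv snd_conv)
    have qs2: "(\<Sum>(b, c)\<leftarrow>qs. lmult b (diff q c)) = 0"
    proof
      fix r
      have "(\<Sum>(b, c)\<leftarrow>qs. lmult b (diff q c)) r = (\<Sum>(b, c)\<leftarrow>qs. b \<star> (XX r \<triangleright> c))"
        by (simp only: sum_list_fun_apply case_prod_unfold lmult_def diff_def)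
      then show "(\<Sum>(b, c)\<leftarrow>qs. lmult b (diff q c)) r = 0 r"
        using z(1) unfolding key by (simp add: cot_ideal_iff act_apply_0 del: Xvec.simps)
    qed
    define R where "R = (\<Sum>(b, c)\<leftarrow>qs. lett (lmult unit (diff q b)) * lett (rmult q (diff q c) unit))"
    have "R \<in> prolongation_rels q"
      unfolding prolongation_rels_def R_def using qs1 qs2 B_unit by blast
    then have RJ: "R \<in> O.J" by (intro O.J_base) blast
    have lm: "lmult unit \<omega> = \<omega>" for \<omega> by (simp add: lmult_def)
    have R: "R = (\<Sum>p\<leftarrow>qs. lett (diff q (fst p)) * lett (diff q (snd p)))"
      unfolding R_def case_prod_unfold lm rmult_eq[OF A_unit] rmul_unit ..
    have "R \<in> words_deg Forms1 2"
      unfolding R using qs1 by (intro words_deg_sum_list words_deg_lett2 Forms1_diff) auto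
    then have "O.cong R (lift_form (tensor_form R))" by (rule tensor_form_reduce)
    \<comment> \<open>The sign is the one in \<open>prolongation_sum\<close>; multiplying by -1 once
      more removes it at the end.\<close>
    moreover have "tensor_form R = (\<lambda>t s. csc (-1) (csc (mat z t s) a))"
    proof (intro ext)
      fix t s Y
      have "tensor_form R t s = (\<Sum>(b, c)\<leftarrow>qs. rmul (diff q b) (XX s \<triangleright> c) t)"
        unfolding R tensor_form_sum_list tensor_form_lett2 case_prod_unfold diff_def[of q "snd _"] ..
      also have "\<dots> = - (\<Sum>(b, c)\<leftarrow>qs. b \<star> (XX t \<triangleright> (XX s \<triangleright> c)))" by (rule prolongation_sum[OF qs1 qs2])
      also have "\<dots> = - csc (mat z t s) a"
        using key[of "XX t * XX s"] by (simp only: act_mult mat_def act_apply_0[symmetric])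
      finally show "tensor_form R t s Y = csc (-1) (csc (mat z t s) a) Y" by simp
    qed
    ultimately have "O.cong R (lift_form (\<lambda>t s. csc (-1) (csc (mat z t s) a)))" by (simp only:)
    from O.cong_trans[OF this lift_form_scale[OF Forms2]] have "fscale (-1) (lift_form (\<lambda>t s. csc (mat z t s) a)) \<in> O.J"
      using RJ O.cong_mem by blast
    then have "fscale (-1) (fscale (-1) (lift_form (\<lambda>t s. csc (mat z t s) a))) \<in> O.J" by (rule O.J_scale)
    then show ?thesis by simp
  qed
qed

text \<open>\<open>lift_form_cot_ideal\<close> needs a coefficient whose weight matches that of the
  element of I. So m is split by weight, and each part is expanded along a projection onto the
  matrices of W of that weight, with the entries of the part as coefficients.\<close>

lemma lift_form_W:
  assumes m: "m \<in> Forms2" and mW: "\<And>Y. (\<lambda>t s. m t s Y) \<in> W"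
  shows "lift_form m \<in> O.J"
proof -
  let ?I = "range (\<lambda>(t, s). wt t + wt s)"
  have fin: "finite ?I"
  proof -
    have "finite (UNIV :: (rvec \<times> rvec) set)" unfolding UNIV_Times_UNIV[symmetric] by (intro finite_cartesian_product) simp_all
    then show ?thesis by (rule finite_imageI)
  qed
  define pm where "pm \<mu> t s = (if wt t + wt s = \<mu> then m t s else 0)" for \<mu> t s
  have m_sum: "m = (\<lambda>t s. \<Sum>\<mu>\<in>?I. pm \<mu> t s)"
  proof (intro ext)
    fix t s Y
    have "(\<Sum>\<mu>\<in>?I. pm \<mu> t s) = (\<Sum>\<mu>\<in>?I. if \<mu> = wt t + wt s then m t s else 0)"
      by (intro sum.cong refl) (auto simp: pm_def)
    also have "\<dots> = m t s" using fin by (subst sum.delta) auto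
    finally show "m t s Y = (\<Sum>\<mu>\<in>?I. pm \<mu> t s) Y" by simp
  qed
  have part: "lift_form (pm \<mu>) \<in> O.J \<and> pm \<mu> \<in> Forms2" for \<mu>
  proof -
    let ?V = "{v \<in> W. proj \<mu> v = v}"
    have projW: "proj \<mu> v \<in> ?V" if v: "v \<in> W" for v
    proof -
      obtain y where y: "y \<in> cot_ideal q" "v = mat y" using v by (auto simp: W_def)
      then have "proj \<mu> v \<in> W" using W_proj[OF y(1), of \<mu>] by (auto simp: W_def intro: rev_image_eqI)
      then show ?thesis by (auto simp: proj_def fun_eq_iff)
    qed
    have pl: "proj \<mu> (v + w) = proj \<mu> v + proj \<mu> w" "proj \<mu> (\<lambda>t s. c * v t s) = (\<lambda>t s. c * proj \<mu> v t s)" for v w c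
      by (intro ext, simp add: proj_def)+
    have "\<exists>P. (\<forall>t s. P t s \<in> ?V) \<and> (\<forall>v\<in>?V. v = (\<Sum>t\<in>UNIV. \<Sum>s\<in>UNIV. mscale (v t s) (P t s)))"
    proof (rule projection_onto_subspace)
      show "0 \<in> ?V" using W_zero by (simp add: proj_def fun_eq_iff)
      show "v + w \<in> ?V" if "v \<in> ?V" "w \<in> ?V" for v w
        using that W_add[of v w] by (simp only: mem_Collect_eq pl simp_thms)
      show "(\<lambda>t s. c * v t s) \<in> ?V" if "v \<in> ?V" for c v
        using that W_scale[of v c] by (simp only: mem_Collect_eq pl simp_thms)
    qed
    then obtain P where P: "\<And>t s. P t s \<in> ?V" "\<And>v. v \<in> ?V \<Longrightarrow> v = (\<Sum>t\<in>UNIV. \<Sum>s\<in>UNIV. mscale (v t s) (P t s))" by blast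
    \<comment> \<open>One summand for each matrix position: the entry there, times a fixed matrix
      from the weight-\<mu> part of W.\<close>
    define g where "g k = (\<lambda>t s. csc (P (fst k) (snd k) t s) (pm \<mu> (fst k) (snd k)))" for k
    have gJ: "lift_form (g k) \<in> O.J" "g k \<in> Forms2" for k
    proof -
      obtain y where y: "y \<in> cot_ideal q" "P (fst k) (snd k) = mat y" "proj \<mu> (mat y) = mat y"
        using P(1)[of "fst k" "snd k"] by (auto simp: W_def)
      obtain z where z: "z \<in> cot_ideal q" "z = 0 \<or> homA \<mu> 0 z" "mat z = mat y"
        using W_proj[OF y(1), of \<mu>] y(3) by auto
      have "pm \<mu> (fst k) (snd k) \<in> Aw \<mu>"
        using m fn.subspace_0[OF subspace_Aw] by (auto simp: pm_def Forms2_def)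
      from lift_form_cot_ideal[OF this z(1,2)] show "lift_form (g k) \<in> O.J" "g k \<in> Forms2"
        unfolding g_def y(2) z(3) by simp_all
    qed
    have fin2: "finite (UNIV :: (rvec \<times> rvec) set)" unfolding UNIV_Times_UNIV[symmetric] by (intro finite_cartesian_product) simp_all
    have pg: "pm \<mu> = (\<lambda>t s. \<Sum>k\<in>UNIV. g k t s)"
    proof (intro ext)
      fix t s Y
      have "(\<lambda>t s. pm \<mu> t s Y) = proj \<mu> (\<lambda>t s. m t s Y)" by (auto simp: pm_def proj_def fun_eq_iff)
      then have "(\<lambda>t s. pm \<mu> t s Y) \<in> ?V" using projW[OF mW[of Y]] by simp
      from P(2)[OF this] have "pm \<mu> t s Y = (\<Sum>t'\<in>UNIV. \<Sum>s'\<in>UNIV. mscale (pm \<mu> t' s' Y) (P t' s')) t s"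
        by (rule fun_cong[OF fun_cong])
      also have "\<dots> = (\<Sum>t'\<in>UNIV. \<Sum>s'\<in>UNIV. g (t', s') t s Y)"
        by (simp only: sum_fun_apply mscale_def g_def csc_apply fst_conv snd_conv mult.commute)
      also have "\<dots> = (\<Sum>k\<in>UNIV. g k t s Y)"
        unfolding sum.cartesian_product by (simp add: UNIV_Times_UNIV case_prod_unfold)
      finally show "pm \<mu> t s Y = (\<Sum>k\<in>UNIV. g k t s) Y" by simp
    qed
    have "O.cong (lift_form (pm \<mu>)) (\<Sum>k\<in>UNIV. lift_form (g k)) \<and> pm \<mu> \<in> Forms2"
      unfolding pg by (intro lift_form_sum fin2 gJ)
    moreover have "(\<Sum>k\<in>UNIV. lift_form (g k)) \<in> O.J" by (intro flin.subspace_sum O.subspace_J gJ)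
    ultimately show ?thesis using O.cong_mem by blast
  qed
  have "O.cong (lift_form (\<lambda>t s. \<Sum>\<mu>\<in>?I. pm \<mu> t s)) (\<Sum>\<mu>\<in>?I. lift_form (pm \<mu>))" using lift_form_sum[OF fin, of pm] part by blast
  moreover have "(\<Sum>\<mu>\<in>?I. lift_form (pm \<mu>)) \<in> O.J" using part by (intro flin.subspace_sum O.subspace_J) blast
  ultimately have "lift_form (\<lambda>t s. \<Sum>\<mu>\<in>?I. pm \<mu> t s) \<in> O.J" using O.cong_mem by blast
  then show ?thesis by (simp only: m_sum[symmetric])
qed

end

section \<open>Coinvariant two-forms\<close>

lemma sum_list_product2: "(\<Sum>(x, y)\<leftarrow>List.product xs ys. f x y) = (\<Sum>x\<leftarrow>xs. \<Sum>y\<leftarrow>ys. f x y)"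
  for f :: "'a \<Rightarrow> 'b \<Rightarrow> complex"
  by (induction xs) (simp_all add: comp_def)

context quantum_parameter
begin

lemma coact_form:
  assumes "\<omega> \<in> Forms1"
  shows "set (coact_form q \<omega>) \<subseteq> AA \<times> Forms1" "coproduct_rep (\<omega> r) (map (\<lambda>p. (fst p, snd p r)) (coact_form q \<omega>))"
proof -
  let ?P = "\<lambda>ps. set ps \<subseteq> AA \<times> Forms1 \<and> (\<forall>X Y r. \<omega> r (X + Y) = (\<Sum>(a, \<eta>)\<leftarrow>ps. a X * \<eta> r Y))"
  define ps where "ps r = (SOME ps. coproduct_rep (\<omega> r) ps \<and> set ps \<subseteq> AA \<times> Aw (wt r))" for r
  have ps: "coproduct_rep (\<omega> r) (ps r) \<and> set (ps r) \<subseteq> AA \<times> Aw (wt r)" for r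
  proof -
    have "\<omega> r \<in> Aw (wt r)" using assms by (simp add: Forms1_def)
    from someI_ex[OF Aw_sw[OF this]] show ?thesis unfolding ps_def .
  qed
  \<comment> \<open>The coproduct of each coefficient is placed in the slot of its own basis vector,
    so that the concatenated list serves all slots at once.\<close>
  define qs where "qs = concat (map (\<lambda>r. map (\<lambda>p. (fst p, \<lambda>s. if s = r then snd p else 0)) (ps r)) all_rvecs)"
  have "?P qs"
  proof (intro conjI allI)
    show "set qs \<subseteq> AA \<times> Forms1"
    proof
      fix p assume "p \<in> set qs"
      then obtain r x where x: "x \<in> set (ps r)" "p = (fst x, \<lambda>s. if s = r then snd x else 0)" unfolding qs_def by auto
      have "set (ps r) \<subseteq> AA \<times> Aw (wt r)" using ps by blast
      then have "fst x \<in> AA" "snd x \<in> Aw (wt r)" using x(1) by auto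
      then show "p \<in> AA \<times> Forms1" unfolding x(2) Forms1_def using fn.subspace_0[OF subspace_Aw] by simp
    qed
    fix X Y r
    have c: "(\<Sum>p\<leftarrow>concat (map h xs). g p) = (\<Sum>x\<leftarrow>xs. \<Sum>p\<leftarrow>h x. g p)" for h :: "rvec \<Rightarrow> (fnl \<times> form1) list" and g :: "fnl \<times> form1 \<Rightarrow> complex" and xs
      by (induction xs) simp_all
    have "(\<Sum>(a, \<eta>)\<leftarrow>qs. a X * \<eta> r Y) = (\<Sum>r'\<in>UNIV. \<Sum>p\<leftarrow>ps r'. fst p X * (if r = r' then snd p else 0) Y)"
      unfolding qs_def c sum_all_rvecs by (simp only: case_prod_unfold map_map comp_def fst_conv snd_conv)
    also have "\<dots> = (\<Sum>r'\<in>UNIV. if r' = r then (\<Sum>p\<leftarrow>ps r. fst p X * snd p Y) else 0)"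
      by (intro sum.cong refl) auto
    also have "\<dots> = (\<Sum>p\<leftarrow>ps r. fst p X * snd p Y)" by (simp only: sum.delta finite_rvec if_True UNIV_I)
    also have "\<dots> = \<omega> r (X + Y)" using ps[of r] unfolding coproduct_rep_def case_prod_unfold by simp
    finally show "\<omega> r (X + Y) = (\<Sum>(a, \<eta>)\<leftarrow>qs. a X * \<eta> r Y)" ..
  qed
  then have *: "?P (coact_form q \<omega>)" unfolding coact_form_def Omega1_eq by (rule someI)
  then show "set (coact_form q \<omega>) \<subseteq> AA \<times> Forms1" by blast
  show "coproduct_rep (\<omega> r) (map (\<lambda>p. (fst p, snd p r)) (coact_form q \<omega>))"
    using * unfolding coproduct_rep_def by (simp add: comp_def case_prod_unfold)
qed

text \<open>The operators G_rt touch only second legs, so the coproduct of a product of coefficients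
  is the product of the two coactions. Hence \<open>tensor_form\<close> is compatible with the left
  coaction.\<close>

lemma rmul_coact:
  assumes "\<omega> \<in> Forms1" "\<eta> \<in> Forms1"
  shows "rmul \<omega> (\<eta> s) t (X + Y) = (\<Sum>(a, \<omega>')\<leftarrow>coact_form q \<omega>. \<Sum>(b, \<eta>')\<leftarrow>coact_form q \<eta>. (a \<star> b) X * rmul \<omega>' (\<eta>' s) t Y)"
proof -
  let ?A = "coact_form q \<omega>" and ?B = "coact_form q \<eta>"
  have 1: "(\<omega> r \<star> (GG r t \<triangleright> \<eta> s)) (X + Y) = (\<Sum>p\<leftarrow>?A. \<Sum>p'\<leftarrow>?B. (fst p \<star> fst p') X * (snd p r \<star> (GG r t \<triangleright> snd p' s)) Y)" for r
  proof -
    let ?C = "map (\<lambda>p. (fst p, snd p r)) ?A" and ?D = "map (\<lambda>(x, y). (x, GG r t \<triangleright> y)) (map (\<lambda>p. (fst p, snd p s)) ?B)"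
    have "coproduct_rep (\<omega> r \<star> (GG r t \<triangleright> \<eta> s)) (map (\<lambda>((x, y), (x', y')). (x \<star> x', y \<star> y')) (List.product ?C ?D))"
      by (intro coproduct_rep_conv coproduct_rep_act_right coact_form(2) assms)
    then have "(\<omega> r \<star> (GG r t \<triangleright> \<eta> s)) (X + Y) = (\<Sum>(p, p')\<leftarrow>List.product ?C ?D. (fst p \<star> fst p') X * (snd p \<star> snd p') Y)"
      unfolding coproduct_rep_def by (simp add: comp_def case_prod_unfold)
    also have "\<dots> = (\<Sum>p\<leftarrow>?C. \<Sum>p'\<leftarrow>?D. (fst p \<star> fst p') X * (snd p \<star> snd p') Y)" by (rule sum_list_product2)
    finally show ?thesis by (simp only: map_map comp_def case_prod_unfold fst_conv snd_conv)
  qed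
  have "rmul \<omega> (\<eta> s) t (X + Y) = (\<Sum>r\<leftarrow>all_rvecs. \<Sum>p\<leftarrow>?A. \<Sum>p'\<leftarrow>?B. (fst p \<star> fst p') X * (snd p r \<star> (GG r t \<triangleright> snd p' s)) Y)"
    unfolding rmul_def sum_fun_apply 1 sum_all_rvecs ..
  also have "\<dots> = (\<Sum>p\<leftarrow>?A. \<Sum>p'\<leftarrow>?B. \<Sum>r\<leftarrow>all_rvecs. (fst p \<star> fst p') X * (snd p r \<star> (GG r t \<triangleright> snd p' s)) Y)"
    by (simp only: sum_list_swap[where xs = all_rvecs and ys = ?A] sum_list_swap[where xs = all_rvecs and ys = ?B])
  also have "\<dots> = (\<Sum>p\<leftarrow>?A. \<Sum>p'\<leftarrow>?B. (fst p \<star> fst p') X * rmul (snd p) (snd p' s) t Y)"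
    unfolding rmul_def sum_fun_apply sum_all_rvecs sum_distrib_left ..
  finally show ?thesis by (simp only: case_prod_unfold)
qed

lemma ev_coact_form:
  assumes "x \<in> words_deg Forms1 2"
  shows "ev X (\<lambda>w. word_form (letters w) t s Y) (coact (coact_form q) x) = tensor_form x t s (X + Y)"
proof -
  let ?L = "\<lambda>w. word_form (letters w) t s Y"
  have "ev X ?L (coact (coact_form q) (fscale c (mon w))) = c * word_form (letters w) t s (X + Y)"
    if wk: "w \<in> Poly_Mapping.keys x" for c w
  proof -
    obtain u v where w: "w = Word [u, v]" "u \<in> Forms1" "v \<in> Forms1" using words_deg_2_induct(2)[OF assms wk] by blast
    have "ev X ?L (coact (coact_form q) (fscale c (mon w)))
        = (\<Sum>(a, ms)\<leftarrow>coact_list (coact_form q) [u, v]. a X * (c * word_form ms t s Y))"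
      unfolding coact_mon w by (simp add: ev_sum_list case_prod_unfold ev_otimes)
    also have "\<dots> = (\<Sum>(a, u')\<leftarrow>coact_form q u. \<Sum>(b, v')\<leftarrow>coact_form q v. (a \<star> b) X * (c * word_form [u', v'] t s Y))"
      by (rule coact_list_2)
    also have "\<dots> = c * (\<Sum>(a, u')\<leftarrow>coact_form q u. \<Sum>(b, v')\<leftarrow>coact_form q v. (a \<star> b) X * rmul u' (v' s) t Y)"
      by (simp add: case_prod_unfold mult_ac flip: sum_list_const_mult)
    also have "\<dots> = c * word_form (letters w) t s (X + Y)"
      unfolding rmul_coact[OF w(2,3), symmetric] by (simp add: w)
    finally show ?thesis .
  qed
  then have "ev X ?L (coact (coact_form q) (\<Sum>w\<in>Poly_Mapping.keys x. fscale (Poly_Mapping.lookup x w) (mon w)))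
      = (\<Sum>w\<in>Poly_Mapping.keys x. Poly_Mapping.lookup x w * word_form (letters w) t s (X + Y))"
    by (simp add: coact_sum ev_sum)
  then show ?thesis
    unfolding words_deg_2_induct(1)[OF assms, symmetric] by (simp add: tensor_form_def lsum_def)
qed

lemma coact_form_list:
  assumes "x \<in> words_deg Forms1 2"
  shows "\<exists>ps. set ps \<subseteq> AA \<times> words_deg Forms1 2 \<and> coact (coact_form q) x = (\<Sum>p\<leftarrow>ps. otimes (fst p) (snd p))"
proof -
  let ?T = "\<lambda>x. \<exists>ps. set ps \<subseteq> AA \<times> words_deg Forms1 2 \<and> coact (coact_form q) x = (\<Sum>p\<leftarrow>ps. otimes (fst p) (snd p))"
  have add: "?T (x + y)" if T: "?T x" "?T y" for x y
  proof -
    obtain ps qs where "set ps \<subseteq> AA \<times> words_deg Forms1 2" "coact (coact_form q) x = (\<Sum>p\<leftarrow>ps. otimes (fst p) (snd p))"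
      "set qs \<subseteq> AA \<times> words_deg Forms1 2" "coact (coact_form q) y = (\<Sum>p\<leftarrow>qs. otimes (fst p) (snd p))" using T by blast
    then show ?thesis by (intro exI[of _ "ps @ qs"]) (simp add: coact_add)
  qed
  have word: "?T (fscale c (mon w))" if wk: "w \<in> Poly_Mapping.keys x" for w c
  proof -
    obtain u v where w: "w = Word [u, v]" "u \<in> Forms1" "v \<in> Forms1" using words_deg_2_induct(2)[OF assms wk] by blast
    let ?ps = "map (\<lambda>(p, p'). (fst p \<star> fst p', fscale c (lett (snd p) * lett (snd p')))) (List.product (coact_form q u) (coact_form q v))"
    have "set ?ps \<subseteq> AA \<times> words_deg Forms1 2"
    proof
      fix z assume "z \<in> set ?ps"
      then obtain p p' where z: "z = (fst p \<star> fst p', fscale c (lett (snd p) * lett (snd p')))"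
        "p \<in> set (coact_form q u)" "p' \<in> set (coact_form q v)" by auto
      have "p \<in> AA \<times> Forms1" "p' \<in> AA \<times> Forms1" using z(2,3) coact_form(1) w(2,3) by blast+
      then show "z \<in> AA \<times> words_deg Forms1 2" unfolding z(1) by (intro SigmaI A_conv words_deg_scale words_deg_lett2) auto
    qed
    moreover have "coact (coact_form q) (fscale c (mon w)) = (\<Sum>p\<leftarrow>?ps. otimes (fst p) (snd p))"
    proof -
      have pr: "(\<Sum>z\<leftarrow>map (\<lambda>(x, y). f x y) (List.product xs ys). z) = (\<Sum>x\<leftarrow>xs. \<Sum>y\<leftarrow>ys. f x y)" for f :: "fnl \<times> form1 \<Rightarrow> fnl \<times> form1 \<Rightarrow> form1 word \<Rightarrow>\<^sub>0 fnl" and xs ys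
        by (induction xs) (simp_all add: comp_def)
      have "coact (coact_form q) (fscale c (mon w)) = (\<Sum>p\<leftarrow>coact_form q u. \<Sum>p'\<leftarrow>coact_form q v. otimes (fst p \<star> fst p') (fscale c (lett (snd p) * lett (snd p'))))"
        unfolding w(1) coact_mon word.sel unfolding coact_list_2 unfolding lett_mult case_prod_unfold ..
      also have "\<dots> = (\<Sum>p\<leftarrow>?ps. otimes (fst p) (snd p))"
        unfolding pr[symmetric] by (simp only: map_map comp_def case_prod_unfold fst_conv snd_conv)
      finally show ?thesis .
    qed
    ultimately show ?thesis by blast
  qed
  have "?T (\<Sum>w\<in>S. fscale (Poly_Mapping.lookup x w) (mon w))" if "finite S" "S \<subseteq> Poly_Mapping.keys x" for S
    using that
  proof (induction S rule: finite_induct)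
    case empty
    show ?case by (intro exI[of _ "[]"]) simp
  next
    case (insert w S)
    then show ?case using add[OF word] by simp
  qed
  from this[of "Poly_Mapping.keys x"] show ?thesis
    using words_deg_2_induct(1)[OF assms] by simp
qed

text \<open>A vanishing element of A \<otimes> \<open>Forms2\<close> must be shown to vanish after
  lifting, although the lift is linear only modulo the ideal. The list is shortened step by step: a
  first leg depending on the others is eliminated at the cost of a term in A \<otimes> J, and an
  independent one has second leg 0.\<close>

lemma otimes_Pm_zero:
  "set ps \<subseteq> AA \<times> Forms2 \<Longrightarrow> (\<And>X t s Y. (\<Sum>p\<leftarrow>ps. fst p X * snd p t s Y) = 0)
    \<Longrightarrow> (\<Sum>p\<leftarrow>ps. otimes (fst p) (lift_form (snd p))) \<in> otimes_set AA O.J"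
proof (induction "length ps" arbitrary: ps)
  case 0
  then show ?case using otimes_set_zero by simp
next
  case (Suc n)
  then obtain a m ps' where ps: "ps = (a, m) # ps'" by (cases ps) auto
  have len: "n = length ps'" using Suc.hyps(2) ps by simp
  have a: "a \<in> AA" and m: "m \<in> Forms2" and ps': "set ps' \<subseteq> AA \<times> Forms2" using Suc.prems(1) ps by auto
  have zero: "a X * m t s Y + (\<Sum>p\<leftarrow>ps'. fst p X * snd p t s Y) = 0" for X t s Y
    using Suc.prems(2)[of X t s Y] unfolding ps by simp
  show ?case
  proof (cases "a \<in> fn.span (fst ` set ps')")
    case True
    then obtain qs where qs: "map snd qs = ps'" "a = (\<Sum>r\<leftarrow>qs. csc (fst r) (fst (snd r)))" using span_list by blast
    \<comment> \<open>The second leg m of the removed pair is distributed over the remaining pairs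
      according to the linear dependence of a.\<close>
    define f where "f r = (\<lambda>t s. snd (snd r) t s + csc (fst r) (m t s))" for r :: "complex \<times> fnl \<times> form2"
    let ?qs = "map (\<lambda>r. (fst (snd r), f r)) qs"
    have qsM: "fst (snd r) \<in> AA" "snd (snd r) \<in> Forms2" if "r \<in> set qs" for r
    proof -
      have "snd r \<in> set ps'" using that qs(1) by (metis image_eqI set_map)
      then show "fst (snd r) \<in> AA" "snd (snd r) \<in> Forms2" using ps' by auto
    qed
    have IH: "(\<Sum>p\<leftarrow>?qs. otimes (fst p) (lift_form (snd p))) \<in> otimes_set AA O.J"
    proof (rule Suc.hyps(1))
      show "n = length ?qs" using len qs(1) by auto
      show "set ?qs \<subseteq> AA \<times> Forms2" using qsM m by (auto simp: f_def intro!: Forms2_add Forms2_scale)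
      fix X t s Y
      have "(\<Sum>p\<leftarrow>?qs. fst p X * snd p t s Y) = (\<Sum>r\<leftarrow>qs. fst (snd r) X * snd (snd r) t s Y) + (\<Sum>r\<leftarrow>qs. fst r * fst (snd r) X) * m t s Y"
        unfolding sum_list_mult_const[symmetric] sum_list_addf[symmetric] by (simp add: f_def comp_def algebra_simps)
      also have "(\<Sum>r\<leftarrow>qs. fst (snd r) X * snd (snd r) t s Y) = (\<Sum>p\<leftarrow>ps'. fst p X * snd p t s Y)"
        unfolding qs(1)[symmetric] by (simp add: comp_def)
      also have "(\<Sum>r\<leftarrow>qs. fst r * fst (snd r) X) = a X"
        unfolding qs(2) by (simp add: sum_list_fun_apply)
      finally show "(\<Sum>p\<leftarrow>?qs. fst p X * snd p t s Y) = 0" using zero[of X t s Y] by (simp add: algebra_simps)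
    qed
    have "(\<Sum>p\<leftarrow>ps. otimes (fst p) (lift_form (snd p))) - (\<Sum>p\<leftarrow>?qs. otimes (fst p) (lift_form (snd p)))
      = (\<Sum>r\<leftarrow>qs. otimes (fst (snd r)) (fscale (fst r) (lift_form m) + lift_form (snd (snd r)) - lift_form (f r)))"
    proof -
      have "(\<Sum>p\<leftarrow>ps. otimes (fst p) (lift_form (snd p))) = otimes a (lift_form m) + (\<Sum>r\<leftarrow>qs. otimes (fst (snd r)) (lift_form (snd (snd r))))"
        unfolding ps qs(1)[symmetric] by (simp add: comp_def)
      also have "otimes a (lift_form m) = (\<Sum>r\<leftarrow>qs. otimes (fst (snd r)) (fscale (fst r) (lift_form m)))"
        unfolding qs(2) otimes_sum_list_left otimes_linear(3) ..
      finally show ?thesis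
        by (simp only: map_map comp_def fst_conv snd_conv otimes_linear(2,6) sum_list_addf sum_list_subtractf)
    qed
    also have "\<dots> \<in> otimes_set AA O.J"
    proof (intro otimes_set_sum_list otimes_set_base)
      fix r assume r: "r \<in> set qs"
      show "fst (snd r) \<in> AA" using qsM[OF r] by blast
      have "O.cong (lift_form (f r)) (lift_form (snd (snd r)) + lift_form (\<lambda>t s. csc (fst r) (m t s)))"
        unfolding f_def by (intro lift_form_add qsM[OF r] Forms2_scale m)
      also have "O.cong \<dots> (lift_form (snd (snd r)) + fscale (fst r) (lift_form m))" by (intro O.cong_add O.cong_refl lift_form_scale m)
      finally have "O.cong (lift_form (snd (snd r)) + fscale (fst r) (lift_form m)) (lift_form (f r))" by (rule O.cong_sym)
      then show "fscale (fst r) (lift_form m) + lift_form (snd (snd r)) - lift_form (f r) \<in> O.J" by (simp add: O.cong_def add.commute)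
    qed
    finally have "(\<Sum>p\<leftarrow>ps. otimes (fst p) (lift_form (snd p))) - (\<Sum>p\<leftarrow>?qs. otimes (fst p) (lift_form (snd p))) \<in> otimes_set AA O.J" .
    from otimes_set_add[OF this IH] show ?thesis by simp
  next
    case False
    have "m t s Y = 0" for t s Y
    proof (rule ccontr)
      assume ne: "m t s Y \<noteq> 0"
      \<comment> \<open>A nonzero entry of m would allow the vanishing sum to be solved for a,
        contradicting independence.\<close>
      have aeq: "a = (\<Sum>p\<leftarrow>ps'. csc (- snd p t s Y / m t s Y) (fst p))"
      proof
        fix X
        have "m t s Y * a X = - (\<Sum>p\<leftarrow>ps'. fst p X * snd p t s Y)"
          using zero[of X t s Y] by (simp add: eq_neg_iff_add_eq_0 mult.commute)
        then have "a X = - (\<Sum>p\<leftarrow>ps'. fst p X * snd p t s Y) / m t s Y" using ne by (simp add: field_simps)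
        also have "\<dots> = (\<Sum>p\<leftarrow>ps'. (- snd p t s Y / m t s Y) * fst p X)"
          unfolding divide_inverse uminus_sum_list_map sum_list_mult_const[symmetric] by (simp add: comp_def mult_ac)
        finally show "a X = (\<Sum>p\<leftarrow>ps'. csc (- snd p t s Y / m t s Y) (fst p)) X"
          by (simp add: sum_list_fun_apply)
      qed
      have sp: "(\<Sum>p\<leftarrow>rs. csc (h p) (fst p)) \<in> fn.span (fst ` set rs)" for rs :: "(fnl \<times> form2) list" and h
      proof (induction rs)
        case Nil
        show ?case by (simp only: list.map sum_list.Nil fn.span_zero)
      next
        case (Cons r rs)
        have "fn.span (fst ` set rs) \<subseteq> fn.span (fst ` set (r # rs))" by (intro fn.span_mono) auto
        then have "(\<Sum>p\<leftarrow>rs. csc (h p) (fst p)) \<in> fn.span (fst ` set (r # rs))" using Cons by blast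
        moreover have "csc (h r) (fst r) \<in> fn.span (fst ` set (r # rs))" by (intro fn.span_scale fn.span_base) simp
        ultimately show ?case by (simp only: list.map sum_list.Cons fn.span_add)
      qed
      have "a \<in> fn.span (fst ` set ps')"
        using sp[of "\<lambda>p. - snd p t s Y / m t s Y" ps'] by (simp only: aeq[symmetric])
      with False show False by contradiction
    qed
    then have m0: "m = (\<lambda>t s. 0)" by (simp add: fun_eq_iff)
    have "otimes a (lift_form m) \<in> otimes_set AA O.J" unfolding m0 by (intro otimes_set_base a lift_form_zero)
    moreover have "(\<Sum>p\<leftarrow>ps'. otimes (fst p) (lift_form (snd p))) \<in> otimes_set AA O.J"
    proof (rule Suc.hyps(1)[OF len ps'])
      show "(\<Sum>p\<leftarrow>ps'. fst p X * snd p t s Y) = 0" for X t s Y using zero[of X t s Y] m0 by simp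
    qed
    ultimately have "otimes a (lift_form m) + (\<Sum>p\<leftarrow>ps'. otimes (fst p) (lift_form (snd p))) \<in> otimes_set AA O.J" by (rule otimes_set_add)
    then show ?thesis unfolding ps by simp
  qed
qed

text \<open>The difference of the coaction of z and 1 \<otimes> z has zero image in A \<otimes>
  \<open>Forms2\<close>, because the coproduct of a multiple of the unit is explicit; lifting back
  introduces only errors in A \<otimes> J.\<close>

lemma coact_form_coinvariant:
  assumes z: "z \<in> words_deg Forms1 2" "tensor_form z = (\<lambda>t s. csc (k t s) unit)"
  shows "coact (coact_form q) z - otimes unit z \<in> otimes_set AA O.J"
proof -
  obtain ps where ps: "set ps \<subseteq> AA \<times> words_deg Forms1 2" "coact (coact_form q) z = (\<Sum>p\<leftarrow>ps. otimes (fst p) (snd p))"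
    using coact_form_list[OF z(1)] by blast
  have zM: "tensor_form z \<in> Forms2" by (rule tensor_form_reduce(2)[OF z(1)])
  \<comment> \<open>The first pair stands for - 1 \<otimes> z, the others for the coaction of
    z.\<close>
  define qs where "qs = (csc (-1) unit, tensor_form z) # map (\<lambda>p. (fst p, tensor_form (snd p))) ps"
  have "(\<Sum>p\<leftarrow>qs. otimes (fst p) (lift_form (snd p))) \<in> otimes_set AA O.J"
  proof (rule otimes_Pm_zero)
    show "set qs \<subseteq> AA \<times> Forms2"
      unfolding qs_def using zM ps(1) tensor_form_reduce(2) A_minus[OF A_zero A_unit] by auto
    fix X t s Y
    have "tensor_form z t s (X + Y) = (\<Sum>p\<leftarrow>ps. fst p X * tensor_form (snd p) t s Y)"
      unfolding ev_coact_form[OF z(1), symmetric] ps(2) ev_sum_list ev_otimes by (simp add: tensor_form_def)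
    moreover have "tensor_form z t s (X + Y) = unit X * tensor_form z t s Y" unfolding z(2) by (simp add: unit_def)
    ultimately show "(\<Sum>p\<leftarrow>qs. fst p X * snd p t s Y) = 0" unfolding qs_def by (simp add: comp_def)
  qed
  moreover have "(\<Sum>p\<leftarrow>ps. otimes (fst p) (snd p - lift_form (tensor_form (snd p)))) \<in> otimes_set AA O.J"
  proof (intro otimes_set_sum_list otimes_set_base)
    fix p assume "p \<in> set ps"
    then have p: "fst p \<in> AA" "snd p \<in> words_deg Forms1 2" using ps(1) by auto
    then show "fst p \<in> AA" by blast
    show "snd p - lift_form (tensor_form (snd p)) \<in> O.J" using tensor_form_reduce(1)[OF p(2)] by (simp only: O.cong_def)
  qed
  moreover have "otimes unit (lift_form (tensor_form z) - z) \<in> otimes_set AA O.J"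
    using O.cong_sym[OF tensor_form_reduce(1)[OF z(1)]] by (intro otimes_set_base A_unit) (simp only: O.cong_def)
  ultimately have "((\<Sum>p\<leftarrow>qs. otimes (fst p) (lift_form (snd p))) + (\<Sum>p\<leftarrow>ps. otimes (fst p) (snd p - lift_form (tensor_form (snd p))))) + otimes unit (lift_form (tensor_form z) - z) \<in> otimes_set AA O.J"
    by (intro otimes_set_add)
  moreover have "((\<Sum>p\<leftarrow>qs. otimes (fst p) (lift_form (snd p))) + (\<Sum>p\<leftarrow>ps. otimes (fst p) (snd p - lift_form (tensor_form (snd p))))) + otimes unit (lift_form (tensor_form z) - z)
      = coact (coact_form q) z - otimes unit z"
  proof -
    have neg: "otimes (csc (-1) unit) y = - otimes unit y" for y :: "form1 free_alg"
    proof -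
      have "csc (-1) unit = - unit" by (simp add: fun_eq_iff)
      then show ?thesis by (simp only: otimes_linear)
    qed
    show ?thesis
      unfolding qs_def ps(2) by (simp add: comp_def otimes_linear(6,8) sum_list_subtractf neg)
  qed
  ultimately show ?thesis by simp
qed

text \<open>The two-form that Takeuchi's equivalence attaches to 1 \<otimes> (f \<wedge> e) for the
  root \<gamma>.\<close>

definition coinv_form :: "root \<Rightarrow> form1 free_alg" where "coinv_form \<gamma> = lift_form (\<lambda>t s. csc (fe \<gamma> t s) unit)"

lemma fe_M2: "(\<lambda>t s. csc (fe \<gamma> t s) unit) \<in> Forms2"
proof -
  have "csc (fe \<gamma> t s) unit \<in> Aw (wt t + wt s)" for t s
  proof (cases "fe \<gamma> t s = 0")
    case True
    then show ?thesis using fn.subspace_0[OF subspace_Aw] by simp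
  next
    case False
    then have "wt t + wt s = 0" by (auto simp: fe_def wt_sum_zero)
    then show ?thesis using fn.subspace_scale[OF subspace_Aw homA_Aw[OF homA_unit]] by simp
  qed
  then show ?thesis by (simp add: Forms2_def)
qed

lemma coinv_form_combination:
  "(\<Sum>\<gamma>\<in>UNIV. fscale (c \<gamma>) (coinv_form \<gamma>)) \<in> words_deg Forms1 2"
  "tensor_form (\<Sum>\<gamma>\<in>UNIV. fscale (c \<gamma>) (coinv_form \<gamma>)) = (\<lambda>t s. csc (\<Sum>\<gamma>\<in>UNIV. c \<gamma> * fe \<gamma> t s) unit)"
proof -
  show "(\<Sum>\<gamma>\<in>UNIV. fscale (c \<gamma>) (coinv_form \<gamma>)) \<in> words_deg Forms1 2"
    unfolding coinv_form_def by (intro words_deg_sum words_deg_scale lift_form_deg fe_M2)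
  show "tensor_form (\<Sum>\<gamma>\<in>UNIV. fscale (c \<gamma>) (coinv_form \<gamma>)) = (\<lambda>t s. csc (\<Sum>\<gamma>\<in>UNIV. c \<gamma> * fe \<gamma> t s) unit)"
    by (intro ext) (simp add: sum_root tensor_form_linear coinv_form_def tensor_form_Pm[OF fe_M2] algebra_simps)
qed

lemma Omega_coinv_eq: "Omega_coinv q 2 = qspan (Omega_ideal q) ((\<lambda>\<gamma>. cls (Omega_ideal q) (coinv_form \<gamma>)) ` UNIV)"
proof -
  have fin: "finite (UNIV :: root set)" by (simp add: UNIV_root)
  have coinv: "C \<in> Omega_coinv q 2 \<longleftrightarrow> (\<exists>x. C = cls O.J x \<and> x \<in> words_deg Forms1 2 \<and>
      (\<exists>s\<in>otimes_set {0} (words_on Forms1). \<exists>t\<in>otimes_set AA O.J. coact (coact_form q) x - otimes unit x = s + t))" for C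
    unfolding Omega_coinv_def Omega_ideal_eq Omega1_eq by (rule coinvariants_iff[OF O.J_neg])
  have "C \<in> Omega_coinv q 2 \<longleftrightarrow> (\<exists>c. C = cls O.J (\<Sum>\<gamma>\<in>UNIV. fscale (c \<gamma>) (coinv_form \<gamma>)))" for C
    unfolding coinv
  proof (intro iffI)
    assume "\<exists>x. C = cls O.J x \<and> x \<in> words_deg Forms1 2 \<and>
      (\<exists>s\<in>otimes_set {0} (words_on Forms1). \<exists>t\<in>otimes_set AA O.J. coact (coact_form q) x - otimes unit x = s + t)"
    then obtain x s t where x: "C = cls O.J x" "x \<in> words_deg Forms1 2" and s: "s \<in> otimes_set {0} (words_on Forms1)"
      and t: "t \<in> otimes_set AA O.J" and eq: "coact (coact_form q) x - otimes unit x = s + t" by blast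
    obtain ss where ss: "s = (\<Sum>(a, y)\<leftarrow>ss. otimes a y)" "set ss \<subseteq> {0} \<times> words_on Forms1" using s by (auto simp: otimes_set_def)
    obtain ts where ts: "t = (\<Sum>(a, y)\<leftarrow>ts. otimes a y)" "set ts \<subseteq> AA \<times> O.J" using t by (auto simp: otimes_set_def)
    define m where "m = tensor_form x"
    have mM: "m \<in> Forms2" unfolding m_def by (rule tensor_form_reduce(2)[OF x(2)])
    \<comment> \<open>Evaluating the first leg at X and the coefficients of the second at the empty
      word turns coinvariance into the statement that m is its value at 1 times the unit, modulo
      W.\<close>
    have inv: "(\<lambda>t s. m t s X - unit X * m t s 0) \<in> W" for X
    proof -
      have "m t' s' X - unit X * m t' s' 0 = (\<Sum>(a, y)\<leftarrow>ts. (\<lambda>t s. a X * tensor_form y t s 0)) t' s'" for t' s'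
      proof -
        let ?ev = "ev X (\<lambda>w. word_form (letters w) t' s' 0)"
        have "?ev s = (\<Sum>p\<leftarrow>ss. 0)"
          unfolding ss(1) ev_sum_list case_prod_unfold ev_otimes using ss(2)
          by (intro arg_cong[where f = sum_list] map_cong) fastforce+
        then have "?ev (s + t) = (\<Sum>(a, y)\<leftarrow>ts. a X * tensor_form y t' s' 0)"
          unfolding ts(1) by (simp add: ev_add ev_sum_list case_prod_unfold ev_otimes tensor_form_def)
        moreover have "?ev (coact (coact_form q) x - otimes unit x) = m t' s' X - unit X * m t' s' 0"
          unfolding ev_minus ev_coact_form[OF x(2)] ev_otimes by (simp add: m_def tensor_form_def)
        ultimately show ?thesis using eq by (simp add: sum_list_fun_apply case_prod_unfold)
      qed
      then have "(\<lambda>t s. m t s X - unit X * m t s 0) = (\<Sum>(a, y)\<leftarrow>ts. (\<lambda>t s. a X * tensor_form y t s 0))"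
        by (intro ext)
      also have "\<dots> \<in> W"
        using ts(2) tensor_form_Omega_ideal unfolding Omega_ideal_eq case_prod_unfold by (intro W_sum_list W_scale) auto
      finally show ?thesis .
    qed
    \<comment> \<open>At X = K_i the left-hand side is known, because the entry of m at (t, s) has
      right weight \<open>wt t + wt s\<close>.\<close>
    have "(\<lambda>t s. (qc powi (wt t i + wt s i) - 1) * m t s 0) \<in> W" for i
    proof -
      have "m t s (Word [K i]) = qc powi (wt t i + wt s i) * m t s 0" for t s
      proof -
        have "m t s \<in> Aw (wt t + wt s)" using mM by (simp add: Forms2_def)
        then have "rt (K i) (m t s) 0 = qc powi (wt t i + wt s i) * m t s 0" by (simp add: Aw_def)
        then show ?thesis by (simp add: rt_apply)
      qed
      then show ?thesis using inv[of "Word [K i]"] by (simp add: algebra_simps)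
    qed
    from W_normal_form[OF this] obtain c where c: "(\<lambda>t s. m t s 0) - (\<lambda>t s. \<Sum>\<gamma>\<in>UNIV. c \<gamma> * fe \<gamma> t s) \<in> W" by blast
    let ?z = "\<Sum>\<gamma>\<in>UNIV. fscale (c \<gamma>) (coinv_form \<gamma>)"
    have d: "x - ?z \<in> words_deg Forms1 2"
      using words_deg_add[OF x(2) words_deg_scale[OF coinv_form_combination(1), of "-1" c]] by simp
    have "(\<lambda>t s. tensor_form (x - ?z) t s Y) \<in> W" for Y
    proof -
      \<comment> \<open>At every word Y, m is congruent to eps(Y) times its value at 1, and that
        value to the chosen combination of the \<open>fe\<close>.\<close>
      have "(\<lambda>t s. m t s Y - unit Y * m t s 0) + (\<lambda>t s. unit Y * ((\<lambda>t s. m t s 0) - (\<lambda>t s. \<Sum>\<gamma>\<in>UNIV. c \<gamma> * fe \<gamma> t s)) t s) \<in> W"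
        by (intro W_add W_scale inv c)
      moreover have "(\<lambda>t s. m t s Y - unit Y * m t s 0) + (\<lambda>t s. unit Y * ((\<lambda>t s. m t s 0) - (\<lambda>t s. \<Sum>\<gamma>\<in>UNIV. c \<gamma> * fe \<gamma> t s)) t s)
          = (\<lambda>t s. tensor_form (x - ?z) t s Y)"
        unfolding tensor_form_linear coinv_form_combination(2) m_def by (intro ext) (simp add: algebra_simps)
      ultimately show ?thesis by simp
    qed
    then have "lift_form (tensor_form (x - ?z)) \<in> O.J" by (intro lift_form_W tensor_form_reduce(2)[OF d])
    then have "x - ?z \<in> O.J" using O.cong_mem[OF tensor_form_reduce(1)[OF d]] by blast
    then show "\<exists>c. C = cls O.J (\<Sum>\<gamma>\<in>UNIV. fscale (c \<gamma>) (coinv_form \<gamma>))" using x(1) O.cls_eq_iff O.cong_def by blast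
  next
    assume "\<exists>c. C = cls O.J (\<Sum>\<gamma>\<in>UNIV. fscale (c \<gamma>) (coinv_form \<gamma>))"
    then obtain c where C: "C = cls O.J (\<Sum>\<gamma>\<in>UNIV. fscale (c \<gamma>) (coinv_form \<gamma>))" by blast
    let ?z = "\<Sum>\<gamma>\<in>UNIV. fscale (c \<gamma>) (coinv_form \<gamma>)"
    have "coact (coact_form q) ?z - otimes unit ?z \<in> otimes_set AA O.J"
      by (rule coact_form_coinvariant[OF coinv_form_combination])
    moreover have "coact (coact_form q) ?z - otimes unit ?z = 0 + (coact (coact_form q) ?z - otimes unit ?z)" by simp
    ultimately show "\<exists>x. C = cls O.J x \<and> x \<in> words_deg Forms1 2 \<and>
      (\<exists>s\<in>otimes_set {0} (words_on Forms1). \<exists>t\<in>otimes_set AA O.J. coact (coact_form q) x - otimes unit x = s + t)"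
      using C coinv_form_combination(1) otimes_set_zero by blast
  qed
  then show ?thesis
    unfolding Omega_ideal_eq O.qspan_eq[OF fin] by blast
qed

text \<open>Evaluating the coefficients at the empty word sends the ideal into W, modulo which the
  \<open>fe\<close> are independent.\<close>

lemma coinv_form_independent:
  assumes "(\<Sum>\<gamma>\<in>UNIV. fscale (c \<gamma>) (coinv_form \<gamma>)) \<in> Omega_ideal q" shows "c \<gamma> = 0"
proof -
  have "(\<lambda>t s. \<Sum>\<gamma>\<in>UNIV. c \<gamma> * fe \<gamma> t s) \<in> W"
    using tensor_form_Omega_ideal[OF assms, of 0] unfolding coinv_form_combination(2) by simp
  then show ?thesis by (rule fe_independent)
qed

lemma qdim_Omega_coinv: "qdim (Omega_ideal q) (Omega_coinv q 2) 3"
  unfolding qdim_def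
proof (intro exI conjI allI impI)
  define r :: "nat \<Rightarrow> root" where "r i = (if i = 0 then A1 else if i = 1 then A2 else A12)" for i
  have i3: "{..<3} = {0, 1, 2::nat}" by auto
  have "(\<lambda>i. cls (Omega_ideal q) (coinv_form (r i))) ` {..<3} = (\<lambda>\<gamma>. cls (Omega_ideal q) (coinv_form \<gamma>)) ` UNIV"
    unfolding i3 UNIV_root by (simp add: r_def)
  then show "Omega_coinv q 2 = qspan (Omega_ideal q) ((\<lambda>i. cls (Omega_ideal q) (coinv_form (r i))) ` {..<3})"
    using Omega_coinv_eq by simp
  fix c :: "nat \<Rightarrow> complex" and i :: nat
  assume c: "cls (Omega_ideal q) (\<Sum>i<3. fscale (c i) (coinv_form (r i))) = cls (Omega_ideal q) 0" and i: "i < 3"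
  define d where "d \<gamma> = (case \<gamma> of A1 \<Rightarrow> c 0 | A2 \<Rightarrow> c 1 | A12 \<Rightarrow> c 2)" for \<gamma>
  have "(\<Sum>i<3. fscale (c i) (coinv_form (r i))) = (\<Sum>\<gamma>\<in>UNIV. fscale (d \<gamma>) (coinv_form \<gamma>))"
    unfolding i3 sum_root by (simp add: r_def d_def add.assoc)
  then have "(\<Sum>\<gamma>\<in>UNIV. fscale (d \<gamma>) (coinv_form \<gamma>)) \<in> Omega_ideal q"
    using c unfolding Omega_ideal_eq O.cls_eq_iff by (simp add: O.cong_def)
  then have "d (r i) = 0" by (rule coinv_form_independent)
  moreover have "i = 0 \<or> i = 1 \<or> i = 2" using i by auto
  ultimately show "c i = 0" by (auto simp: d_def r_def)
qed

end

theorem lemma6p3: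
  fixes q :: real
  assumes "q \<notin> {-1, 0, 1}"
  shows "qdim (Omega_ideal q) (Omega_coinv q 2) 3 \<and>
    V_coinv q 2 = qspan (V_ideal q)
      {wedge q (f_form A1) (e_form A1), wedge q (f_form A2) (e_form A2), wedge q (f_form A12) (e_form A12)}"
proof -
  interpret quantum_parameter q by standard (fact assms)
  have "(\<lambda>\<gamma>. cls (V_ideal q) (lett (f_form \<gamma>) * lett (e_form \<gamma>))) ` UNIV
      = {wedge q (f_form A1) (e_form A1), wedge q (f_form A2) (e_form A2), wedge q (f_form A12) (e_form A12)}"
    unfolding UNIV_root wedge_def by simp
  then show ?thesis using qdim_Omega_coinv V_coinv_eq by simp
qed

end
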